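(* There is an a.e. continuous graphon $U$ that is computable in $d_\square$ (i.e. has a computable $d_\square$-name), such that if $V$ is any graphon weakly isomorphic to $U$, then any $d_1$-name for $V$ computes the halting problem $0'$.
   Context: $\lambda$ is Lebesgue measure. A graphon is a symmetric measurable function $W\colon[0,1]^2\to[0,1]$. A graphon $W$ is a.e. continuous if there is a set $X\subseteq[0,1]^2$ with $\lambda(X)=1$ such that $W|_X$ is continuous with respect to the subspace topology on $X$ (here for the usual topology on $[0,1]^2$). For symmetric measurable $F\colon[0,1]^2\to[-1,1]$, $\|F\|_\square=\sup_{S,T\subseteq[0,1]}\left|\int_{S\times T}F(x,y)\,dx\,dy\right|$ (over measurable $S,T$) and $\|F\|_1=\int|F(x,y)|\,dx\,dy$. For graphons $U,W$: $d_\square(U,W)=\|U-W\|_\square$ and $d_1(U,W)=\|U-W\|_1$. Graphons $U,W$ are weakly isomorphic if $\inf_\varphi d_\square(U,W^\varphi)=0$, where $\varphi$ ranges over measure-preserving maps of $([0,1],\lambda)$ to itself and $W^\varphi(x,y)=W(\varphi(x),\varphi(y))$; equivalently (a known theorem), there are measure-preserving maps $\varphi,\psi\colon[0,1]\to[0,1]$ with $U^\varphi=W^\psi$ a.e. Let $\mathcal{S}=(s_i)_{i\in\mathbb{N}}$ be a (straightforward) computable enumeration of the graphons that are constant with a rational value on each product $p\times q$ of parts $p,q$ of a partition of $[0,1]$ into finitely many equally-sized intervals. For $d\in\{d_1,d_\square\}$, a $d$-name of a graphon $U$ is a sequence $(s_{k_j})_{j\in\mathbb{N}}$ of elements of $\mathcal{S}$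 with $d(s_{k_j},s_{k_\ell})\le2^{-j}$ for all $j<\ell$ and $d(s_{k_j},U)\to0$; it is identified with its index sequence $(k_j)_j$, and is computable if that sequence is. $0'=\{e\in\mathbb{N}:\{e\}(0)\text{ halts}\}$ is the halting set, where $\{e\}$ is the partial computable function given by program $e$. *)

theory Defs
  imports "HOL-Analysis.Analysis" "HOL-Library.Nat_Bijection"
begin

section \<open>Oracle computability\<close>

text \<open>Partial recursive functions relative to an oracle \<open>g :: nat \<Rightarrow> nat\<close>. All programs are unary; several
  arguments are passed through the Cantor pairing function \<^const>\<open>prod_encode\<close>. The basic functions
  are zero, successor, the two projections of the pairing function and the oracle, closed under
  pairing, composition, primitive recursion and unbounded minimisation.\<close>

datatype prog =
    Zero | Succ | Left | Right | Oracle
  | Pair prog prog | Comp prog prog | Prec prog prog | Mu prog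

text \<open>\<open>eval g p x\<close> is the value of \<open>p\<close> with oracle \<open>g\<close> at \<open>x\<close>, and \<^const>\<open>None\<close> if the computation
  diverges. \<^term>\<open>Mu p\<close> searches for the least zero of \<open>p\<close> in its second argument; it
  diverges if \<open>p\<close> diverges anywhere before that zero.\<close>

primrec eval :: "(nat \<Rightarrow> nat) \<Rightarrow> prog \<Rightarrow> nat \<Rightarrow> nat option" where
  "eval g Zero = (\<lambda>x. Some 0)"
| "eval g Succ = (\<lambda>x. Some (Suc x))"
| "eval g Left = (\<lambda>x. Some (fst (prod_decode x)))"
| "eval g Right = (\<lambda>x. Some (snd (prod_decode x)))"
| "eval g Oracle = (\<lambda>x. Some (g x))"
| "eval g (Pair p q) = (\<lambda>x. Option.bind (eval g p x)
      (\<lambda>a. Option.bind (eval g q x) (\<lambda>b. Some (prod_encode (a, b)))))"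
| "eval g (Comp p q) = (\<lambda>x. Option.bind (eval g q x) (eval g p))"
| "eval g (Prec p q) = (\<lambda>x. case prod_decode x of (a, n) \<Rightarrow>
      rec_nat (eval g p a)
        (\<lambda>m r. Option.bind r (\<lambda>y. eval g q (prod_encode (a, prod_encode (m, y))))) n)"
| "eval g (Mu p) = (\<lambda>x.
      if \<exists>n. eval g p (prod_encode (x, n)) = Some 0 \<and>
            (\<forall>m<n. eval g p (prod_encode (x, m)) \<noteq> None)
      then Some (LEAST n. eval g p (prod_encode (x, n)) = Some 0)
      else None)"

primrec prog_code :: "prog \<Rightarrow> nat" where
  "prog_code Zero = 0"
| "prog_code Succ = 1"
| "prog_code Left = 2"
| "prog_code Right = 3"
| "prog_code Oracle = 4"
| "prog_code (Pair p q) = 5 + 4 * prod_encode (prog_code p, prog_code q)"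
| "prog_code (Comp p q) = 6 + 4 * prod_encode (prog_code p, prog_code q)"
| "prog_code (Prec p q) = 7 + 4 * prod_encode (prog_code p, prog_code q)"
| "prog_code (Mu p) = 8 + 4 * prog_code p"

lemma inj_prog_code: "inj prog_code"
proof (rule injI)
  have neq: "5 + 4 * a \<noteq> 6 + 4 * b" "5 + 4 * a \<noteq> 7 + 4 * b" "5 + 4 * a \<noteq> 8 + 4 * b"
    "6 + 4 * a \<noteq> 7 + 4 * b" "6 + 4 * a \<noteq> 8 + 4 * b" "7 + 4 * a \<noteq> 8 + 4 * b" for a b :: nat
    by presburger+
  fix p q show "prog_code p = prog_code q \<Longrightarrow> p = q"
  proof (induction p arbitrary: q)
    case Zero then show ?case by (cases q) auto
  next
    case Succ then show ?case by (cases q) auto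
  next
    case Left then show ?case by (cases q) auto
  next
    case Right then show ?case by (cases q) auto
  next
    case Oracle then show ?case by (cases q) auto
  next
    case (Pair p1 p2)
    then show ?case by (cases q) (auto simp: neq neq[symmetric])
  next
    case (Comp p1 p2)
    then show ?case by (cases q) (auto simp: neq neq[symmetric])
  next
    case (Prec p1 p2)
    then show ?case by (cases q) (auto simp: neq neq[symmetric])
  next
    case (Mu p)
    then show ?case by (cases q) (auto simp: neq neq[symmetric])
  qed
qed

lemma surj_prog_code: "surj prog_code"
proof -
  have "\<exists>p. prog_code p = n" for n
  proof (induction n rule: less_induct)
    case (less n)
    show ?case
    proof (cases "n < 5")
      case True
      then consider "n = 0" | "n = 1" | "n = 2" | "n = 3" | "n = 4" by linarith
      then show ?thesis
        using prog_code.simps(1-5) by cases metis+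
    next
      case False
      define m where "m = (n - 5) div 4"
      obtain a b where ab: "prod_decode m = (a, b)" by fastforce
      then have m: "m = prod_encode (a, b)" by (metis prod_decode_inverse)
      have mn: "m < n" using False unfolding m_def by linarith
      have "a < n" "b < n"
        using le_prod_encode_1[of a b] le_prod_encode_2[of b a] mn m by auto
      then obtain p q where pq: "prog_code p = a" "prog_code q = b" using less by metis
      obtain r where r: "prog_code r = m" using less mn by metis
      consider "n = 5 + 4 * m" | "n = 6 + 4 * m" | "n = 7 + 4 * m" | "n = 8 + 4 * m"
        using False unfolding m_def by linarith
      then show ?thesis
      proof cases
        case 1
        then have "prog_code (Pair p q) = n" using pq m by simp
        then show ?thesis ..
      next
        case 2
        then have "prog_code (Comp p q) = n" using pq m by simp
        then show ?thesis ..
      next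
        case 3
        then have "prog_code (Prec p q) = n" using pq m by simp
        then show ?thesis ..
      next
        case 4
        then have "prog_code (Mu r) = n" using r by simp
        then show ?thesis ..
      qed
    qed
  qed
  then show ?thesis by (metis surj_def)
qed

lemma bij_prog_code: "bij prog_code"
  using inj_prog_code surj_prog_code by (simp add: bij_def)

text \<open>Computability without an oracle is computability relative to the constant zero oracle.\<close>

definition partial_computable_fun :: "nat \<Rightarrow> nat \<Rightarrow> nat option" where
  "partial_computable_fun e = eval (\<lambda>_. 0) (inv prog_code e)"

definition halting_set :: "nat set" where
  "halting_set = {e. partial_computable_fun e 0 \<noteq> None}"

definition computable :: "(nat \<Rightarrow> nat) \<Rightarrow> bool" where
  "computable f \<longleftrightarrow> (\<exists>e. \<forall>n. partial_computable_fun e n = Some (f n))"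

definition computes_set :: "(nat \<Rightarrow> nat) \<Rightarrow> nat set \<Rightarrow> bool" where
  "computes_set g A \<longleftrightarrow> (\<exists>p. \<forall>n. eval g p n = Some (if n \<in> A then 1 else 0))"


section \<open>Graphons\<close>

text \<open>A graphon is represented by a function on the plane of which only the values on the unit square
  matter: none of the notions below depends on its values elsewhere.\<close>

abbreviation unit_square :: "(real \<times> real) set" where
  "unit_square \<equiv> {0..1} \<times> {0..1}"

definition graphon :: "(real \<times> real \<Rightarrow> real) \<Rightarrow> bool" where
  "graphon W \<longleftrightarrow> W \<in> borel_measurable (lebesgue_on unit_square) \<and>
     (\<forall>z\<in>unit_square. 0 \<le> W z \<and> W z \<le> 1) \<and>
     (\<forall>x\<in>{0..1}. \<forall>y\<in>{0..1}. W (x, y) = W (y, x))"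

definition ae_continuous :: "(real \<times> real \<Rightarrow> real) \<Rightarrow> bool" where
  "ae_continuous W \<longleftrightarrow> (\<exists>X \<in> sets lebesgue. X \<subseteq> unit_square \<and> emeasure lebesgue X = 1 \<and>
     continuous_on X W)"

definition cut_norm :: "(real \<times> real \<Rightarrow> real) \<Rightarrow> real" where
  "cut_norm F = (SUP (S, T) \<in> {A \<in> sets lebesgue. A \<subseteq> {0..1}} \<times> {A \<in> sets lebesgue. A \<subseteq> {0..1}}.
     \<bar>LINT z:S \<times> T|lebesgue. F z\<bar>)"

definition L1_norm :: "(real \<times> real \<Rightarrow> real) \<Rightarrow> real" where
  "L1_norm F = (LINT z:unit_square|lebesgue. \<bar>F z\<bar>)"

definition cut_dist :: "(real \<times> real \<Rightarrow> real) \<Rightarrow> (real \<times> real \<Rightarrow> real) \<Rightarrow> real" where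
  "cut_dist U W = cut_norm (\<lambda>z. U z - W z)"

definition L1_dist :: "(real \<times> real \<Rightarrow> real) \<Rightarrow> (real \<times> real \<Rightarrow> real) \<Rightarrow> real" where
  "L1_dist U W = L1_norm (\<lambda>z. U z - W z)"

definition measure_preserving_maps :: "(real \<Rightarrow> real) set" where
  "measure_preserving_maps = {\<phi> \<in> lebesgue_on {0..1} \<rightarrow>\<^sub>M lebesgue_on {0..1}.
     distr (lebesgue_on {0..1}) (lebesgue_on {0..1}) \<phi> = lebesgue_on {0..1}}"

definition pullback :: "(real \<Rightarrow> real) \<Rightarrow> (real \<times> real \<Rightarrow> real) \<Rightarrow> real \<times> real \<Rightarrow> real" where
  "pullback \<phi> W = (\<lambda>(x, y). W (\<phi> x, \<phi> y))"

definition weakly_isomorphic :: "(real \<times> real \<Rightarrow> real) \<Rightarrow> (real \<times> real \<Rightarrow> real) \<Rightarrow> bool" where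
  "weakly_isomorphic U W \<longleftrightarrow> (INF \<phi>\<in>measure_preserving_maps. cut_dist U (pullback \<phi> W)) = 0"


section \<open>Rational step graphons and names\<close>

text \<open>Index of the part of \<open>x\<close> in the partition of the unit interval into the \<open>n\<close> intervals
  \<open>[p/n, (p+1)/n)\<close> for \<open>p < n\<close>, the last of which is closed.\<close>

definition part_index :: "nat \<Rightarrow> real \<Rightarrow> nat" where
  "part_index n x = min (nat \<lfloor>real n * x\<rfloor>) (n - 1)"

text \<open>A surjection from the natural numbers onto the rationals in the unit interval.\<close>

definition rat_value :: "nat \<Rightarrow> real" where
  "rat_value c = (case prod_decode c of (a, b) \<Rightarrow> min 1 (real a / real (Suc b)))"

text \<open>The number \<open>prod_encode (m, c)\<close> codes the graphon with \<open>m + 1\<close> parts whose value on the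
  product of parts \<open>p\<close> and \<open>q\<close> with \<open>q \<le> p\<close> (and on its transpose) is coded by the entry at position
  \<open>p (p + 1) / 2 + q\<close> of the list coded by \<open>c\<close>. Entries beyond the end of the list are \<open>0\<close>.\<close>

definition step_graphon :: "nat \<Rightarrow> real \<times> real \<Rightarrow> real" where
  "step_graphon i = (case prod_decode i of (m, c) \<Rightarrow> \<lambda>(x, y).
     let vs = list_decode c;
         p = part_index (Suc m) x; q = part_index (Suc m) y;
         k = triangle (max p q) + min p q
     in if k < length vs then rat_value (vs ! k) else 0)"

definition is_name ::
  "((real \<times> real \<Rightarrow> real) \<Rightarrow> (real \<times> real \<Rightarrow> real) \<Rightarrow> real) \<Rightarrow> (nat \<Rightarrow> nat) \<Rightarrow> (real \<times> real \<Rightarrow> real) \<Rightarrow> bool"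
  where
  "is_name d k U \<longleftrightarrow>
     (\<forall>j l. j < l \<longrightarrow> d (step_graphon (k j)) (step_graphon (k l)) \<le> 1 / 2 ^ j) \<and>
     (\<lambda>j. d (step_graphon (k j)) U) \<longlonglongrightarrow> 0"

subsection \<open>The enumeration has the intended range\<close>

lemma rat_value_bounds: "0 \<le> rat_value c" "rat_value c \<le> 1"
  by (auto simp: rat_value_def split: prod.split)

lemma rat_value_Rats: "rat_value c \<in> \<rat>"
  by (auto simp: rat_value_def min_def split: prod.split)

lemma rat_value_surj:
  assumes "r \<in> \<rat>" "0 \<le> r" "r \<le> 1"
  shows "\<exists>c. rat_value c = r"
proof -
  obtain a b :: nat where ab: "b \<noteq> 0" "\<bar>r\<bar> = real a / real b"
    using Rats_abs_nat_div_natE[OF assms(1)] by metis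
  then obtain b' where "b = Suc b'" using not0_implies_Suc by blast
  with ab assms have "rat_value (prod_encode (a, b')) = r"
    by (simp add: rat_value_def)
  then show ?thesis ..
qed

lemma part_index_less: "0 < n \<Longrightarrow> part_index n x < n"
  by (auto simp: part_index_def)

lemma step_graphon_form:
  obtains n w where "0 < n" "\<And>p q. w p q \<in> \<rat> \<and> 0 \<le> w p q \<and> w p q \<le> 1 \<and> w p q = w q p"
    "\<And>x y. step_graphon i (x, y) = w (part_index n x) (part_index n y)"
proof -
  obtain m c where mc: "prod_decode i = (m, c)" by fastforce
  define w where "w = (\<lambda>p q. let k = triangle (max p q) + min p q
     in if k < length (list_decode c) then rat_value (list_decode c ! k) else 0)"
  show ?thesis
  proof (rule that[of "Suc m" w])
    show "w p q \<in> \<rat> \<and> 0 \<le> w p q \<and> w p q \<le> 1 \<and> w p q = w q p" for p q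
      by (auto simp: w_def Let_def rat_value_bounds rat_value_Rats max.commute min.commute)
    show "step_graphon i (x, y) = w (part_index (Suc m) x) (part_index (Suc m) y)" for x y
      by (simp add: step_graphon_def mc w_def Let_def)
  qed simp
qed

lemma step_graphon_surj:
  assumes n: "0 < n"
    and w: "\<And>p q. p < n \<Longrightarrow> q < n \<Longrightarrow> w p q \<in> \<rat> \<and> 0 \<le> w p q \<and> w p q \<le> 1 \<and> w p q = w q p"
  shows "\<exists>i. \<forall>x y. step_graphon i (x, y) = w (part_index n x) (part_index n y)"
proof -
  obtain m where m: "n = Suc m" using n gr0_conv_Suc by blast
  define code where "code = (\<lambda>p q. SOME c. rat_value c = w p q)"
  have code: "rat_value (code p q) = w p q" if "p < n" "q < n" for p q
    unfolding code_def using rat_value_surj w[OF that] by (metis (mono_tags, lifting) someI_ex)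
  define vs where "vs = map (\<lambda>k. case prod_decode k of (a, b) \<Rightarrow> code (a + b) a) [0..<triangle n]"
  have tri: "triangle p + q < triangle n" if "q \<le> p" "p < n" for p q
  proof -
    have mono: "triangle a \<le> triangle (a + b)" for a b by (induction b) auto
    have "triangle p + q < triangle (Suc p)" using that by simp
    also have "\<dots> \<le> triangle n" using mono[of "Suc p" "n - Suc p"] that by simp
    finally show ?thesis .
  qed
  have entry: "rat_value (vs ! (triangle p + q)) = w p q" "triangle p + q < length vs"
    if "q \<le> p" "p < n" for p q
  proof -
    have "prod_encode (q, p - q) = triangle p + q"
      using that by (simp add: prod_encode_def)
    then have "prod_decode (triangle p + q) = (q, p - q)"
      using prod_encode_inverse[of "(q, p - q)"] by simp
    then show "rat_value (vs ! (triangle p + q)) = w p q"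
      using tri[OF that] that code[of p q] by (simp add: vs_def)
    show "triangle p + q < length vs" using tri[OF that] by (simp add: vs_def)
  qed
  have "step_graphon (prod_encode (m, list_encode vs)) (x, y)
      = w (part_index n x) (part_index n y)" for x y
  proof -
    define p q where pq: "p = part_index n x" "q = part_index n y"
    have "p < n" "q < n" using part_index_less[OF n] pq by auto
    moreover have "w (max p q) (min p q) = w p q"
      using w calculation by (auto simp: max_def min_def)
    ultimately show ?thesis
      using entry[of "min p q" "max p q"]
      by (simp add: step_graphon_def Let_def pq m)
  qed
  then show ?thesis by blast
qed

lemma graphon_step_graphon: "graphon (step_graphon i)"
proof -
  obtain n w where nw: "0 < n" "\<And>p q. w p q \<in> \<rat> \<and> 0 \<le> w p q \<and> w p q \<le> 1 \<and> w p q = w q p"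
    "\<And>x y. step_graphon i (x, y) = w (part_index n x) (part_index n y)"
    using step_graphon_form by metis
  have meas: "part_index n \<in> borel \<rightarrow>\<^sub>M count_space UNIV"
    unfolding part_index_def by measurable
  have eq: "step_graphon i
      = (\<lambda>z. w (part_index n (fst z)) (part_index n (snd z)))"
    using nw(3) by auto
  have "step_graphon i \<in> borel_measurable borel"
  proof -
    have "(\<lambda>z::real \<times> real. part_index n (fst z)) \<in> borel \<rightarrow>\<^sub>M count_space UNIV"
      "(\<lambda>z::real \<times> real. part_index n (snd z)) \<in> borel \<rightarrow>\<^sub>M count_space UNIV"
      using meas by (auto intro!: measurable_compose[OF _ meas] borel_measurable_continuous_onI continuous_intros)
    then show ?thesis unfolding eq by measurable
  qed
  then have "step_graphon i \<in> borel_measurable (lebesgue_on unit_square)"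
    by (intro measurable_restrict_space1 measurable_completion) simp
  then show ?thesis
    using nw(2,3) by (auto simp: graphon_def)
qed

end

theory Submission
  imports Defs
begin

text \<open>
  Place disjoint blocks \<open>B\<^sub>0, B\<^sub>1, \<dots>\<close> with \<open>\<lambda>(B\<^sub>e) = 2\<^sup>-\<^sup>e\<^sup>-\<^sup>1\<close> on the diagonal. On \<open>B\<^sub>e \<times> B\<^sub>e\<close> the graphon is
  constantly \<open>1/2\<close> if program \<open>e\<close> does not halt; if a halting computation is first found at stage
  \<open>w\<close>, it is the \<open>{0,1}\<close>-valued pattern of a Hadamard matrix so large that it is within
  \<open>2\<^sup>-\<^sup>w\<close> of \<open>1/2\<close> in cut norm. Hence replacing \<open>1/2\<close> by the pattern when \<open>e\<close> is seen to halt keeps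
  the name \<open>d\<^sub>\<box>\<close>-Cauchy. On the other hand \<open>\<integral>W (1 - W)\<close> is \<open>1\<close>-Lipschitz for \<open>d\<^sub>1\<close>, and it is
  invariant under weak isomorphism because \<open>\<integral>W\<^sup>2\<close> is lower semicontinuous for the cut norm (in both
  directions, measure-preserving maps being isometries). For our graphon it equals
  \<open>\<Sum>{4\<^sup>-\<^sup>e\<^sup>-\<^sup>2 | e \<notin> 0'}\<close>, and the base-4 digits of this number decide \<open>0'\<close>.
\<close>

section \<open>Functions computable relative to an oracle\<close>

text \<open>Since \<open>V\<close> is only weakly isomorphic to the graphon, its blocks cannot be
  located, and only an invariant of weak isomorphism can be read off from a name. An invariant that
  is effectively continuous for the cut norm, such as a subgraph density, is useless: it can already
  be computed from the computable cut-norm name. The integral of \<open>W * (1 - W)\<close> escapes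
  this because it is continuous for the \<open>L1\<close> distance but only semicontinuous for the
  cut norm: a quasirandom pattern of zeros and ones in place of \<open>1/2\<close> makes it drop
  while hardly moving the graphon in cut norm. Drops caused by different programs are told apart by
  size: a block square has area \<open>4^-(e+1)\<close>, and digits 0 and 1 in base 4 leave a gap,
  so precision proportional to \<open>4^-e\<close> settles the digit of \<open>e\<close>. Powers of
  two govern blocks and patterns alike; hence each stage is a step graphon on one dyadic grid, and
  all discontinuities lie on countably many lines. \<open>eval\<close> has no step count, so the
  search for halting computations runs over finite certificates instead.\<close>

definition recf :: "(nat \<Rightarrow> nat) \<Rightarrow> (nat \<Rightarrow> nat) \<Rightarrow> bool" where
  "recf g f \<longleftrightarrow> (\<exists>p. \<forall>x. eval g p x = Some (f x))"

definition decf :: "(nat \<Rightarrow> nat) \<Rightarrow> (nat \<Rightarrow> bool) \<Rightarrow> bool" where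
  "decf g P \<longleftrightarrow> recf g (\<lambda>x. of_bool (P x))"

abbreviation pfst :: "nat \<Rightarrow> nat" where "pfst x \<equiv> fst (prod_decode x)"
abbreviation psnd :: "nat \<Rightarrow> nat" where "psnd x \<equiv> snd (prod_decode x)"

named_theorems recf_intros

lemma computable_iff_recf: "computable f \<longleftrightarrow> recf (\<lambda>_. 0) f"
proof -
  have "(\<exists>e. Q (inv prog_code e)) \<longleftrightarrow> (\<exists>p. Q p)" for Q
    by (metis bij_prog_code bij_inv_eq_iff)
  then show ?thesis
    unfolding computable_def partial_computable_fun_def recf_def .
qed

lemma recf_comp: "recf g f \<Longrightarrow> recf g h \<Longrightarrow> recf g (\<lambda>x. f (h x))"
  unfolding recf_def
proof (elim exE)
  fix p q assume "\<forall>x. eval g p x = Some (f x)" "\<forall>x. eval g q x = Some (h x)"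
  then show "\<exists>p. \<forall>x. eval g p x = Some (f (h x))"
    by (intro exI[of _ "Comp p q"]) simp
qed

lemma recf_Suc [recf_intros]: "recf g h \<Longrightarrow> recf g (\<lambda>x. Suc (h x))"
  by (rule recf_comp[of g Suc]) (auto simp: recf_def intro: exI[of _ Succ])

lemma recf_pfst [recf_intros]: "recf g h \<Longrightarrow> recf g (\<lambda>x. pfst (h x))"
  by (rule recf_comp[of g pfst]) (auto simp: recf_def intro: exI[of _ Left])

lemma recf_psnd [recf_intros]: "recf g h \<Longrightarrow> recf g (\<lambda>x. psnd (h x))"
  by (rule recf_comp[of g psnd]) (auto simp: recf_def intro: exI[of _ Right])

lemma recf_oracle: "recf g h \<Longrightarrow> recf g (\<lambda>x. g (h x))"
  by (rule recf_comp[of g g]) (auto simp: recf_def intro: exI[of _ Oracle])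

lemma recf_pair [recf_intros]:
  "recf g f \<Longrightarrow> recf g h \<Longrightarrow> recf g (\<lambda>x. prod_encode (f x, h x))"
  unfolding recf_def
proof (elim exE)
  fix p q assume "\<forall>x. eval g p x = Some (f x)" "\<forall>x. eval g q x = Some (h x)"
  then show "\<exists>p. \<forall>x. eval g p x = Some (prod_encode (f x, h x))"
    by (intro exI[of _ "Pair p q"]) simp
qed

lemma recf_id [recf_intros]: "recf g (\<lambda>x. x)"
  unfolding recf_def by (intro exI[of _ "Pair Left Right"]) simp

lemma recf_const [recf_intros]: "recf g (\<lambda>x. c)"
proof (induction c)
  case 0
  then show ?case unfolding recf_def by (intro exI[of _ Zero]) simp
qed (rule recf_Suc)

text \<open>\<open>Prec\<close> hands its parameter on to base and step, so running it on the pair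
  of \<open>x\<close> and \<open>n x\<close> covers recursions whose base, step and length all
  depend on \<open>x\<close>.\<close>

lemma recf_rec [recf_intros]:
  assumes "recf g a" "recf g n"
    and "recf g (\<lambda>z. s (pfst z) (pfst (psnd z)) (psnd (psnd z)))"
  shows "recf g (\<lambda>x. rec_nat (a x) (s x) (n x))"
proof -
  obtain p q where p: "\<And>x. eval g p x = Some (a x)"
    and q: "\<And>z. eval g q z = Some (s (pfst z) (pfst (psnd z)) (psnd (psnd z)))"
    using assms(1,3) unfolding recf_def by metis
  have "eval g (Prec p q) z = Some (rec_nat (a (pfst z)) (s (pfst z)) (psnd z))" for z
  proof -
    have "rec_nat (eval g p b) (\<lambda>m r. Option.bind r
        (\<lambda>y. eval g q (prod_encode (b, prod_encode (m, y))))) k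
        = Some (rec_nat (a b) (s b) k)" for b k
      by (induction k) (simp_all add: p q)
    then show ?thesis by (simp add: case_prod_beta)
  qed
  then have "recf g (\<lambda>z. rec_nat (a (pfst z)) (s (pfst z)) (psnd z))"
    unfolding recf_def by blast
  from recf_comp[OF this recf_pair[OF recf_id assms(2)]]
  show ?thesis by simp
qed

section \<open>Arithmetic by primitive recursion\<close>

lemma recf_add [recf_intros]:
  assumes [THEN recf_comp, recf_intros]: "recf g a" "recf g b"
  shows "recf g (\<lambda>x. a x + b x)"
proof -
  have "rec_nat u (\<lambda>_ r. Suc r) v = u + v" for u v by (induction v) simp_all
  moreover have "recf g (\<lambda>x. rec_nat (a x) (\<lambda>_ r. Suc r) (b x))"
    by (intro recf_intros)
  ultimately show ?thesis by simp
qed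

text \<open>\<open>THEN recf_comp\<close> turns the assumptions into rules for
  \<open>a (h x)\<close>: inside the step of a recursion the argument \<open>x\<close> has become
  \<open>pfst z\<close>, where the bare assumption would not apply.\<close>

lemma recf_mult [recf_intros]:
  assumes [THEN recf_comp, recf_intros]: "recf g a" "recf g b"
  shows "recf g (\<lambda>x. a x * b x)"
proof -
  have "rec_nat 0 (\<lambda>_ r. r + u) v = u * v" for u v :: nat by (induction v) simp_all
  moreover have "recf g (\<lambda>x. rec_nat 0 (\<lambda>_ r. r + a x) (b x))"
    by (intro recf_intros)
  ultimately show ?thesis by simp
qed

lemma recf_power [recf_intros]:
  assumes [THEN recf_comp, recf_intros]: "recf g a" "recf g b"
  shows "recf g (\<lambda>x. a x ^ b x)"
proof -
  have "rec_nat 1 (\<lambda>_ r. r * u) v = u ^ v" for u v :: nat by (induction v) simp_all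
  moreover have "recf g (\<lambda>x. rec_nat 1 (\<lambda>_ r. r * a x) (b x))"
    by (intro recf_intros)
  ultimately show ?thesis by simp
qed

lemma recf_diff [recf_intros]:
  assumes [THEN recf_comp, recf_intros]: "recf g a" "recf g b"
  shows "recf g (\<lambda>x. a x - b x)"
proof -
  have pred: "recf g (\<lambda>x. c x - 1)" if [THEN recf_comp, recf_intros]: "recf g c" for c
  proof -
    have "rec_nat 0 (\<lambda>m _. m) v = v - 1" for v :: nat by (cases v) simp_all
    moreover have "recf g (\<lambda>x. rec_nat 0 (\<lambda>m _. m) (c x))" by (intro recf_intros)
    ultimately show ?thesis by simp
  qed
  have "rec_nat u (\<lambda>_ r. r - 1) v = u - v" for u v :: nat by (induction v) simp_all
  moreover have "recf g (\<lambda>x. rec_nat (a x) (\<lambda>_ r. r - 1) (b x))"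
    by (intro recf_intros pred)
  ultimately show ?thesis by simp
qed

lemma recf_sum [recf_intros]:
  assumes [THEN recf_comp, recf_intros]: "recf g n"
    and f: "recf g (\<lambda>z. f (pfst z) (psnd z))"
  shows "recf g (\<lambda>x. \<Sum>i<n x. f x i)"
proof -
  have f': "recf g (\<lambda>x. f (h x) (k x))"
    if "recf g h" "recf g k" for h k
    using recf_comp[OF f recf_pair[OF that]] by simp
  have "rec_nat 0 (\<lambda>i r. r + f x i) v = (\<Sum>i<v. f x i)" for x v by (induction v) simp_all
  moreover have "recf g (\<lambda>x. rec_nat 0 (\<lambda>i r. r + f x i) (n x))"
    by (intro recf_intros f')
  ultimately show ?thesis by simp
qed

section \<open>Case distinctions, decidable predicates and bounded quantifiers\<close>

lemma recf_if [recf_intros]: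
  assumes P: "decf g P"
    and [THEN recf_comp, recf_intros]: "recf g a" "recf g b"
  shows "recf g (\<lambda>x. if P x then a x else b x)"
proof -
  have [THEN recf_comp, recf_intros]: "recf g (\<lambda>x. of_bool (P x))"
    using P by (simp add: decf_def)
  have "recf g (\<lambda>x. of_bool (P x) * a x + (1 - of_bool (P x)) * b x)"
    by (intro recf_intros)
  moreover have "of_bool Q * u + (1 - of_bool Q) * v = (if Q then u else v)"
    for Q and u v :: nat by simp
  ultimately show ?thesis by simp
qed

lemma recf_of_bool [recf_intros]: "decf g P \<Longrightarrow> recf g (\<lambda>x. of_bool (P x))"
  by (simp add: decf_def)

lemma decf_less [recf_intros]:
  assumes [recf_intros]: "recf g a" "recf g b"
  shows "decf g (\<lambda>x. a x < b x)"
proof -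
  have "recf g (\<lambda>x. 1 - (1 - (b x - a x)))" by (intro recf_intros)
  moreover have "of_bool (u < v) = 1 - (1 - (v - u))" for u v :: nat by simp
  ultimately show ?thesis unfolding decf_def by simp
qed

lemma decf_not [recf_intros]:
  assumes [recf_intros]: "decf g P"
  shows "decf g (\<lambda>x. \<not> P x)"
proof -
  have "recf g (\<lambda>x. 1 - of_bool (P x))" by (intro recf_intros)
  moreover have "of_bool (\<not> Q) = 1 - (of_bool Q :: nat)" for Q by simp
  ultimately show ?thesis unfolding decf_def by (simp only:)
qed

lemma decf_conj [recf_intros]:
  assumes [recf_intros]: "decf g P" "decf g Q"
  shows "decf g (\<lambda>x. P x \<and> Q x)"
proof -
  have "recf g (\<lambda>x. of_bool (P x) * of_bool (Q x))" by (intro recf_intros)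
  then show ?thesis unfolding decf_def by (simp add: of_bool_conj)
qed

lemma decf_imp [recf_intros]:
  assumes [recf_intros]: "decf g P" "decf g Q"
  shows "decf g (\<lambda>x. P x \<longrightarrow> Q x)"
proof -
  have "decf g (\<lambda>x. \<not> (P x \<and> \<not> Q x))" by (intro recf_intros)
  then show ?thesis by simp
qed

lemma decf_disj [recf_intros]:
  assumes [recf_intros]: "decf g P" "decf g Q"
  shows "decf g (\<lambda>x. P x \<or> Q x)"
proof -
  have "decf g (\<lambda>x. \<not> P x \<longrightarrow> Q x)" by (intro recf_intros)
  then show ?thesis by (simp add: disj_imp)
qed

lemma decf_if [recf_intros]:
  assumes [recf_intros]: "decf g P" "decf g Q" "decf g R"
  shows "decf g (\<lambda>x. if P x then Q x else R x)"
proof -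
  have "decf g (\<lambda>x. (P x \<longrightarrow> Q x) \<and> (\<not> P x \<longrightarrow> R x))" by (intro recf_intros)
  then show ?thesis by (simp add: if_bool_eq_conj)
qed

lemma decf_le [recf_intros]:
  assumes [recf_intros]: "recf g a" "recf g b"
  shows "decf g (\<lambda>x. a x \<le> b x)"
proof -
  have "decf g (\<lambda>x. \<not> b x < a x)" by (intro recf_intros)
  then show ?thesis by (simp add: not_less)
qed

lemma decf_eq [recf_intros]:
  assumes [recf_intros]: "recf g a" "recf g b"
  shows "decf g (\<lambda>x. a x = b x)"
proof -
  have "decf g (\<lambda>x. a x \<le> b x \<and> b x \<le> a x)" by (intro recf_intros)
  then show ?thesis by (simp add: order_class.order_eq_iff)
qed

lemma decf_ex_less [recf_intros]:
  assumes [recf_intros]: "recf g n"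
    and P: "decf g (\<lambda>z. P (pfst z) (psnd z))"
  shows "decf g (\<lambda>x. \<exists>i<n x. P x i)"
proof -
  have "decf g (\<lambda>x. 0 < (\<Sum>i<n x. of_bool (P x i) :: nat))"
    by (intro recf_intros P)
  moreover have "0 < (\<Sum>i<v. of_bool (Q i) :: nat) \<longleftrightarrow> (\<exists>i<v. Q i)" for Q and v :: nat
    by (induction v) (auto simp: less_Suc_eq simp del: sum_of_bool_eq)
  ultimately show ?thesis by simp
qed

lemma decf_all_less [recf_intros]:
  assumes [recf_intros]: "recf g n" "decf g (\<lambda>z. P (pfst z) (psnd z))"
  shows "decf g (\<lambda>x. \<forall>i<n x. P x i)"
proof -
  have "decf g (\<lambda>x. \<not> (\<exists>i<n x. \<not> P x i))" by (intro recf_intros)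
  then show ?thesis by simp
qed

lemma recf_div [recf_intros]:
  assumes [THEN recf_comp, recf_intros]: "recf g a" "recf g b"
  shows "recf g (\<lambda>x. a x div b x)"
proof -
  \<comment> \<open>The quotient counts the positive multiples of \<open>v\<close> up to
    \<open>u\<close>; the guard \<open>0 < v\<close> yields the convention
    \<open>u div 0 = 0\<close>.\<close>
  have "u div v = (\<Sum>i<u. of_bool (0 < v \<and> Suc i * v \<le> u))" for u v :: nat
  proof (cases "v = 0")
    case False
    then have "{i. i < u \<and> 0 < v \<and> Suc i * v \<le> u} = {..<u div v}"
      by (auto simp: less_eq_div_iff_mult_less_eq[symmetric] Suc_le_eq simp del: mult_Suc
          intro: less_le_trans[OF _ div_le_dividend])
    moreover have "{..<u} \<inter> {i. 0 < v \<and> Suc i * v \<le> u} = {i. i < u \<and> 0 < v \<and> Suc i * v \<le> u}"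
      by auto
    ultimately show ?thesis by (simp del: mult_Suc)
  qed simp
  moreover have "recf g (\<lambda>x. \<Sum>i<a x. of_bool (0 < b x \<and> Suc i * b x \<le> a x))"
    by (intro recf_intros)
  ultimately show ?thesis by simp
qed

lemma recf_mod [recf_intros]:
  assumes [recf_intros]: "recf g a" "recf g b"
  shows "recf g (\<lambda>x. a x mod b x)"
  unfolding minus_div_mult_eq_mod[symmetric] by (intro recf_intros)

section \<open>The halting set is recursively enumerable\<close>

text \<open>A halting computation is certified by a number \<open>D\<close> coding (via \<^const>\<open>set_decode\<close>) a finite set of
  triples \<open>(e, x, y)\<close>, read as ``program \<open>e\<close> maps \<open>x\<close> to \<open>y\<close>'', in which every triple follows from others
  by one evaluation step. Circular justifications are harmless: a triple refers only to
  proper subprograms, or to the same primitive recursion with a smaller counter.\<close>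

definition inset :: "nat \<Rightarrow> nat \<Rightarrow> nat \<Rightarrow> nat \<Rightarrow> bool" where
  "inset D e x y \<longleftrightarrow> prod_encode (e, prod_encode (x, y)) \<in> set_decode D"

text \<open>The residue of \<open>e - 5\<close> modulo 4 recovers the outermost constructor from the
  code. Witnesses are bounded by \<open>D\<close> to keep the predicate decidable; nothing is lost,
  as every result recorded in \<open>D\<close> is smaller than \<open>D\<close>. Code 4 is the
  oracle, here constantly 0.\<close>

definition justified :: "nat \<Rightarrow> nat \<Rightarrow> nat \<Rightarrow> nat \<Rightarrow> bool" where
  "justified D e x y \<longleftrightarrow>
    (if e = 0 \<or> e = 4 then y = 0
     else if e = 1 then y = Suc x
     else if e = 2 then y = pfst x
     else if e = 3 then y = psnd x
     else if (e - 5) mod 4 = 0 then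
       inset D (pfst ((e - 5) div 4)) x (pfst y) \<and> inset D (psnd ((e - 5) div 4)) x (psnd y)
     else if (e - 5) mod 4 = 1 then
       \<exists>z<D. inset D (psnd ((e - 5) div 4)) x z \<and> inset D (pfst ((e - 5) div 4)) z y
     else if (e - 5) mod 4 = 2 then
       (if psnd x = 0 then inset D (pfst ((e - 5) div 4)) (pfst x) y
        else \<exists>z<D. inset D e (prod_encode (pfst x, psnd x - 1)) z \<and>
          inset D (psnd ((e - 5) div 4)) (prod_encode (pfst x, prod_encode (psnd x - 1, z))) y)
     else inset D ((e - 5) div 4) (prod_encode (x, y)) 0 \<and>
       (\<forall>m<y. \<exists>z<D. inset D ((e - 5) div 4) (prod_encode (x, m)) (Suc z)))"

definition halting_witness :: "nat \<Rightarrow> nat \<Rightarrow> bool" where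
  "halting_witness e D \<longleftrightarrow>
    (\<forall>c<D. c \<in> set_decode D \<longrightarrow> justified D (pfst c) (pfst (psnd c)) (psnd (psnd c))) \<and>
    (\<exists>y<D. inset D e 0 y)"

lemma decf_halting_witness [recf_intros]:
  assumes [THEN recf_comp, recf_intros]: "recf g a" "recf g b"
  shows "decf g (\<lambda>x. halting_witness (a x) (b x))"
proof -
  have [recf_intros]: "decf g (\<lambda>x. c x \<in> set_decode (d x))"
    if [recf_intros]: "recf g c" "recf g d" for c d
    unfolding set_decode_def mem_Collect_eq odd_iff_mod_2_eq_one by (intro recf_intros)
  show ?thesis
    unfolding halting_witness_def justified_def inset_def
    by (intro recf_intros)
qed

lemma less_if_in_set_decode: "c \<in> set_decode D \<Longrightarrow> c < D"
proof -
  assume "c \<in> set_decode D"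
  then have "D div 2 ^ c \<noteq> 0" unfolding set_decode_def by (metis even_zero mem_Collect_eq)
  then have "2 ^ c \<le> D" by (metis div_less not_less)
  then show ?thesis using less_exp[of c] by linarith
qed

lemma inset_less: "inset D e x y \<Longrightarrow> y < D"
  using less_if_in_set_decode le_prod_encode_2 unfolding inset_def
  by (meson le_trans not_less)

text \<open>The rules on programs instead of codes, with the bounds on \<open>z\<close> removed by
  \<open>inset_less\<close>; all later arguments use this form.\<close>

lemma justified_prog:
  "justified D (prog_code Zero) x y \<longleftrightarrow> y = 0"
  "justified D (prog_code Succ) x y \<longleftrightarrow> y = Suc x"
  "justified D (prog_code Left) x y \<longleftrightarrow> y = pfst x"
  "justified D (prog_code Right) x y \<longleftrightarrow> y = psnd x"
  "justified D (prog_code Oracle) x y \<longleftrightarrow> y = 0"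
  "justified D (prog_code (Pair p q)) x y \<longleftrightarrow>
    inset D (prog_code p) x (pfst y) \<and> inset D (prog_code q) x (psnd y)"
  "justified D (prog_code (Comp p q)) x y \<longleftrightarrow>
    (\<exists>z. inset D (prog_code q) x z \<and> inset D (prog_code p) z y)"
  "justified D (prog_code (Prec p q)) x y \<longleftrightarrow>
    (if psnd x = 0 then inset D (prog_code p) (pfst x) y
     else \<exists>z. inset D (prog_code (Prec p q)) (prod_encode (pfst x, psnd x - 1)) z \<and>
       inset D (prog_code q) (prod_encode (pfst x, prod_encode (psnd x - 1, z))) y)"
  "justified D (prog_code (Mu p)) x y \<longleftrightarrow>
    inset D (prog_code p) (prod_encode (x, y)) 0 \<and>
    (\<forall>m<y. \<exists>z. inset D (prog_code p) (prod_encode (x, m)) (Suc z))"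
proof -
  have mod: "(1 + 4 * a) mod 4 = 1" "(2 + 4 * a) mod 4 = 2" "(3 + 4 * a) mod 4 = 3"
    "(1 + 4 * a) div 4 = a" "(2 + 4 * a) div 4 = a" "(3 + 4 * a) div 4 = a" for a :: nat
    by presburger+
  have diff: "6 + 4 * a - 5 = 1 + 4 * a" "7 + 4 * a - 5 = 2 + 4 * a" "8 + 4 * a - 5 = 3 + 4 * a"
    for a :: nat by simp_all
  show "justified D (prog_code Zero) x y \<longleftrightarrow> y = 0"
    "justified D (prog_code Succ) x y \<longleftrightarrow> y = Suc x"
    "justified D (prog_code Left) x y \<longleftrightarrow> y = pfst x"
    "justified D (prog_code Right) x y \<longleftrightarrow> y = psnd x"
    "justified D (prog_code Oracle) x y \<longleftrightarrow> y = 0"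
    "justified D (prog_code (Pair p q)) x y \<longleftrightarrow>
      inset D (prog_code p) x (pfst y) \<and> inset D (prog_code q) x (psnd y)"
    by (simp_all add: justified_def)
  show "justified D (prog_code (Comp p q)) x y \<longleftrightarrow>
    (\<exists>z. inset D (prog_code q) x z \<and> inset D (prog_code p) z y)"
    unfolding justified_def prog_code.simps diff mod by (auto dest: inset_less)
  show "justified D (prog_code (Prec p q)) x y \<longleftrightarrow>
    (if psnd x = 0 then inset D (prog_code p) (pfst x) y
     else \<exists>z. inset D (prog_code (Prec p q)) (prod_encode (pfst x, psnd x - 1)) z \<and>
       inset D (prog_code q) (prod_encode (pfst x, prod_encode (psnd x - 1, z))) y)"
    unfolding justified_def prog_code.simps diff mod by (auto dest: inset_less)
  show "justified D (prog_code (Mu p)) x y \<longleftrightarrow>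
    inset D (prog_code p) (prod_encode (x, y)) 0 \<and>
    (\<forall>m<y. \<exists>z. inset D (prog_code p) (prod_encode (x, m)) (Suc z))"
    unfolding justified_def prog_code.simps diff mod by (simp, meson inset_less Suc_lessD)
qed

section \<open>Soundness of certificates\<close>

definition closed_set :: "nat \<Rightarrow> bool" where
  "closed_set D \<longleftrightarrow> (\<forall>e x y. inset D e x y \<longrightarrow> justified D e x y)"

lemma halting_witness_iff:
  "halting_witness e D \<longleftrightarrow> closed_set D \<and> (\<exists>y. inset D e 0 y)"
proof -
  have "(\<forall>c<D. c \<in> set_decode D \<longrightarrow> justified D (pfst c) (pfst (psnd c)) (psnd (psnd c))) \<longleftrightarrow> closed_set D"
  proof
    assume *: "\<forall>c<D. c \<in> set_decode D \<longrightarrow> justified D (pfst c) (pfst (psnd c)) (psnd (psnd c))"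
    show "closed_set D"
      unfolding closed_set_def inset_def
    proof (intro allI impI)
      fix e x y assume "prod_encode (e, prod_encode (x, y)) \<in> set_decode D"
      from *[rule_format, OF less_if_in_set_decode[OF this] this] show "justified D e x y" by simp
    qed
  next
    assume *: "closed_set D"
    show "\<forall>c<D. c \<in> set_decode D \<longrightarrow> justified D (pfst c) (pfst (psnd c)) (psnd (psnd c))"
    proof (intro allI impI)
      fix c assume "c \<in> set_decode D"
      moreover have "prod_encode (pfst c, prod_encode (pfst (psnd c), psnd (psnd c))) = c" by simp
      ultimately show "justified D (pfst c) (pfst (psnd c)) (psnd (psnd c))"
        using * unfolding closed_set_def inset_def by metis
    qed
  qed
  then show ?thesis unfolding halting_witness_def using inset_less by blast
qed

text \<open>Every justification leads to proper subprograms or to a smaller counter, so induction on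
  the program works whatever else \<open>D\<close> contains; primitive recursion needs an inner
  induction on the counter.\<close>

lemma eval_if_inset:
  assumes D: "closed_set D"
  shows "inset D (prog_code p) x y \<Longrightarrow> eval (\<lambda>_. 0) p x = Some y"
proof (induction p arbitrary: x y)
  case (Prec p q)
  have "\<forall>y. inset D (prog_code (Prec p q)) (prod_encode (a, n)) y \<longrightarrow>
    eval (\<lambda>_. 0) (Prec p q) (prod_encode (a, n)) = Some y" for a n
  proof (induction n)
    case 0
    have "inset D (prog_code p) a y" if "inset D (prog_code (Prec p q)) (prod_encode (a, 0)) y" for y
      using D that unfolding closed_set_def by (fastforce simp: justified_prog simp del: prog_code.simps)
    then show ?case using Prec.IH(1) by simp
  next
    case (Suc n)
    show ?case
    proof (intro allI impI)
      fix y assume "inset D (prog_code (Prec p q)) (prod_encode (a, Suc n)) y"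
      then have "justified D (prog_code (Prec p q)) (prod_encode (a, Suc n)) y"
        using D unfolding closed_set_def by blast
      then obtain z where z: "inset D (prog_code (Prec p q)) (prod_encode (a, n)) z"
        "inset D (prog_code q) (prod_encode (a, prod_encode (n, z))) y"
        unfolding justified_prog by auto
      show "eval (\<lambda>_. 0) (Prec p q) (prod_encode (a, Suc n)) = Some y"
        using Suc z(1) Prec.IH(2)[OF z(2)] by auto
    qed
  qed
  from this[of "pfst x" "psnd x"] Prec.prems show ?case by (simp del: prog_code.simps eval.simps)
next
  case (Mu p)
  then have j: "justified D (prog_code (Mu p)) x y" using D unfolding closed_set_def by blast
  from j have 0: "eval (\<lambda>_. 0) p (prod_encode (x, y)) = Some 0"
    using Mu.IH unfolding justified_prog by blast
  from j have less: "\<exists>z. eval (\<lambda>_. 0) p (prod_encode (x, m)) = Some (Suc z)" if "m < y" for m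
    using that Mu.IH unfolding justified_prog by blast
  have "(LEAST n. eval (\<lambda>_. 0) p (prod_encode (x, n)) = Some 0) = y"
  proof (rule Least_equality, rule 0, rule ccontr)
    fix n assume "eval (\<lambda>_. 0) p (prod_encode (x, n)) = Some 0" "\<not> y \<le> n"
    then show False using less[of n] by simp
  qed
  moreover have "\<exists>n. eval (\<lambda>_. 0) p (prod_encode (x, n)) = Some 0 \<and>
      (\<forall>m<n. eval (\<lambda>_. 0) p (prod_encode (x, m)) \<noteq> None)"
    using 0 less by (intro exI[of _ y]) auto
  ultimately show ?case by simp
next
  case (Pair p q)
  then have "justified D (prog_code (Pair p q)) x y" using D unfolding closed_set_def by blast
  then have "eval (\<lambda>_. 0) p x = Some (pfst y)" "eval (\<lambda>_. 0) q x = Some (psnd y)"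
    using Pair.IH unfolding justified_prog by blast+
  then show ?case by simp
next
  case (Comp p q)
  then have "justified D (prog_code (Comp p q)) x y" using D unfolding closed_set_def by blast
  then show ?case using Comp.IH unfolding justified_prog by auto
qed (use D in \<open>fastforce simp: closed_set_def justified_prog simp del: prog_code.simps\<close>)+

section \<open>Completeness of certificates\<close>

definition derivable :: "nat \<Rightarrow> nat \<Rightarrow> nat \<Rightarrow> bool" where
  "derivable e x y \<longleftrightarrow> (\<exists>D. closed_set D \<and> inset D e x y)"

lemma inset_set_encode:
  "finite A \<Longrightarrow> inset (set_encode A) e x y \<longleftrightarrow> prod_encode (e, prod_encode (x, y)) \<in> A"
  by (simp add: inset_def)

text \<open>The bounds on \<open>z\<close> in \<open>justified\<close> depend on \<open>D\<close>;
  in \<open>justified_prog\<close> they are gone and membership occurs only positively. That form is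
  always available because every number codes a program.\<close>

lemma justified_mono:
  assumes "\<And>e x y. inset D e x y \<Longrightarrow> inset D' e x y" "justified D e x y"
  shows "justified D' e x y"
proof -
  obtain p where e: "e = prog_code p" using surj_prog_code by blast
  show ?thesis
    using assms unfolding e
    by (cases p) (simp_all add: justified_prog del: prog_code.simps split: if_splits, blast+)
qed

lemma closed_set_un:
  assumes "closed_set D" "closed_set D'"
  shows "closed_set (set_encode (set_decode D \<union> set_decode D'))"
proof -
  define E where "E = set_encode (set_decode D \<union> set_decode D')"
  have E: "inset E e x y \<longleftrightarrow> inset D e x y \<or> inset D' e x y" for e x y
    by (simp add: E_def inset_def)
  have "justified E e x y" if "inset E e x y" for e x y
    using that assms justified_mono[of D E e x y] justified_mono[of D' E e x y]
    unfolding closed_set_def E by blast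
  then show ?thesis unfolding closed_set_def E_def by blast
qed

text \<open>The finitely many premises in \<open>C\<close> have certificates whose union is again
  one by monotonicity, and the new triple may be added to it. Each evaluation rule then only has to
  name its premises.\<close>

lemma derivableI:
  assumes C: "finite C" "\<And>e x y. prod_encode (e, prod_encode (x, y)) \<in> C \<Longrightarrow> derivable e x y"
    and j: "justified (set_encode C) e x y"
  shows "derivable e x y"
proof -
  have "\<exists>D. closed_set D \<and> C \<subseteq> set_decode D"
    using C
  proof (induction C)
    case empty
    have "closed_set 0" by (simp add: closed_set_def inset_def)
    then show ?case by auto
  next
    case (insert c C)
    then obtain D where D: "closed_set D" "C \<subseteq> set_decode D" by auto
    have "prod_encode (pfst c, prod_encode (pfst (psnd c), psnd (psnd c))) = c" by simp
    then obtain D' where D': "closed_set D'" "c \<in> set_decode D'"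
      using insert.prems unfolding derivable_def inset_def by (metis insertI1)
    show ?case
      using closed_set_un[OF D(1) D'(1)] D(2) D'(2)
      by (intro exI[of _ "set_encode (set_decode D \<union> set_decode D')"]) auto
  qed
  then obtain D where D: "closed_set D" "C \<subseteq> set_decode D" by blast
  define E where "E = set_encode (insert (prod_encode (e, prod_encode (x, y))) (set_decode D))"
  have E: "inset E e' x' y' \<longleftrightarrow> (e' = e \<and> x' = x \<and> y' = y) \<or> inset D e' x' y'" for e' x' y'
    by (auto simp: E_def inset_set_encode inset_def)
  have "justified E e x y"
    using D(2) C(1) by (intro justified_mono[OF _ j]) (auto simp: E inset_set_encode inset_def[of D])
  then have "closed_set E"
    using D(1) unfolding closed_set_def by (auto simp: E intro: justified_mono[of D E])
  then show ?thesis unfolding derivable_def using E by blast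
qed

lemma derivable_if_eval:
  "eval (\<lambda>_. 0) p x = Some y \<Longrightarrow> derivable (prog_code p) x y"
proof (induction p arbitrary: x y)
  case (Pair p q)
  then obtain a b where ab: "eval (\<lambda>_. 0) p x = Some a" "eval (\<lambda>_. 0) q x = Some b"
    "y = prod_encode (a, b)" by (auto split: bind_splits)
  show ?case
    by (rule derivableI[where C = "{prod_encode (prog_code p, prod_encode (x, a)),
          prod_encode (prog_code q, prod_encode (x, b))}"])
      (use Pair.IH(1)[OF ab(1)] Pair.IH(2)[OF ab(2)] in \<open>auto simp: justified_prog inset_set_encode ab(3) simp del: prog_code.simps set_encode_insert\<close>)
next
  case (Comp p q)
  then obtain a where a: "eval (\<lambda>_. 0) q x = Some a" "eval (\<lambda>_. 0) p a = Some y"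
    by (auto split: bind_splits)
  show ?case
    by (rule derivableI[where C = "{prod_encode (prog_code q, prod_encode (x, a)),
          prod_encode (prog_code p, prod_encode (a, y))}"])
      (use Comp.IH(2)[OF a(1)] Comp.IH(1)[OF a(2)] in \<open>auto simp: justified_prog inset_set_encode simp del: prog_code.simps set_encode_insert\<close>)
next
  case (Prec p q)
  have "eval (\<lambda>_. 0) (Prec p q) (prod_encode (a, n)) = Some y \<Longrightarrow>
    derivable (prog_code (Prec p q)) (prod_encode (a, n)) y" for a n y
  proof (induction n arbitrary: y)
    case 0
    show ?case
      by (rule derivableI[where C = "{prod_encode (prog_code p, prod_encode (a, y))}"])
        (use Prec.IH(1)[of a y] 0 in \<open>auto simp: justified_prog inset_set_encode simp del: prog_code.simps set_encode_insert\<close>)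
  next
    case (Suc n)
    from Suc.prems obtain z where z: "eval (\<lambda>_. 0) (Prec p q) (prod_encode (a, n)) = Some z"
      "eval (\<lambda>_. 0) q (prod_encode (a, prod_encode (n, z))) = Some y"
      by (auto split: bind_splits)
    show ?case
      by (rule derivableI[where
            C = "{prod_encode (prog_code (Prec p q), prod_encode (prod_encode (a, n), z)),
              prod_encode (prog_code q, prod_encode (prod_encode (a, prod_encode (n, z)), y))}"])
        (use Suc.IH[OF z(1)] Prec.IH(2)[OF z(2)] in \<open>auto simp: justified_prog inset_set_encode simp del: prog_code.simps set_encode_insert\<close>)
  qed
  from this[of "pfst x" "psnd x" y] Prec.prems show ?case by (simp del: prog_code.simps eval.simps)
next
  case (Mu p)
  let ?P = "\<lambda>n. eval (\<lambda>_. 0) p (prod_encode (x, n)) = Some 0"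
  obtain n where n: "?P n" "\<forall>m<n. eval (\<lambda>_. 0) p (prod_encode (x, m)) \<noteq> None" "y = (LEAST n. ?P n)"
    using Mu.prems by (auto split: if_splits)
  have y: "?P y" "y \<le> n" and not_less: "\<And>m. m < y \<Longrightarrow> \<not> ?P m"
    unfolding n(3) by (rule LeastI[of ?P], rule n(1)) (rule Least_le[of ?P], rule n(1), rule not_less_Least)
  have "\<exists>z. eval (\<lambda>_. 0) p (prod_encode (x, m)) = Some (Suc z)" if "m < y" for m
    using n(2) y(2) not_less[OF that] that by (metis less_le_trans not0_implies_Suc option.exhaust)
  then obtain z where z: "\<And>m. m < y \<Longrightarrow> eval (\<lambda>_. 0) p (prod_encode (x, m)) = Some (Suc (z m))"
    by metis
  \<comment> \<open>The premises of a minimisation are the zero at \<open>y\<close> and the positive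
    values at all smaller arguments, finitely many in total.\<close>
  show ?case
    by (rule derivableI[where C = "insert (prod_encode (prog_code p, prod_encode (prod_encode (x, y), 0)))
          ((\<lambda>m. prod_encode (prog_code p, prod_encode (prod_encode (x, m), Suc (z m)))) ` {..<y})"])
      (use Mu.IH[OF y(1)] Mu.IH[OF z] in \<open>auto simp: justified_prog inset_set_encode simp del: prog_code.simps set_encode_insert\<close>)
qed (rule derivableI[where C = "{}"];
    simp add: justified_prog del: prog_code.simps)+

lemma halting_set_iff: "e \<in> halting_set \<longleftrightarrow> (\<exists>D. halting_witness e D)"
proof -
  obtain p where e: "e = prog_code p" using surj_prog_code by blast
  have inv: "inv prog_code e = p" unfolding e using inj_prog_code by simp
  show ?thesis
    unfolding halting_set_def partial_computable_fun_def halting_witness_iff mem_Collect_eq inv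
    using eval_if_inset derivable_if_eval unfolding derivable_def e by blast
qed

section \<open>Lebesgue measure on the unit square\<close>

text \<open>Lebesgue measure on the plane is the completion of a product of Borel measures and not
  itself a product, so statements on Lebesgue measurable rectangles are obtained from Borel ones up
  to null strips.\<close>

lemma null_sets_lebesgue_Times_UNIV:
  fixes N :: "real set"
  assumes "N \<in> null_sets lebesgue"
  shows "N \<times> (UNIV :: real set) \<in> null_sets lebesgue" "(UNIV :: real set) \<times> N \<in> null_sets lebesgue"
proof -
  obtain N' where N': "N' \<in> null_sets lborel" "N \<subseteq> N'"
    using assms by (auto simp: null_sets_completion_iff2)
  then have "N' \<times> (UNIV :: real set) \<in> null_sets lborel" "(UNIV :: real set) \<times> N' \<in> null_sets lborel"
    by (simp_all add: lborel.emeasure_pair_measure_Times lborel_prod[symmetric] null_sets_def)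
  then have "N' \<times> (UNIV :: real set) \<in> null_sets lebesgue" and "(UNIV :: real set) \<times> N' \<in> null_sets lebesgue"
    by (auto intro: null_sets_completionI)
  moreover have "N \<times> UNIV \<subseteq> N' \<times> (UNIV :: real set)" "UNIV \<times> N \<subseteq> (UNIV :: real set) \<times> N'"
    using N'(2) by auto
  ultimately show "N \<times> (UNIV :: real set) \<in> null_sets lebesgue" "(UNIV :: real set) \<times> N \<in> null_sets lebesgue"
    using null_sets_completion_subset by metis+
qed

lemma measurable_fst_lebesgue: "(fst :: real \<times> real \<Rightarrow> real) \<in> lebesgue \<rightarrow>\<^sub>M lebesgue"
proof (rule completion.measurable_completion2)
  show m: "(fst :: real \<times> real \<Rightarrow> real) \<in> lebesgue \<rightarrow>\<^sub>M lborel"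
    unfolding lborel_prod[symmetric] by (intro measurable_completion measurable_fst)
  have "fst -` N \<inter> space lebesgue = N \<times> (UNIV :: real set)" for N :: "real set" by auto
  then show "null_sets lborel \<subseteq> null_sets (distr lebesgue lborel (fst :: real \<times> real \<Rightarrow> real))"
    using null_sets_lebesgue_Times_UNIV(1)[OF null_sets_completionI]
    by (auto simp: null_sets_distr_iff[OF m] dest: null_setsD2[of _ lborel, unfolded sets_lborel])
qed

lemma measurable_snd_lebesgue: "(snd :: real \<times> real \<Rightarrow> real) \<in> lebesgue \<rightarrow>\<^sub>M lebesgue"
proof (rule completion.measurable_completion2)
  show m: "(snd :: real \<times> real \<Rightarrow> real) \<in> lebesgue \<rightarrow>\<^sub>M lborel"
    unfolding lborel_prod[symmetric] by (intro measurable_completion measurable_snd)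
  have "snd -` N \<inter> space lebesgue = (UNIV :: real set) \<times> N" for N :: "real set" by auto
  then show "null_sets lborel \<subseteq> null_sets (distr lebesgue lborel (snd :: real \<times> real \<Rightarrow> real))"
    using null_sets_lebesgue_Times_UNIV(2)[OF null_sets_completionI]
    by (auto simp: null_sets_distr_iff[OF m] dest: null_setsD2[of _ lborel, unfolded sets_lborel])
qed

lemma sets_lebesgue_Times:
  fixes A B :: "real set"
  assumes "A \<in> sets lebesgue" "B \<in> sets lebesgue"
  shows "A \<times> B \<in> sets lebesgue"
proof -
  have "A \<times> B = (fst -` A \<inter> space lebesgue) \<inter> (snd -` B \<inter> space lebesgue)" by auto
  then show ?thesis
    using measurable_sets[OF measurable_fst_lebesgue assms(1)]
      measurable_sets[OF measurable_snd_lebesgue assms(2)] by simp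
qed

text \<open>Passing to the Borel main part of each factor changes the rectangle only inside two null
  strips.\<close>

lemma emeasure_lebesgue_Times:
  fixes A B :: "real set"
  assumes A: "A \<in> sets lebesgue" and B: "B \<in> sets lebesgue"
  shows "emeasure lebesgue (A \<times> B) = emeasure lebesgue A * emeasure lebesgue B"
proof -
  let ?A = "main_part lborel A" and ?B = "main_part lborel B"
  have sA: "?A \<in> sets lborel" and sB: "?B \<in> sets lborel"
    using main_part_sets[OF A] main_part_sets[OF B] .
  have sub: "?A \<times> ?B \<subseteq> A \<times> B"
    using main_part_null_part_Un[OF A] main_part_null_part_Un[OF B] by blast
  have "A \<times> B - ?A \<times> ?B \<subseteq> null_part lborel A \<times> UNIV \<union> UNIV \<times> null_part lborel B"
    using main_part_null_part_Un[OF A] main_part_null_part_Un[OF B] by blast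
  moreover have "null_part lborel A \<times> (UNIV :: real set) \<in> null_sets lebesgue"
    "(UNIV :: real set) \<times> null_part lborel B \<in> null_sets lebesgue"
    using null_part_null_sets[OF A] null_part_null_sets[OF B]
    by (auto intro: null_sets_lebesgue_Times_UNIV)
  ultimately have "A \<times> B - ?A \<times> ?B \<in> null_sets lebesgue"
    by (meson completion.complete2 null_sets.Un)
  then have "emeasure lebesgue (?A \<times> ?B \<union> (A \<times> B - ?A \<times> ?B)) = emeasure lebesgue (?A \<times> ?B)"
    using sA sB by (intro emeasure_Un_null_set) (auto intro!: sets_lebesgue_Times)
  also have "?A \<times> ?B \<union> (A \<times> B - ?A \<times> ?B) = A \<times> B" using sub by blast
  also have "emeasure lebesgue (?A \<times> ?B) = emeasure lborel (?A \<times> ?B)"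
    using sA sB by (simp add: borel_Times)
  also have "\<dots> = emeasure lborel ?A * emeasure lborel ?B"
    using sA sB by (simp add: lborel.emeasure_pair_measure_Times lborel_prod[symmetric])
  also have "\<dots> = emeasure lebesgue A * emeasure lebesgue B"
    using A B by simp
  finally show ?thesis .
qed

abbreviation unit_square_measure :: "(real \<times> real) measure" where
  "unit_square_measure \<equiv> lebesgue_on unit_square"

lemma sets_unit_square [simp]: "unit_square \<in> sets lebesgue"
  by (intro sets_lebesgue_Times) auto

lemma emeasure_unit_square: "emeasure lebesgue unit_square = 1"
  by (subst emeasure_lebesgue_Times) auto

interpretation unit_square: finite_measure unit_square_measure
  by (rule finite_measureI) (simp add: emeasure_restrict_space emeasure_unit_square)

lemma integrable_unit_square:
  fixes F :: "real \<times> real \<Rightarrow> real"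
  assumes "F \<in> borel_measurable unit_square_measure" "\<And>z. z \<in> unit_square \<Longrightarrow> \<bar>F z\<bar> \<le> B"
  shows "integrable unit_square_measure F"
  using assms by (intro unit_square.integrable_const_bound[where B = B] AE_I2) auto

section \<open>Measure-preserving maps acting on the square\<close>

definition product_map :: "(real \<Rightarrow> real) \<Rightarrow> real \<times> real \<Rightarrow> real \<times> real" where
  "product_map \<phi> z = (\<phi> (fst z), \<phi> (snd z))"

text \<open>A measure on the Borel sets of the plane is determined by its values on rectangles, and
  the preimage of a rectangle is a rectangle with sides of the same measure. The right-hand side
  does not mention \<open>\<phi>\<close>, which gives the invariance.\<close>

lemma
  assumes \<phi>: "\<phi> \<in> measure_preserving_maps"
  shows product_map_measurable: "product_map \<phi> \<in> unit_square_measure \<rightarrow>\<^sub>M borel"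
    and distr_product_map: "distr unit_square_measure borel (product_map \<phi>)
      = distr (lebesgue_on {0..1}) borel (\<lambda>x. x) \<Otimes>\<^sub>M distr (lebesgue_on {0..1}) borel (\<lambda>x. x)"
proof -
  let ?I = "lebesgue_on {0..1::real}"
  have \<phi>_meas: "\<phi> \<in> ?I \<rightarrow>\<^sub>M ?I" and \<phi>_distr: "distr ?I ?I \<phi> = ?I"
    using \<phi> by (auto simp: measure_preserving_maps_def)
  have id: "(\<lambda>x. x) \<in> ?I \<rightarrow>\<^sub>M (borel :: real measure)"
    by (intro measurable_restrict_space1 measurable_completion) simp
  have \<phi>_borel: "\<phi> \<in> ?I \<rightarrow>\<^sub>M borel"
    using measurable_compose[OF \<phi>_meas id] .
  have fst: "fst \<in> unit_square_measure \<rightarrow>\<^sub>M ?I" and snd: "snd \<in> unit_square_measure \<rightarrow>\<^sub>M ?I"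
    by (auto intro!: measurable_restrict_space3 measurable_fst_lebesgue measurable_snd_lebesgue)
  show meas: "product_map \<phi> \<in> unit_square_measure \<rightarrow>\<^sub>M borel"
    unfolding product_map_def borel_prod[symmetric]
    by (intro measurable_Pair measurable_compose[OF fst \<phi>_borel] measurable_compose[OF snd \<phi>_borel])
  let ?\<mu> = "distr ?I borel (\<lambda>x. x)"
  interpret \<mu>: finite_measure ?\<mu>
    by (rule finite_measureI) (simp add: emeasure_distr[OF id] emeasure_restrict_space)
  have \<mu>: "emeasure lebesgue (\<phi> -` A \<inter> {0..1}) = emeasure ?\<mu> A"
    "\<phi> -` A \<inter> {0..1} \<in> sets lebesgue" if A: "A \<in> sets borel" for A
  proof -
    have A': "A \<inter> {0..1} \<in> sets ?I"
      using A by (auto simp: sets_restrict_space_iff)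
    have "\<phi> -` A \<inter> {0..1} \<in> sets ?I"
      using measurable_sets[OF \<phi>_borel A] by simp
    then show *: "\<phi> -` A \<inter> {0..1} \<in> sets lebesgue"
      by (simp add: sets_restrict_space_iff)
    have "emeasure ?\<mu> A = emeasure ?I (A \<inter> {0..1})"
      using A by (simp add: emeasure_distr[OF id])
    also have "\<dots> = emeasure (distr ?I ?I \<phi>) (A \<inter> {0..1})" by (simp add: \<phi>_distr)
    also have "\<dots> = emeasure ?I (\<phi> -` (A \<inter> {0..1}) \<inter> {0..1})"
      using A' by (simp add: emeasure_distr[OF \<phi>_meas])
    also have "\<phi> -` (A \<inter> {0..1}) \<inter> {0..1} = \<phi> -` A \<inter> {0..1}"
      using measurable_space[OF \<phi>_meas] by auto
    also have "emeasure ?I (\<phi> -` A \<inter> {0..1}) = emeasure lebesgue (\<phi> -` A \<inter> {0..1})"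
      using * by (intro emeasure_restrict_space) auto
    finally show "emeasure lebesgue (\<phi> -` A \<inter> {0..1}) = emeasure ?\<mu> A" by simp
  qed
  show "distr unit_square_measure borel (product_map \<phi>) = ?\<mu> \<Otimes>\<^sub>M ?\<mu>"
  proof (rule pair_measure_eqI[symmetric])
    fix A B assume "A \<in> sets ?\<mu>" "B \<in> sets ?\<mu>"
    then have AB: "A \<in> sets borel" "B \<in> sets borel" by simp_all
    have "product_map \<phi> -` (A \<times> B) \<inter> unit_square = (\<phi> -` A \<inter> {0..1}) \<times> (\<phi> -` B \<inter> {0..1})"
      by (auto simp: product_map_def)
    then have "emeasure (distr unit_square_measure borel (product_map \<phi>)) (A \<times> B)
        = emeasure unit_square_measure ((\<phi> -` A \<inter> {0..1}) \<times> (\<phi> -` B \<inter> {0..1}))"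
      using AB by (simp add: emeasure_distr[OF meas] borel_Times)
    also have "\<dots> = emeasure lebesgue ((\<phi> -` A \<inter> {0..1}) \<times> (\<phi> -` B \<inter> {0..1}))"
      by (intro emeasure_restrict_space) auto
    also have "\<dots> = emeasure ?\<mu> A * emeasure ?\<mu> B"
      using \<mu> AB by (simp add: emeasure_lebesgue_Times)
    finally show "emeasure ?\<mu> A * emeasure ?\<mu> B
        = emeasure (distr unit_square_measure borel (product_map \<phi>)) (A \<times> B)" ..
  next
    have "sets (?\<mu> \<Otimes>\<^sub>M ?\<mu>) = sets (borel \<Otimes>\<^sub>M borel)"
      by (intro sets_pair_measure_cong) simp_all
    then show "sets (?\<mu> \<Otimes>\<^sub>M ?\<mu>) = sets (distr unit_square_measure borel (product_map \<phi>))"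
      by (simp only: borel_prod sets_distr)
  qed (rule \<mu>.sigma_finite_measure_axioms)+
qed

lemma id_measure_preserving: "(\<lambda>x. x) \<in> measure_preserving_maps"
  by (simp add: measure_preserving_maps_def distr_id2)

lemma distr_product_map_eq:
  assumes "\<phi> \<in> measure_preserving_maps"
  shows "distr unit_square_measure borel (product_map \<phi>) = distr unit_square_measure borel (\<lambda>z. z)"
proof -
  have "product_map (\<lambda>x. x) = (\<lambda>z. z)" by (auto simp: product_map_def)
  then show ?thesis
    using distr_product_map[OF assms] distr_product_map[OF id_measure_preserving] by simp
qed

lemma measurable_id_unit_square: "(\<lambda>z. z) \<in> unit_square_measure \<rightarrow>\<^sub>M borel"
  by (intro measurable_restrict_space1 measurable_completion) simp

lemma product_map_unit_square:
  assumes "\<phi> \<in> measure_preserving_maps" "z \<in> unit_square"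
  shows "product_map \<phi> z \<in> unit_square"
proof -
  have "\<phi> \<in> lebesgue_on {0..1} \<rightarrow>\<^sub>M lebesgue_on {0..1}"
    using assms(1) by (simp add: measure_preserving_maps_def)
  from measurable_space[OF this] assms(2) show ?thesis by (auto simp: product_map_def)
qed

text \<open>The exceptional set can be enlarged to a Borel null set, and the image measure on Borel
  sets is the same as for the identity.\<close>

lemma AE_product_map:
  assumes \<phi>: "\<phi> \<in> measure_preserving_maps" and P: "AE z in lborel. P z"
  shows "AE z in unit_square_measure. P (product_map \<phi> z)"
proof -
  obtain N where N: "{z. \<not> P z} \<subseteq> N" "N \<in> null_sets lborel"
    using P by (auto elim!: AE_E simp: null_sets_def)
  have "N \<in> null_sets lebesgue" using N(2) by (rule null_sets_completionI)
  then have "AE z in lebesgue. z \<notin> N" by (rule AE_not_in)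
  then have "AE z in unit_square_measure. z \<notin> N"
    by (auto simp: AE_restrict_space_iff elim: eventually_mono)
  then have "AE z in distr unit_square_measure borel (\<lambda>z. z). z \<notin> N"
    using N(2) by (subst AE_distr_iff[OF measurable_id_unit_square]) (auto simp: null_sets_def)
  then have "AE z in distr unit_square_measure borel (product_map \<phi>). z \<notin> N"
    unfolding distr_product_map_eq[OF \<phi>] .
  then have "AE z in unit_square_measure. product_map \<phi> z \<notin> N"
    using N(2) by (subst (asm) AE_distr_iff[OF product_map_measurable[OF \<phi>]]) (auto simp: null_sets_def)
  then show ?thesis using N(1) by (auto elim!: eventually_mono)
qed

lemma pullback_eq: "pullback \<phi> W = (\<lambda>z. W (product_map \<phi> z))"
  by (auto simp: pullback_def product_map_def)

text \<open>\<open>product_map\<close> is known to be measurable only into the Borel sets, whereas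
  \<open>W\<close> is merely Lebesgue measurable; therefore \<open>W\<close>, extended by 0, is
  first replaced by a Borel function equal to it almost everywhere.\<close>

lemma
  fixes W :: "real \<times> real \<Rightarrow> real"
  assumes \<phi>: "\<phi> \<in> measure_preserving_maps" and W: "W \<in> borel_measurable unit_square_measure"
  shows pullback_measurable: "pullback \<phi> W \<in> borel_measurable unit_square_measure"
    and integral_pullback:
      "integral\<^sup>L unit_square_measure (pullback \<phi> W) = integral\<^sup>L unit_square_measure W"
proof -
  let ?M = unit_square_measure
  define W0 where "W0 z = indicator unit_square z *\<^sub>R W z" for z
  have "W0 \<in> borel_measurable lebesgue"
    using W unfolding W0_def by (simp add: borel_measurable_restrict_space_iff)
  then obtain W' where W': "W' \<in> borel_measurable lborel" "AE z in lborel. W0 z = W' z"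
    using completion_ex_borel_measurable_real by blast
  note \<Phi> = product_map_measurable[OF \<phi>]
  have "(\<lambda>z. W' (product_map \<phi> z)) \<in> borel_measurable ?M"
    using measurable_compose[OF \<Phi>, of W' borel] W'(1) by simp
  then have "(\<lambda>z. indicator unit_square z *\<^sub>R W' (product_map \<phi> z)) \<in> borel_measurable lebesgue"
    by (simp add: borel_measurable_restrict_space_iff)
  moreover have eq: "AE z in ?M. W' (product_map \<phi> z) = pullback \<phi> W z"
    using AE_product_map[OF \<phi> W'(2)] AE_space
  proof eventually_elim
    case (elim z)
    then have "product_map \<phi> z \<in> unit_square"
      using product_map_unit_square[OF \<phi>] by simp
    then show ?case using elim(1) by (simp add: W0_def pullback_eq indicator_def)
  qed
  then have "AE z in lebesgue. indicator unit_square z *\<^sub>R W' (product_map \<phi> z)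
      = indicator unit_square z *\<^sub>R pullback \<phi> W z"
    by (auto simp: AE_restrict_space_iff indicator_def elim!: eventually_mono)
  ultimately have "(\<lambda>z. indicator unit_square z *\<^sub>R pullback \<phi> W z) \<in> borel_measurable lebesgue"
    by (rule borel_measurable_AE)
  then show meas: "pullback \<phi> W \<in> borel_measurable ?M"
    by (simp add: borel_measurable_restrict_space_iff)
  have "AE z in lebesgue. W0 z = W' z" using W'(2) by (rule AE_completion)
  then have eq0: "AE z in ?M. W z = W' z"
    by (auto simp: AE_restrict_space_iff W0_def elim!: eventually_mono)
  have W'_meas: "W' \<in> borel_measurable borel" using W'(1) by simp
  have "integral\<^sup>L ?M (pullback \<phi> W) = (\<integral>z. W' (product_map \<phi> z) \<partial>?M)"
    using eq meas measurable_compose[OF \<Phi> W'_meas] by (intro integral_cong_AE) auto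
  also have "\<dots> = integral\<^sup>L (distr ?M borel (product_map \<phi>)) W'"
    using \<Phi> W'_meas by (simp add: integral_distr)
  also have "\<dots> = integral\<^sup>L (distr ?M borel (\<lambda>z. z)) W'"
    by (simp add: distr_product_map_eq[OF \<phi>])
  also have "\<dots> = integral\<^sup>L ?M W'"
    using measurable_id_unit_square W'_meas by (simp add: integral_distr)
  also have "\<dots> = integral\<^sup>L ?M W"
    using eq0 W measurable_compose[OF measurable_id_unit_square W'_meas]
    by (intro integral_cong_AE) auto
  finally show "integral\<^sup>L ?M (pullback \<phi> W) = integral\<^sup>L ?M W" .
qed

section \<open>Cut norm and weak isomorphism\<close>

lemma set_integral_unit_square:
  fixes F :: "real \<times> real \<Rightarrow> real"
  assumes "A \<subseteq> unit_square"
  shows "(LINT z:A|lebesgue. F z) = (\<integral>z. indicator A z * F z \<partial>unit_square_measure)"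
proof -
  have "indicator unit_square z *\<^sub>R (indicator A z * F z) = indicator A z *\<^sub>R F z" for z
    using assms by (auto simp: indicator_def)
  moreover have "(\<integral>z. indicator A z * F z \<partial>unit_square_measure)
      = (\<integral>z. indicator unit_square z *\<^sub>R (indicator A z * F z) \<partial>lebesgue)"
    by (rule integral_restrict_space) simp
  ultimately show ?thesis by (simp only: set_lebesgue_integral_def)
qed

lemma indicator_unit_square_measurable:
  assumes "S \<in> sets lebesgue" "S \<subseteq> {0..1}" "T \<in> sets lebesgue" "T \<subseteq> {0..1}"
  shows "indicator (S \<times> T) \<in> borel_measurable unit_square_measure"
  using assms
  by (intro borel_measurable_indicator)
     (auto simp: sets_restrict_space_iff intro!: sets_lebesgue_Times)

lemma abs_set_integral_le:
  fixes F :: "real \<times> real \<Rightarrow> real"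
  assumes F: "F \<in> borel_measurable unit_square_measure" "\<And>z. z \<in> unit_square \<Longrightarrow> \<bar>F z\<bar> \<le> B"
    and S: "S \<in> sets lebesgue" "S \<subseteq> {0..1}" and T: "T \<in> sets lebesgue" "T \<subseteq> {0..1}"
  shows "\<bar>LINT z:S \<times> T|lebesgue. F z\<bar> \<le> (\<integral>z. \<bar>F z\<bar> \<partial>unit_square_measure)"
proof -
  have sub: "S \<times> T \<subseteq> unit_square" using S T by auto
  note [measurable] = F(1) indicator_unit_square_measurable[OF S T]
  have "\<bar>LINT z:S \<times> T|lebesgue. F z\<bar> \<le> (\<integral>z. \<bar>indicator (S \<times> T) z * F z\<bar> \<partial>unit_square_measure)"
    unfolding set_integral_unit_square[OF sub] by (rule integral_abs_bound)
  also have "\<dots> \<le> (\<integral>z. \<bar>F z\<bar> \<partial>unit_square_measure)"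
  proof (rule integral_mono)
    show "integrable unit_square_measure (\<lambda>z. \<bar>F z\<bar>)"
      using F by (intro integrable_unit_square[where B = B]) auto
    show "integrable unit_square_measure (\<lambda>z. \<bar>indicator (S \<times> T) z * F z\<bar>)"
    proof (rule integrable_unit_square[where B = B])
      fix z :: "real \<times> real" assume "z \<in> unit_square"
      from F(2)[OF this] show "\<bar>\<bar>indicator (S \<times> T) z * F z\<bar>\<bar> \<le> B"
        by (auto simp: indicator_def)
    qed measurable
  qed (auto simp: indicator_def)
  finally show ?thesis .
qed

lemma
  fixes F :: "real \<times> real \<Rightarrow> real"
  assumes F: "F \<in> borel_measurable unit_square_measure" "\<And>z. z \<in> unit_square \<Longrightarrow> \<bar>F z\<bar> \<le> B"
  shows abs_set_integral_le_cut_norm: "S \<in> sets lebesgue \<Longrightarrow> S \<subseteq> {0..1} \<Longrightarrow> T \<in> sets lebesgue \<Longrightarrow> T \<subseteq> {0..1}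
      \<Longrightarrow> \<bar>LINT z:S \<times> T|lebesgue. F z\<bar> \<le> cut_norm F"
    and cut_norm_nonneg: "0 \<le> cut_norm F"
proof -
  let ?L = "{A \<in> sets lebesgue. A \<subseteq> {0..1::real}}"
  show le: "\<bar>LINT z:S \<times> T|lebesgue. F z\<bar> \<le> cut_norm F" if "S \<in> sets lebesgue" "S \<subseteq> {0..1}"
    "T \<in> sets lebesgue" "T \<subseteq> {0..1}" for S T
  proof -
    have "bdd_above ((\<lambda>(S, T). \<bar>LINT z:S \<times> T|lebesgue. F z\<bar>) ` (?L \<times> ?L))"
      using abs_set_integral_le[OF F] by (intro bdd_aboveI2) auto
    then have "(case (S, T) of (S, T) \<Rightarrow> \<bar>LINT z:S \<times> T|lebesgue. F z\<bar>) \<le> cut_norm F"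
      unfolding cut_norm_def using that by (intro cSUP_upper) auto
    then show ?thesis by simp
  qed
  show "0 \<le> cut_norm F"
    using le[of "{}" "{}"] by simp
qed

lemma cut_norm_le:
  assumes "\<And>S T. S \<in> sets lebesgue \<Longrightarrow> S \<subseteq> {0..1} \<Longrightarrow> T \<in> sets lebesgue \<Longrightarrow> T \<subseteq> {0..1}
      \<Longrightarrow> \<bar>LINT z:S \<times> T|lebesgue. F z\<bar> \<le> c"
  shows "cut_norm F \<le> c"
  unfolding cut_norm_def
proof (rule cSUP_least)
  show "{A \<in> sets lebesgue. A \<subseteq> {0..1::real}} \<times> {A \<in> sets lebesgue. A \<subseteq> {0..1::real}} \<noteq> {}" by blast
qed (use assms in auto)

lemma L1_norm_eq: "L1_norm F = (\<integral>z. \<bar>F z\<bar> \<partial>unit_square_measure)"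
  unfolding L1_norm_def set_lebesgue_integral_def by (rule integral_restrict_space[symmetric]) simp

lemma graphonD:
  assumes "graphon W"
  shows "W \<in> borel_measurable unit_square_measure" "z \<in> unit_square \<Longrightarrow> 0 \<le> W z"
    "z \<in> unit_square \<Longrightarrow> W z \<le> 1"
  using assms by (auto simp: graphon_def)

text \<open>The lower bound comes from \<open>G\<^sup>2 \<ge> 2 G h - h\<^sup>2\<close>, in which \<open>G\<close> occurs linearly and is tested
  against boxes only.\<close>
lemma integral_square_ge:
  fixes F G :: "real \<times> real \<Rightarrow> real" and c :: "nat \<Rightarrow> nat \<Rightarrow> real" and \<pi> :: "real \<Rightarrow> nat"
  assumes F: "F \<in> borel_measurable unit_square_measure" "\<And>z. z \<in> unit_square \<Longrightarrow> \<bar>F z\<bar> \<le> 1"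
    and G: "G \<in> borel_measurable unit_square_measure" "\<And>z. z \<in> unit_square \<Longrightarrow> \<bar>G z\<bar> \<le> 1"
    and c: "\<And>i j. \<bar>c i j\<bar> \<le> 1"
    and \<pi>: "\<And>i. {x \<in> {0..1}. \<pi> x = i} \<in> sets lebesgue" "\<And>x. \<pi> x < N"
  shows "(\<integral>z. (F z)\<^sup>2 \<partial>unit_square_measure)
      - (\<integral>z. (F z - c (\<pi> (fst z)) (\<pi> (snd z)))\<^sup>2 \<partial>unit_square_measure)
      - 2 * real N ^ 2 * cut_norm (\<lambda>z. F z - G z)
    \<le> (\<integral>z. (G z)\<^sup>2 \<partial>unit_square_measure)"
proof -
  let ?M = unit_square_measure
  define P where "P i = {x \<in> {0..1}. \<pi> x = i}" for i
  have P: "P i \<in> sets lebesgue" "P i \<subseteq> {0..1}" for i using \<pi>(1) by (auto simp: P_def)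
  define h where "h z = (\<Sum>i<N. \<Sum>j<N. c i j * indicator (P i \<times> P j) z)" for z
  have h_eq: "h z = c (\<pi> (fst z)) (\<pi> (snd z))" if "z \<in> unit_square" for z
  proof -
    have "h z = (\<Sum>i<N. \<Sum>j<N. if i = \<pi> (fst z) then if j = \<pi> (snd z) then c i j else 0 else 0)"
      unfolding h_def using that by (intro sum.cong refl) (cases z; simp add: P_def indicator_def)
    also have "\<dots> = (\<Sum>i<N. if i = \<pi> (fst z) then c i (\<pi> (snd z)) else 0)"
      using \<pi>(2) by (intro sum.cong refl) (auto simp: sum.delta)
    also have "\<dots> = c (\<pi> (fst z)) (\<pi> (snd z))" using \<pi>(2) by (simp add: sum.delta)
    finally show ?thesis .
  qed
  note [measurable] = F(1) G(1) indicator_unit_square_measurable[OF P P]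
  have h_meas [measurable]: "h \<in> borel_measurable ?M" unfolding h_def by measurable
  have h_bound: "\<bar>h z\<bar> \<le> 1" if "z \<in> unit_square" for z using h_eq[OF that] c by simp
  have mult_bound: "\<bar>a * b\<bar> \<le> 1" if "\<bar>a\<bar> \<le> 1" "\<bar>b\<bar> \<le> 1" for a b :: real
    using that by (simp add: abs_mult mult_le_one)
  have [simp]: "integrable ?M (\<lambda>z. (F z)\<^sup>2)" "integrable ?M (\<lambda>z. (G z)\<^sup>2)" "integrable ?M (\<lambda>z. (h z)\<^sup>2)"
    "integrable ?M (\<lambda>z. F z * h z)" "integrable ?M (\<lambda>z. G z * h z)"
    unfolding power2_eq_square
    by (intro integrable_unit_square[where B = 1] mult_bound F G h_bound borel_measurable_times; simp add: F G)+
  \<comment> \<open>\<open>h\<close> is a combination of \<open>N^2\<close> indicators of boxes with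
    coefficients of modulus at most 1, and each box costs at most one cut norm.\<close>
  have "\<bar>\<integral>z. (F z - G z) * h z \<partial>?M\<bar> \<le> real N ^ 2 * cut_norm (\<lambda>z. F z - G z)"
  proof -
    have FG: "(\<lambda>z. F z - G z) \<in> borel_measurable ?M" by measurable
    have FG_bound: "\<bar>F z - G z\<bar> \<le> 2" if "z \<in> unit_square" for z
      using F(2)[OF that] G(2)[OF that] by linarith
    have int: "integrable ?M (\<lambda>z. indicator (P i \<times> P j) z * (F z - G z))" for i j
    proof (rule integrable_unit_square[where B = 2])
      fix z :: "real \<times> real" assume "z \<in> unit_square"
      from FG_bound[OF this] show "\<bar>indicator (P i \<times> P j) z * (F z - G z)\<bar> \<le> 2"
        by (auto simp: indicator_def)
    qed measurable
    have "(\<integral>z. (F z - G z) * h z \<partial>?M)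
        = (\<integral>z. (\<Sum>i<N. \<Sum>j<N. c i j * (indicator (P i \<times> P j) z * (F z - G z))) \<partial>?M)"
      by (intro Bochner_Integration.integral_cong refl) (simp only: h_def sum_distrib_left mult_ac)
    also have "\<dots> = (\<Sum>i<N. \<Sum>j<N. c i j * (\<integral>z. indicator (P i \<times> P j) z * (F z - G z) \<partial>?M))"
      using int by simp
    also have "\<bar>\<dots>\<bar> \<le> (\<Sum>i<N. \<Sum>j<N. cut_norm (\<lambda>z. F z - G z))"
    proof (intro order_trans[OF sum_abs] sum_mono)
      fix i j
      have "P i \<times> P j \<subseteq> unit_square" using P by blast
      then have "\<bar>\<integral>z. indicator (P i \<times> P j) z * (F z - G z) \<partial>?M\<bar> \<le> cut_norm (\<lambda>z. F z - G z)"
        using abs_set_integral_le_cut_norm[OF FG FG_bound P P, of i j]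
        by (simp add: set_integral_unit_square)
      then show "\<bar>c i j * (\<integral>z. indicator (P i \<times> P j) z * (F z - G z) \<partial>?M)\<bar> \<le> cut_norm (\<lambda>z. F z - G z)"
        using c[of i j] mult_mono[of "\<bar>c i j\<bar>" 1 "\<bar>\<integral>z. indicator (P i \<times> P j) z * (F z - G z) \<partial>?M\<bar>"]
        by (simp add: abs_mult)
    qed
    also have "\<dots> = real N ^ 2 * cut_norm (\<lambda>z. F z - G z)" by (simp add: power2_eq_square)
    finally show ?thesis .
  qed
  moreover have "(\<integral>z. (F z - G z) * h z \<partial>?M) = (\<integral>z. F z * h z \<partial>?M) - (\<integral>z. G z * h z \<partial>?M)"
    by (simp add: left_diff_distrib)
  moreover have "(\<integral>z. (F z - h z)\<^sup>2 \<partial>?M)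
      = (\<integral>z. (F z)\<^sup>2 \<partial>?M) - 2 * (\<integral>z. F z * h z \<partial>?M) + (\<integral>z. (h z)\<^sup>2 \<partial>?M)"
    by (simp add: power2_diff mult.assoc)
  moreover have "0 \<le> (\<integral>z. (G z - h z)\<^sup>2 \<partial>?M)" by simp
  moreover have "(\<integral>z. (G z - h z)\<^sup>2 \<partial>?M)
      = (\<integral>z. (G z)\<^sup>2 \<partial>?M) - 2 * (\<integral>z. G z * h z \<partial>?M) + (\<integral>z. (h z)\<^sup>2 \<partial>?M)"
    by (simp add: power2_diff mult.assoc)
  moreover have "(\<integral>z. (F z - h z)\<^sup>2 \<partial>?M) = (\<integral>z. (F z - c (\<pi> (fst z)) (\<pi> (snd z)))\<^sup>2 \<partial>?M)"
    by (intro Bochner_Integration.integral_cong refl) (simp add: h_eq)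
  ultimately show ?thesis by (simp add: abs_le_iff)
qed

lemma cut_norm_minus_commute: "cut_norm (\<lambda>z. F z - G z) = cut_norm (\<lambda>z. G z - F z)"
proof -
  have "(LINT z:A|lebesgue. F z - G z) = - (LINT z:A|lebesgue. G z - F z)" for A
  proof -
    have "(\<lambda>z. indicator A z *\<^sub>R (F z - G z)) = (\<lambda>z. - (indicator A z *\<^sub>R (G z - F z)))"
      by (auto simp: algebra_simps)
    then show ?thesis by (simp only: set_lebesgue_integral_def Bochner_Integration.integral_minus)
  qed
  then show ?thesis by (simp add: cut_norm_def)
qed

section \<open>Approximation by step functions on a grid\<close>

lemma part_index_measurable: "part_index n \<in> borel \<rightarrow>\<^sub>M count_space UNIV"
  unfolding part_index_def by measurable

lemma step_function_measurable:
  fixes c :: "nat \<Rightarrow> nat \<Rightarrow> real"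
  shows "(\<lambda>z. c (part_index n (fst z)) (part_index n (snd z))) \<in> borel_measurable unit_square_measure"
proof -
  have [measurable]: "(\<lambda>z::real \<times> real. part_index n (fst z)) \<in> borel \<rightarrow>\<^sub>M count_space UNIV"
    "(\<lambda>z::real \<times> real. part_index n (snd z)) \<in> borel \<rightarrow>\<^sub>M count_space UNIV"
    by (auto intro!: measurable_compose[OF _ part_index_measurable] borel_measurable_continuous_onI continuous_intros)
  have "(\<lambda>z::real \<times> real. c (part_index n (fst z)) (part_index n (snd z))) \<in> borel_measurable borel"
    by measurable
  then show ?thesis by (rule measurable_compose[OF measurable_id_unit_square])
qed

lemma part_index_bounds:
  assumes "0 < n" "x \<in> {0..1}"
  shows "\<bar>real (part_index n x) - real n * x\<bar> \<le> 1"
proof (cases "\<lfloor>real n * x\<rfloor> < int n")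
  case True
  have "0 \<le> real n * x" using assms by simp
  then have "real (part_index n x) = of_int \<lfloor>real n * x\<rfloor>"
    using True assms(1) by (simp add: part_index_def min_def)
  then show ?thesis by linarith
next
  case False
  \<comment> \<open>The clipping in \<open>part_index\<close> takes effect only at
    \<open>x = 1\<close>, which belongs to the closed last part.\<close>
  then have "real n \<le> real n * x" by linarith
  with assms(1) have "1 \<le> x" by simp
  with assms(2) have "x = 1" by simp
  then show ?thesis using assms(1) by (simp add: part_index_def of_nat_diff)
qed

lemma part_index_div_tendsto:
  assumes "x \<in> {0..1}"
  shows "(\<lambda>k. real (part_index (Suc k) x) / real (Suc k)) \<longlonglongrightarrow> x"
proof (rule Lim_transform[OF tendsto_const])
  have "(\<lambda>k. x - real (part_index (Suc k) x) / real (Suc k)) \<longlonglongrightarrow> 0"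
  proof (rule tendsto_rabs_zero_cancel, rule tendsto_sandwich[OF _ _ tendsto_const LIMSEQ_inverse_real_of_nat])
    show "\<forall>\<^sub>F k in sequentially. \<bar>x - real (part_index (Suc k) x) / real (Suc k)\<bar> \<le> inverse (real (Suc k))"
    proof (intro always_eventually allI)
      fix k
      have "\<bar>x - real (part_index (Suc k) x) / real (Suc k)\<bar>
          = \<bar>real (part_index (Suc k) x) - real (Suc k) * x\<bar> / real (Suc k)"
        by (simp add: field_simps abs_if del: of_nat_Suc)
      also have "\<dots> \<le> 1 / real (Suc k)"
        using part_index_bounds[OF zero_less_Suc assms, of k] by (intro divide_right_mono) auto
      finally show "\<bar>x - real (part_index (Suc k) x) / real (Suc k)\<bar> \<le> inverse (real (Suc k))"
        by (simp add: inverse_eq_divide)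
    qed
  qed simp
  then show "(\<lambda>k. real (part_index (Suc k) x) / real (Suc k) - x) \<longlonglongrightarrow> 0"
    using tendsto_minus by fastforce
qed

text \<open>A measurable function is an almost everywhere limit of continuous ones; clamping these
  to the unit interval makes dominated convergence applicable. A continuous function is in turn the
  pointwise limit of its samples on ever finer grids.\<close>

lemma step_approximation:
  fixes W :: "real \<times> real \<Rightarrow> real"
  assumes W: "W \<in> borel_measurable unit_square_measure" "\<And>z. z \<in> unit_square \<Longrightarrow> 0 \<le> W z \<and> W z \<le> 1"
    and \<epsilon>: "0 < \<epsilon>"
  obtains N c where "0 < N" "\<And>i j. \<bar>c i j\<bar> \<le> (1::real)"
    "(\<integral>z. (W z - c (part_index N (fst z)) (part_index N (snd z)))\<^sup>2 \<partial>unit_square_measure) < \<epsilon>"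
proof -
  let ?M = unit_square_measure
  note W(1) [measurable]
  have clamp: "\<bar>a - max 0 (min 1 b)\<bar> \<le> 1" if "0 \<le> a" "a \<le> 1" for a b :: real
    using that by linarith
  have sq_le: "\<bar>(a - max 0 (min 1 b))\<^sup>2\<bar> \<le> 1" if "0 \<le> a" "a \<le> 1" for a b :: real
    using clamp[OF that] by (simp add: abs_square_le_1)
  obtain N g where N: "negligible N" and g: "\<And>n. continuous_on UNIV (g n)"
    and lim: "\<And>z. z \<notin> N \<Longrightarrow> (\<lambda>n. g n z) \<longlonglongrightarrow> (if z \<in> unit_square then W z else 0)"
    using W(1) measurable_on_iff_borel_measurable[OF sets_unit_square, of W]
    unfolding measurable_on_def by blast
  define g' where "g' n z = max 0 (min 1 (g n z))" for n z
  have g'_cont: "continuous_on UNIV (g' n)" for n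
    unfolding g'_def using g by (intro continuous_intros)
  have [measurable]: "g' n \<in> borel_measurable ?M" for n
    using borel_measurable_continuous_onI[OF g'_cont] by (rule measurable_compose[OF measurable_id_unit_square])
  have "(\<lambda>n. \<integral>z. (W z - g' n z)\<^sup>2 \<partial>?M) \<longlonglongrightarrow> (\<integral>z. 0 \<partial>?M)"
  proof (rule integral_dominated_convergence[where w = "\<lambda>_. 1"])
    have "AE z in lebesgue. z \<notin> N" using N by (intro AE_not_in) (simp add: negligible_iff_null_sets)
    then show "AE z in ?M. (\<lambda>n. (W z - g' n z)\<^sup>2) \<longlonglongrightarrow> 0"
    proof (subst AE_restrict_space_iff, simp, eventually_elim, intro impI)
      fix z assume z: "z \<notin> N" "z \<in> unit_square"
      then have "(\<lambda>n. g n z) \<longlonglongrightarrow> W z" using lim[OF z(1)] by simp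
      then have "(\<lambda>n. (W z - g' n z)\<^sup>2) \<longlonglongrightarrow> (W z - max 0 (min 1 (W z)))\<^sup>2"
        unfolding g'_def by (intro tendsto_intros)
      then show "(\<lambda>n. (W z - g' n z)\<^sup>2) \<longlonglongrightarrow> 0" using W(2)[OF z(2)] by simp
    qed
    show "AE z in ?M. norm ((W z - g' n z)\<^sup>2) \<le> 1" for n
      using W(2) sq_le unfolding g'_def by (intro AE_I2) auto
  qed auto
  then have "\<forall>\<^sub>F n in sequentially. (\<integral>z. (W z - g' n z)\<^sup>2 \<partial>?M) < \<epsilon>"
    using \<epsilon> by (intro order_tendstoD(2)[where y = "\<integral>z. 0 \<partial>?M"]) auto
  then obtain n where n: "(\<integral>z. (W z - g' n z)\<^sup>2 \<partial>?M) < \<epsilon>"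
    by (meson eventually_happens' sequentially_bot)
  \<comment> \<open>\<open>g' n\<close> is sampled at the lower left corner of each cell.\<close>
  define c where "c k i j = g' n (real i / real (Suc k), real j / real (Suc k))" for k i j
  define h where "h k z = c k (part_index (Suc k) (fst z)) (part_index (Suc k) (snd z))" for k z
  have [measurable]: "h k \<in> borel_measurable ?M" for k
    unfolding h_def by (rule step_function_measurable)
  have "(\<lambda>k. \<integral>z. (W z - h k z)\<^sup>2 \<partial>?M) \<longlonglongrightarrow> (\<integral>z. (W z - g' n z)\<^sup>2 \<partial>?M)"
  proof (rule integral_dominated_convergence[where w = "\<lambda>_. 1"])
    show "AE z in ?M. (\<lambda>k. (W z - h k z)\<^sup>2) \<longlonglongrightarrow> (W z - g' n z)\<^sup>2"
    proof (rule AE_I2)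
      fix z assume "z \<in> space ?M"
      then have "fst z \<in> {0..1}" "snd z \<in> {0..1}" by auto
      then have "(\<lambda>k. (real (part_index (Suc k) (fst z)) / real (Suc k), real (part_index (Suc k) (snd z)) / real (Suc k)))
          \<longlonglongrightarrow> (fst z, snd z)"
        by (intro tendsto_Pair part_index_div_tendsto)
      then have "(\<lambda>k. h k z) \<longlonglongrightarrow> g' n (fst z, snd z)"
        unfolding h_def c_def
        by (rule continuous_on_tendsto_compose[OF g'_cont]) auto
      then show "(\<lambda>k. (W z - h k z)\<^sup>2) \<longlonglongrightarrow> (W z - g' n z)\<^sup>2"
        by (intro tendsto_intros) simp
    qed
    show "AE z in ?M. norm ((W z - h k z)\<^sup>2) \<le> 1" for k
      using W(2) sq_le unfolding h_def c_def g'_def by (intro AE_I2) auto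
  qed auto
  then have "\<forall>\<^sub>F k in sequentially. (\<integral>z. (W z - h k z)\<^sup>2 \<partial>?M) < \<epsilon>"
    using n by (intro order_tendstoD(2))
  then obtain k where k: "(\<integral>z. (W z - h k z)\<^sup>2 \<partial>?M) < \<epsilon>"
    by (meson eventually_happens' sequentially_bot)
  show ?thesis
  proof (rule that[of "Suc k" "c k"])
    show "\<bar>c k i j\<bar> \<le> 1" for i j unfolding c_def g'_def by simp
  qed (use k in \<open>simp_all add: h_def\<close>)
qed

section \<open>Invariants of weak isomorphism\<close>

lemma weakly_isomorphic_small:
  assumes "weakly_isomorphic U W" "0 < \<delta>"
  obtains \<phi> where "\<phi> \<in> measure_preserving_maps" "cut_dist U (pullback \<phi> W) < \<delta>"
proof -
  have "Inf ((\<lambda>\<phi>. cut_dist U (pullback \<phi> W)) ` measure_preserving_maps) < \<delta>"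
    using assms by (simp add: weakly_isomorphic_def)
  from cInf_lessD[OF _ this] show ?thesis
    using id_measure_preserving that by blast
qed

text \<open>The definition of weak isomorphism is not visibly symmetric and \<open>\<phi>\<close>
  need not be invertible. For the second inequality \<open>W\<close> is therefore approximated on a
  grid before \<open>\<phi>\<close> is chosen, and the grid is pulled back along
  \<open>\<phi>\<close>. Its parts are then arbitrary measurable sets, which is why
  \<open>integral_square_ge\<close> admits any finite measurable partition.\<close>

lemma weakly_isomorphic_integral_square_le:
  assumes U: "graphon U" and W: "graphon W" and UW: "weakly_isomorphic U W"
  shows "(\<integral>z. (U z)\<^sup>2 \<partial>unit_square_measure) \<le> (\<integral>z. (W z)\<^sup>2 \<partial>unit_square_measure)"
    and "(\<integral>z. (W z)\<^sup>2 \<partial>unit_square_measure) \<le> (\<integral>z. (U z)\<^sup>2 \<partial>unit_square_measure)"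
proof -
  let ?M = unit_square_measure
  note Um = graphonD(1)[OF U] and Wm = graphonD(1)[OF W]
  have Ub: "0 \<le> U z \<and> U z \<le> 1" if "z \<in> unit_square" for z using graphonD(2,3)[OF U that] by simp
  have Wb: "0 \<le> W z \<and> W z \<le> 1" if "z \<in> unit_square" for z using graphonD(2,3)[OF W that] by simp
  have Ub': "\<bar>U z\<bar> \<le> 1" if "z \<in> unit_square" for z using graphonD(2,3)[OF U that] by simp
  have pb: "\<bar>pullback \<phi> W z\<bar> \<le> 1" if "\<phi> \<in> measure_preserving_maps" "z \<in> unit_square" for \<phi> z
    using graphonD(2,3)[OF W product_map_unit_square[OF that]] by (simp add: pullback_eq)
  show "(\<integral>z. (U z)\<^sup>2 \<partial>?M) \<le> (\<integral>z. (W z)\<^sup>2 \<partial>?M)"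
  proof (rule field_le_epsilon)
    fix e :: real assume e: "0 < e"
    obtain N c where N: "0 < N" and c: "\<And>i j. \<bar>c i j\<bar> \<le> (1::real)"
      and approx: "(\<integral>z. (U z - c (part_index N (fst z)) (part_index N (snd z)))\<^sup>2 \<partial>?M) < e / 2"
      by (rule step_approximation[OF Um Ub half_gt_zero[OF e]]) (assumption, rule that)
    \<comment> \<open>The grid is fixed first; this tolerance then turns the term with
      \<open>2 * N^2\<close> cut norms into at most \<open>e / 2\<close>.\<close>
    obtain \<phi> where \<phi>: "\<phi> \<in> measure_preserving_maps"
      and small: "cut_dist U (pullback \<phi> W) < e / (4 * real N ^ 2)"
      using weakly_isomorphic_small[OF UW, of "e / (4 * real N ^ 2)"] e N by auto
    have "{x \<in> {0..1}. part_index N x = i} \<in> sets lebesgue" for i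
      using measurable_sets[OF part_index_measurable, of "{i}" N]
      by (auto simp: vimage_def Collect_conj_eq intro!: sets.Int sets_completionI_sets)
    from integral_square_ge[where G = "pullback \<phi> W" and c = c, OF Um Ub' pullback_measurable[OF \<phi> Wm] pb[OF \<phi>] c this part_index_less[OF N]]
    have "(\<integral>z. (U z)\<^sup>2 \<partial>?M) - e / 2 - 2 * real N ^ 2 * cut_dist U (pullback \<phi> W) \<le> (\<integral>z. (pullback \<phi> W z)\<^sup>2 \<partial>?M)"
      using approx by (simp add: cut_dist_def)
    moreover have "2 * real N ^ 2 * cut_dist U (pullback \<phi> W) \<le> e / 2"
      using small N by (simp add: field_simps)
    moreover have "(\<integral>z. (pullback \<phi> W z)\<^sup>2 \<partial>?M) = (\<integral>z. (W z)\<^sup>2 \<partial>?M)"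
      using integral_pullback[OF \<phi>, of "\<lambda>z. (W z)\<^sup>2"] Wm by (simp add: pullback_eq)
    ultimately show "(\<integral>z. (U z)\<^sup>2 \<partial>?M) \<le> (\<integral>z. (W z)\<^sup>2 \<partial>?M) + e" by linarith
  qed
  show "(\<integral>z. (W z)\<^sup>2 \<partial>?M) \<le> (\<integral>z. (U z)\<^sup>2 \<partial>?M)"
  proof (rule field_le_epsilon)
    fix e :: real assume e: "0 < e"
    obtain N c where N: "0 < N" and c: "\<And>i j. \<bar>c i j\<bar> \<le> (1::real)"
      and approx: "(\<integral>z. (W z - c (part_index N (fst z)) (part_index N (snd z)))\<^sup>2 \<partial>?M) < e / 2"
      by (rule step_approximation[OF Wm Wb half_gt_zero[OF e]]) (assumption, rule that)
    obtain \<phi> where \<phi>: "\<phi> \<in> measure_preserving_maps"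
      and small: "cut_dist U (pullback \<phi> W) < e / (4 * real N ^ 2)"
      using weakly_isomorphic_small[OF UW, of "e / (4 * real N ^ 2)"] e N by auto
    have "{x \<in> {0..1}. part_index N (\<phi> x) = i} \<in> sets lebesgue" for i
    proof -
      have "\<phi> \<in> lebesgue_on {0..1} \<rightarrow>\<^sub>M lebesgue_on {0..1}"
        using \<phi> by (simp add: measure_preserving_maps_def)
      moreover have "part_index N \<in> lebesgue_on {0..1} \<rightarrow>\<^sub>M count_space UNIV"
        using part_index_measurable by (intro measurable_restrict_space1 measurable_completion) simp
      ultimately have "(\<lambda>x. part_index N (\<phi> x)) \<in> lebesgue_on {0..1} \<rightarrow>\<^sub>M count_space UNIV"
        by (rule measurable_compose)
      from measurable_sets[OF this, of "{i}"]
      have "(\<lambda>x. part_index N (\<phi> x)) -` {i} \<inter> {0..1} \<in> sets lebesgue"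
        by (simp add: sets_restrict_space_iff)
      moreover have "(\<lambda>x. part_index N (\<phi> x)) -` {i} \<inter> {0..1} = {x \<in> {0..1}. part_index N (\<phi> x) = i}"
        by blast
      ultimately show ?thesis by simp
    qed
    from integral_square_ge[where G = U and c = c, OF pullback_measurable[OF \<phi> Wm] pb[OF \<phi>] Um Ub' c this part_index_less[OF N]]
    have "(\<integral>z. (pullback \<phi> W z)\<^sup>2 \<partial>?M)
        - (\<integral>z. (pullback \<phi> W z - c (part_index N (\<phi> (fst z))) (part_index N (\<phi> (snd z))))\<^sup>2 \<partial>?M)
        - 2 * real N ^ 2 * cut_dist U (pullback \<phi> W) \<le> (\<integral>z. (U z)\<^sup>2 \<partial>?M)"
      by (simp add: cut_dist_def cut_norm_minus_commute)
    moreover have "2 * real N ^ 2 * cut_dist U (pullback \<phi> W) \<le> e / 2"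
      using small N by (simp add: field_simps)
    moreover have "(\<integral>z. (pullback \<phi> W z)\<^sup>2 \<partial>?M) = (\<integral>z. (W z)\<^sup>2 \<partial>?M)"
      using integral_pullback[OF \<phi>, of "\<lambda>z. (W z)\<^sup>2"] Wm by (simp add: pullback_eq)
    moreover have "(\<integral>z. (pullback \<phi> W z - c (part_index N (\<phi> (fst z))) (part_index N (\<phi> (snd z))))\<^sup>2 \<partial>?M)
        = (\<integral>z. (W z - c (part_index N (fst z)) (part_index N (snd z)))\<^sup>2 \<partial>?M)"
      using integral_pullback[OF \<phi>, of "\<lambda>z. (W z - c (part_index N (fst z)) (part_index N (snd z)))\<^sup>2"]
        Wm step_function_measurable[of c N]
      by (simp add: pullback_eq product_map_def)
    ultimately show "(\<integral>z. (W z)\<^sup>2 \<partial>?M) \<le> (\<integral>z. (U z)\<^sup>2 \<partial>?M) + e" using approx by linarith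
  qed
qed

text \<open>The whole square is one of the rectangles tested by the cut norm, and pulling back
  preserves the integral.\<close>

lemma weakly_isomorphic_integral_eq:
  assumes U: "graphon U" and W: "graphon W" and UW: "weakly_isomorphic U W"
  shows "(\<integral>z. U z \<partial>unit_square_measure) = (\<integral>z. W z \<partial>unit_square_measure)"
proof -
  let ?M = unit_square_measure
  note Um = graphonD(1)[OF U] and Wm = graphonD(1)[OF W]
  have "\<bar>(\<integral>z. U z \<partial>?M) - (\<integral>z. W z \<partial>?M)\<bar> \<le> e" if e: "0 < e" for e
  proof -
    obtain \<phi> where \<phi>: "\<phi> \<in> measure_preserving_maps" and small: "cut_dist U (pullback \<phi> W) < e"
      using weakly_isomorphic_small[OF UW e] by auto
    note pm = pullback_measurable[OF \<phi> Wm]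
    have Ub: "\<bar>U z\<bar> \<le> 1" if "z \<in> unit_square" for z
      using graphonD(2,3)[OF U that] by simp
    have pb: "\<bar>pullback \<phi> W z\<bar> \<le> 1" if "z \<in> unit_square" for z
      using graphonD(2,3)[OF W product_map_unit_square[OF \<phi> that]] by (simp add: pullback_eq)
    have int: "integrable ?M U" "integrable ?M (pullback \<phi> W)"
      using Um Ub pm pb by (auto intro!: integrable_unit_square[where B = 1])
    have bound: "\<bar>U z - pullback \<phi> W z\<bar> \<le> 2" if "z \<in> unit_square" for z
      using Ub[OF that] pb[OF that] by linarith
    have "\<bar>LINT z:{0..1} \<times> {0..1}|lebesgue. U z - pullback \<phi> W z\<bar> \<le> cut_dist U (pullback \<phi> W)"
      unfolding cut_dist_def using Um pm bound by (intro abs_set_integral_le_cut_norm[where B = 2]) auto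
    moreover have "(LINT z:{0..1} \<times> {0..1}|lebesgue. U z - pullback \<phi> W z) = (\<integral>z. U z - pullback \<phi> W z \<partial>?M)"
      unfolding set_lebesgue_integral_def by (rule integral_restrict_space[symmetric]) simp
    ultimately show ?thesis using small int integral_pullback[OF \<phi> Wm] by simp
  qed
  then have "\<bar>(\<integral>z. U z \<partial>?M) - (\<integral>z. W z \<partial>?M)\<bar> \<le> 0"
    by (rule field_le_epsilon) simp
  then show ?thesis by simp
qed

text \<open>The average variance of a coin with bias \<open>W z\<close>: it vanishes for graphons
  with values 0 and 1 and is largest, \<open>1/4\<close>, for the constant
  \<open>1/2\<close>.\<close>

definition edge_variance :: "(real \<times> real \<Rightarrow> real) \<Rightarrow> real" where
  "edge_variance W = (\<integral>z. W z * (1 - W z) \<partial>unit_square_measure)"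

lemma weakly_isomorphic_edge_variance:
  assumes U: "graphon U" and W: "graphon W" and UW: "weakly_isomorphic U W"
  shows "edge_variance U = edge_variance W"
proof -
  have "edge_variance V = (\<integral>z. V z \<partial>unit_square_measure) - (\<integral>z. (V z)\<^sup>2 \<partial>unit_square_measure)"
    if V: "graphon V" for V
  proof -
    have "integrable unit_square_measure V" "integrable unit_square_measure (\<lambda>z. (V z)\<^sup>2)"
      using graphonD[OF V] by (auto intro!: integrable_unit_square[where B = 1] simp: abs_square_le_1)
    then show ?thesis by (simp add: edge_variance_def right_diff_distrib power2_eq_square)
  qed
  with assms weakly_isomorphic_integral_eq[OF assms] weakly_isomorphic_integral_square_le[OF assms]
  show ?thesis by simp
qed

lemma edge_variance_L1_dist:
  assumes U: "graphon U" and W: "graphon W"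
  shows "\<bar>edge_variance U - edge_variance W\<bar> \<le> L1_dist U W"
proof -
  let ?M = unit_square_measure
  have bound: "\<bar>u * (1 - u) - w * (1 - w)\<bar> \<le> \<bar>u - w\<bar>" if "0 \<le> u" "u \<le> 1" "0 \<le> w" "w \<le> 1" for u w :: real
  proof -
    have "u * (1 - u) - w * (1 - w) = (u - w) * (1 - u - w)" by (simp add: algebra_simps)
    moreover have "\<bar>u - w\<bar> * \<bar>1 - u - w\<bar> \<le> \<bar>u - w\<bar> * 1"
      using that by (intro mult_left_mono) auto
    ultimately show ?thesis by (simp add: abs_mult)
  qed
  have bound1: "\<bar>V z * (1 - V z)\<bar> \<le> 1" if "graphon V" "z \<in> unit_square" for V z
    using graphonD(2,3)[OF that] by (simp add: abs_mult mult_le_one)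
  have int: "integrable ?M (\<lambda>z. V z * (1 - V z))" if V: "graphon V" for V
    using bound1[OF V] graphonD(1)[OF V] by (intro integrable_unit_square[where B = 1]) auto
  have intd: "integrable ?M (\<lambda>z. \<bar>U z - W z\<bar>)"
    using graphonD[OF U] graphonD[OF W]
    by (intro integrable_unit_square[where B = 1]) (auto simp: abs_le_iff diff_le_eq intro: add_increasing2 order_trans)
  have "\<bar>edge_variance U - edge_variance W\<bar> = \<bar>\<integral>z. U z * (1 - U z) - W z * (1 - W z) \<partial>?M\<bar>"
    using int[OF U] int[OF W] by (simp add: edge_variance_def)
  also have "\<dots> \<le> (\<integral>z. \<bar>U z * (1 - U z) - W z * (1 - W z)\<bar> \<partial>?M)" by (rule integral_abs_bound)
  also have "\<dots> \<le> (\<integral>z. \<bar>U z - W z\<bar> \<partial>?M)"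
  proof (rule integral_mono)
    show "integrable ?M (\<lambda>z. \<bar>U z * (1 - U z) - W z * (1 - W z)\<bar>)"
      using int[OF U] int[OF W] by simp
    fix z assume "z \<in> space ?M"
    then have "z \<in> unit_square" by simp
    with graphonD[OF U] graphonD[OF W]
    show "\<bar>U z * (1 - U z) - W z * (1 - W z)\<bar> \<le> \<bar>U z - W z\<bar>" by (intro bound) auto
  qed (rule intd)
  also have "\<dots> = L1_dist U W" by (simp add: L1_dist_def L1_norm_eq)
  finally show ?thesis .
qed

section \<open>Walsh functions have small cut norm\<close>

text \<open>\<open>walsh m\<close> is the Sylvester-Hadamard matrix of order \<open>2\<^sup>m\<close>.\<close>

definition bit_product :: "nat \<Rightarrow> nat \<Rightarrow> nat \<Rightarrow> nat" where
  "bit_product m p q = (\<Sum>i<m. (p div 2 ^ i mod 2) * (q div 2 ^ i mod 2))"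

definition walsh :: "nat \<Rightarrow> nat \<Rightarrow> nat \<Rightarrow> real" where
  "walsh m p q = (- 1) ^ bit_product m p q"

lemma walsh_Suc: "walsh (Suc m) p q = (- 1) ^ ((p mod 2) * (q mod 2)) * walsh m (p div 2) (q div 2)"
  unfolding walsh_def bit_product_def sum.lessThan_Suc_shift
  by (simp add: power_add div_mult2_eq)

lemma walsh_commute: "walsh m p q = walsh m q p"
  by (simp add: walsh_def bit_product_def mult.commute)

lemma abs_walsh [simp]: "\<bar>walsh m p q\<bar> = 1"
  by (simp add: walsh_def power_abs)

lemma sum_lessThan_double:
  "(\<Sum>q<2 * n. f q) = (\<Sum>q<n. f (2 * q) + f (Suc (2 * q)))" for f :: "nat \<Rightarrow> real"
  by (induction n) (simp_all add: ac_simps)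

text \<open>Splitting \<open>q\<close> by its lowest bit produces the factor
  \<open>1 + ?\<sigma>\<close>, which is 0 if \<open>p\<close> and \<open>p'\<close> differ in their
  lowest bits and 2 otherwise; the remaining bits are left to the induction.\<close>

lemma walsh_orthogonal:
  assumes "p < 2 ^ m" "p' < 2 ^ m"
  shows "(\<Sum>q<2 ^ m. walsh m p q * walsh m p' q) = (if p = p' then 2 ^ m else 0)"
  using assms
proof (induction m arbitrary: p p')
  case 0
  then show ?case by (simp add: walsh_def bit_product_def)
next
  case (Suc m)
  let ?\<sigma> = "(- 1) ^ (p mod 2) * (- 1) ^ (p' mod 2) :: real"
  have double: "walsh (Suc m) a (2 * q) = walsh m (a div 2) q"
    "walsh (Suc m) a (Suc (2 * q)) = (- 1) ^ (a mod 2) * walsh m (a div 2) q" for a q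
    by (simp_all add: walsh_Suc)
  have "(\<Sum>q<2 ^ Suc m. walsh (Suc m) p q * walsh (Suc m) p' q)
      = (\<Sum>q<2 ^ m. (1 + ?\<sigma>) * (walsh m (p div 2) q * walsh m (p' div 2) q))"
    unfolding power_Suc sum_lessThan_double double by (simp add: algebra_simps)
  also have "\<dots> = (1 + ?\<sigma>) * (if p div 2 = p' div 2 then 2 ^ m else 0)"
    using Suc.prems by (subst Suc.IH[symmetric]) (auto simp: sum_distrib_left)
  also have "\<dots> = (if p = p' then 2 ^ Suc m else 0)"
  proof (cases "p div 2 = p' div 2 \<and> p \<noteq> p'")
    case True
    then have "p mod 2 \<noteq> p' mod 2" by (metis div_mult_mod_eq)
    then have "p mod 2 = 0 \<and> p' mod 2 = 1 \<or> p mod 2 = 1 \<and> p' mod 2 = 0" by linarith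
    then show ?thesis using True by auto
  next
    case False
    moreover have "?\<sigma> = 1" if "p = p'"
      using that by (simp flip: power_mult_distrib)
    ultimately show ?thesis by auto
  qed
  finally show ?case .
qed

text \<open>Lindsey's lemma: orthogonality gives the matrix operator norm \<open>2^k\<close>, while
  \<open>s\<close> and \<open>t\<close> have Euclidean norm at most \<open>2^-k\<close>. The even
  exponent keeps the square root of the order a power of two.\<close>

lemma walsh_bilinear:
  assumes s: "\<And>p. p < 2 ^ (2 * k) \<Longrightarrow> \<bar>s p\<bar> \<le> 1 / 2 ^ (2 * k)"
    and t: "\<And>q. q < 2 ^ (2 * k) \<Longrightarrow> \<bar>t q\<bar> \<le> 1 / 2 ^ (2 * k)"
  shows "\<bar>\<Sum>p<2 ^ (2 * k). \<Sum>q<2 ^ (2 * k). walsh (2 * k) p q * (s p * t q)\<bar> \<le> 1 / 2 ^ k"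
proof -
  let ?m = "2 * k" and ?n = "2 ^ (2 * k) :: nat"
  have sq: "(\<Sum>q<?n. (u q)\<^sup>2) \<le> 1 / 2 ^ ?m" if u: "\<And>q. q < ?n \<Longrightarrow> \<bar>u q\<bar> \<le> 1 / 2 ^ ?m" for u :: "nat \<Rightarrow> real"
  proof -
    have "(\<Sum>q<?n. (u q)\<^sup>2) \<le> (\<Sum>q<?n. (1 / 2 ^ ?m)\<^sup>2)"
      using u by (intro sum_mono) (metis abs_ge_zero lessThan_iff power2_abs power_mono)
    also have "\<dots> = 1 / 2 ^ ?m" by (simp add: power2_eq_square)
    finally show ?thesis .
  qed
  define b where "b q = (\<Sum>p<?n. walsh ?m p q * s p)" for q
  have "(\<Sum>q<?n. (b q)\<^sup>2) = (\<Sum>q<?n. \<Sum>p<?n. \<Sum>p'<?n. s p * s p' * (walsh ?m p q * walsh ?m p' q))"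
    unfolding b_def power2_eq_square sum_product by (simp add: ac_simps)
  also have "\<dots> = (\<Sum>p<?n. \<Sum>p'<?n. s p * s p' * (\<Sum>q<?n. walsh ?m p q * walsh ?m p' q))"
    unfolding sum_distrib_left by (subst sum.swap) (intro sum.cong refl sum.swap)
  also have "\<dots> = (\<Sum>p<?n. \<Sum>p'<?n. if p = p' then s p * s p' * 2 ^ ?m else 0)"
    by (intro sum.cong refl) (simp add: walsh_orthogonal)
  also have "\<dots> = 2 ^ ?m * (\<Sum>p<?n. (s p)\<^sup>2)"
    by (simp add: sum_distrib_left power2_eq_square ac_simps)
  also have "\<dots> \<le> 2 ^ ?m * (1 / 2 ^ ?m)" using sq[OF s] by (intro mult_left_mono) auto
  finally have b: "(\<Sum>q<?n. (b q)\<^sup>2) \<le> 1" by simp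
  have "(\<Sum>p<?n. \<Sum>q<?n. walsh ?m p q * (s p * t q)) = (\<Sum>q<?n. t q * b q)"
    unfolding b_def sum_distrib_left by (subst sum.swap) (simp add: ac_simps)
  moreover have "(\<Sum>q<?n. t q * b q)\<^sup>2 \<le> (\<Sum>q<?n. (t q)\<^sup>2) * (\<Sum>q<?n. (b q)\<^sup>2)"
    by (rule Cauchy_Schwarz_ineq_sum)
  moreover have "\<dots> \<le> 1 / 2 ^ ?m * 1"
    using sq[OF t] b by (intro mult_mono) (auto intro: sum_nonneg)
  ultimately have "(\<Sum>p<?n. \<Sum>q<?n. walsh ?m p q * (s p * t q))\<^sup>2 \<le> (1 / 2 ^ k)\<^sup>2"
    by (simp add: power_divide power_mult[symmetric] mult.commute)
  then show ?thesis unfolding abs_le_square_iff[symmetric] by simp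
qed

section \<open>Grid parts and integrals of step functions over rectangles\<close>

definition grid_part :: "nat \<Rightarrow> nat \<Rightarrow> real set" where
  "grid_part n i = {x \<in> {0..1}. part_index n x = i}"

lemma grid_part_sets: "grid_part n i \<in> sets lebesgue" "grid_part n i \<subseteq> {0..1}"
proof -
  have "grid_part n i = part_index n -` {i} \<inter> {0..1}" by (auto simp: grid_part_def)
  then show "grid_part n i \<in> sets lebesgue"
    using measurable_sets[OF part_index_measurable, of "{i}" n] by (simp add: sets_completionI_sets)
qed (auto simp: grid_part_def)

lemma measure_grid_part:
  assumes "i < n" shows "measure lebesgue (grid_part n i) = 1 / real n"
proof -
  have n: "0 < real n" using assms by simp
  have nonneg: "0 \<le> x" if "real i / real n \<le> x" for x
    by (rule order_trans[OF _ that]) simp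
  show ?thesis
  proof (cases "Suc i < n")
    case True
    have iff: "part_index n x = i \<longleftrightarrow> real i / real n \<le> x \<and> x < (real i + 1) / real n" if "0 \<le> x" "x \<le> 1" for x
    proof -
      have "part_index n x = i \<longleftrightarrow> \<lfloor>real n * x\<rfloor> = int i"
        using True that unfolding part_index_def by (auto simp: min_def nat_eq_iff)
      also have "\<dots> \<longleftrightarrow> real i \<le> real n * x \<and> real n * x < real i + 1"
        by (simp add: floor_eq_iff)
      also have "\<dots> \<longleftrightarrow> real i / real n \<le> x \<and> x < (real i + 1) / real n"
        using n by (simp add: field_simps)
      finally show ?thesis .
    qed
    have le_1: "(real i + 1) / real n \<le> 1" using True by simp
    have "grid_part n i = {real i / real n..<(real i + 1) / real n}"
    proof (rule set_eqI)
      fix x show "x \<in> grid_part n i \<longleftrightarrow> x \<in> {real i / real n..<(real i + 1) / real n}"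
        using iff[of x] nonneg[of x] le_1 by (auto simp: grid_part_def)
    qed
    then show ?thesis using n by (simp add: field_simps)
  next
    \<comment> \<open>The last part is closed at 1 because of the clipping, and has to be computed
      separately.\<close>
    case False
    with assms have i: "n = Suc i" by simp
    have iff: "part_index n x = i \<longleftrightarrow> real i / real n \<le> x" if "0 \<le> x" "x \<le> 1" for x
    proof -
      have "part_index n x = i \<longleftrightarrow> int i \<le> \<lfloor>real n * x\<rfloor>"
      proof -
        have "0 \<le> \<lfloor>real n * x\<rfloor>" using that by simp
        then show ?thesis unfolding part_index_def i by (auto simp: min_def nat_le_iff nat_eq_iff)
      qed
      also have "\<dots> \<longleftrightarrow> real i \<le> real n * x"
        by (simp add: le_floor_iff)
      also have "\<dots> \<longleftrightarrow> real i / real n \<le> x"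
        using n by (simp add: field_simps)
      finally show ?thesis .
    qed
    have "grid_part n i = {real i / real n..1}"
    proof (rule set_eqI)
      fix x show "x \<in> grid_part n i \<longleftrightarrow> x \<in> {real i / real n..1}"
        using iff[of x] nonneg[of x] by (auto simp: grid_part_def)
    qed
    then show ?thesis using n i by (simp add: field_simps)
  qed
qed

lemma measure_lebesgue_Times:
  fixes A B :: "real set"
  assumes "A \<in> sets lebesgue" "B \<in> sets lebesgue"
  shows "measure lebesgue (A \<times> B) = measure lebesgue A * measure lebesgue B"
  using assms by (simp add: measure_def emeasure_lebesgue_Times enn2real_mult)

lemma integral_indicator_unit_square:
  assumes A: "A \<in> sets lebesgue" "A \<subseteq> {0..1}" and B: "B \<in> sets lebesgue" "B \<subseteq> {0..1}"
  shows "(\<integral>z. indicator (A \<times> B) z \<partial>unit_square_measure) = measure lebesgue A * measure lebesgue B"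
proof -
  have sub: "A \<times> B \<subseteq> unit_square" using A B by auto
  have "(\<integral>z. indicator (A \<times> B) z \<partial>unit_square_measure) = measure unit_square_measure (A \<times> B)"
    using sub by (simp add: Int_absorb2)
  also have "\<dots> = measure lebesgue (A \<times> B)"
    using sub by (intro measure_restrict_space) auto
  finally show ?thesis using A B by (simp add: measure_lebesgue_Times)
qed

lemma double_sum_delta:
  fixes a b :: nat
  assumes "a < n" "b < n"
  shows "(\<Sum>i<n. \<Sum>j<n. if i = a \<and> j = b then c i j else (0 :: real)) = c a b"
proof -
  have "(\<Sum>i<n. \<Sum>j<n. if i = a \<and> j = b then c i j else 0) = (\<Sum>i<n. if i = a then c i b else 0)"
    using assms by (intro sum.cong refl) (auto simp: sum.delta)
  then show ?thesis using assms by (simp add: sum.delta)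
qed

text \<open>Only the masses of \<open>S\<close> and \<open>T\<close> in the parts matter; this
  reduces the cut norm of a step function to a bilinear form in two vectors with entries at most
  \<open>1 / n\<close>.\<close>

lemma integral_step_rectangle:
  fixes c :: "nat \<Rightarrow> nat \<Rightarrow> real"
  assumes n: "0 < n" and S: "S \<in> sets lebesgue" "S \<subseteq> {0..1}" and T: "T \<in> sets lebesgue" "T \<subseteq> {0..1}"
  shows "(\<integral>z. indicator (S \<times> T) z * c (part_index n (fst z)) (part_index n (snd z)) \<partial>unit_square_measure)
    = (\<Sum>i<n. \<Sum>j<n. c i j * (measure lebesgue (S \<inter> grid_part n i) * measure lebesgue (T \<inter> grid_part n j)))"
proof -
  let ?M = unit_square_measure
  have sets: "S \<inter> grid_part n i \<in> sets lebesgue" "S \<inter> grid_part n i \<subseteq> {0..1}"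
    "T \<inter> grid_part n i \<in> sets lebesgue" "T \<inter> grid_part n i \<subseteq> {0..1}" for i
    using S T grid_part_sets[of n i] by auto
  have "(\<integral>z. indicator (S \<times> T) z * c (part_index n (fst z)) (part_index n (snd z)) \<partial>?M)
      = (\<integral>z. (\<Sum>i<n. \<Sum>j<n. c i j * indicator ((S \<inter> grid_part n i) \<times> (T \<inter> grid_part n j)) z) \<partial>?M)"
  proof (rule Bochner_Integration.integral_cong[OF refl])
    fix z assume "z \<in> space ?M"
    then obtain x y where z: "z = (x, y)" "x \<in> {0..1}" "y \<in> {0..1}" by auto
    have "(\<Sum>i<n. \<Sum>j<n. c i j * indicator ((S \<inter> grid_part n i) \<times> (T \<inter> grid_part n j)) z)
        = (\<Sum>i<n. \<Sum>j<n. if i = part_index n x \<and> j = part_index n y then c i j * indicator (S \<times> T) z else 0)"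
      using z by (intro sum.cong refl) (auto simp: grid_part_def indicator_def)
    also have "\<dots> = c (part_index n x) (part_index n y) * indicator (S \<times> T) z"
      using part_index_less[OF n] by (intro double_sum_delta)
    finally show "indicator (S \<times> T) z * c (part_index n (fst z)) (part_index n (snd z))
        = (\<Sum>i<n. \<Sum>j<n. c i j * indicator ((S \<inter> grid_part n i) \<times> (T \<inter> grid_part n j)) z)"
      by (simp only: z fst_conv snd_conv mult.commute)
  qed
  also have "\<dots> = (\<Sum>i<n. \<Sum>j<n. c i j * (\<integral>z. indicator ((S \<inter> grid_part n i) \<times> (T \<inter> grid_part n j)) z \<partial>?M))"
  proof -
    have int: "integrable ?M (\<lambda>z. c i j * indicator ((S \<inter> grid_part n i) \<times> (T \<inter> grid_part n j)) z)" for i j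
    proof (rule integrable_mult_right)
      have "indicator ((S \<inter> grid_part n i) \<times> (T \<inter> grid_part n j)) \<in> borel_measurable ?M"
        by (rule indicator_unit_square_measurable) (rule sets)+
      then show "integrable ?M (indicator ((S \<inter> grid_part n i) \<times> (T \<inter> grid_part n j)) :: _ \<Rightarrow> real)"
        by (rule integrable_unit_square[where B = 1]) (simp add: indicator_def)
    qed
    have "(\<integral>z. (\<Sum>i<n. \<Sum>j<n. c i j * indicator ((S \<inter> grid_part n i) \<times> (T \<inter> grid_part n j)) z) \<partial>?M)
        = (\<Sum>i<n. \<integral>z. (\<Sum>j<n. c i j * indicator ((S \<inter> grid_part n i) \<times> (T \<inter> grid_part n j)) z) \<partial>?M)"
      by (rule Bochner_Integration.integral_sum) (intro Bochner_Integration.integrable_sum int)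
    also have "\<dots> = (\<Sum>i<n. \<Sum>j<n. \<integral>z. c i j * indicator ((S \<inter> grid_part n i) \<times> (T \<inter> grid_part n j)) z \<partial>?M)"
      by (intro sum.cong refl Bochner_Integration.integral_sum int)
    finally show ?thesis by (simp only: integral_mult_right_zero)
  qed
  finally show ?thesis
    by (simp only: integral_indicator_unit_square[OF sets(1,2) sets(3,4)])
qed

definition walsh_fun :: "nat \<Rightarrow> real \<times> real \<Rightarrow> real" where
  "walsh_fun m z = walsh m (part_index (2 ^ m) (fst z)) (part_index (2 ^ m) (snd z))"

lemma walsh_fun_rectangle:
  assumes S: "S \<in> sets lebesgue" "S \<subseteq> {0..1}" and T: "T \<in> sets lebesgue" "T \<subseteq> {0..1}"
  shows "\<bar>\<integral>z. indicator (S \<times> T) z * walsh_fun (2 * k) z \<partial>unit_square_measure\<bar> \<le> 1 / 2 ^ k"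
proof -
  have le: "\<bar>measure lebesgue (A \<inter> grid_part (2 ^ (2 * k)) i)\<bar> \<le> 1 / 2 ^ (2 * k)"
    if "A \<in> sets lebesgue" "i < 2 ^ (2 * k)" for A i
  proof -
    have "grid_part (2 ^ (2 * k)) i \<in> fmeasurable lebesgue"
      by (rule bounded_set_imp_lmeasurable)
        (rule bounded_subset[OF bounded_closed_interval grid_part_sets(2)], rule grid_part_sets(1))
    then have "measure lebesgue (A \<inter> grid_part (2 ^ (2 * k)) i) \<le> measure lebesgue (grid_part (2 ^ (2 * k)) i)"
      using that(1) grid_part_sets by (intro measure_mono_fmeasurable) auto
    then show ?thesis using measure_grid_part[OF that(2)] by simp
  qed
  show ?thesis
    unfolding walsh_fun_def using S T
    by (subst integral_step_rectangle) (auto intro!: walsh_bilinear le)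
qed

section \<open>The graphon\<close>

text \<open>Dyadic grids are nested, so a cell of a fine grid determines the cell of every coarser
  one by division. Comparing blocks and computing the name both rest on this.\<close>

lemma part_index_coarsen:
  assumes "a \<le> b"
  shows "part_index (2 ^ a) x = part_index (2 ^ b) x div 2 ^ (b - a)"
proof -
  have pow: "(2::nat) ^ b = 2 ^ a * 2 ^ (b - a)" using assms by (simp flip: power_add)
  have "nat \<lfloor>2 ^ a * x\<rfloor> = nat \<lfloor>2 ^ b * x\<rfloor> div 2 ^ (b - a)"
  proof -
    have "(2::real) ^ b = 2 ^ a * 2 ^ (b - a)" using assms by (simp flip: power_add)
    then have "2 ^ a * x = 2 ^ b * x / of_int (2 ^ (b - a))" by simp
    then have "\<lfloor>2 ^ a * x\<rfloor> = \<lfloor>2 ^ b * x\<rfloor> div 2 ^ (b - a)"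
      by (simp only: floor_divide_real_eq_div[of "2 ^ (b - a)"] zero_le_power zero_le_numeral)
    then show ?thesis
      by (simp add: nat_div_distrib' nat_power_eq)
  qed
  \<comment> \<open>The clipped last parts correspond to each other as well.\<close>
  moreover have "(2 ^ b - 1) div 2 ^ (b - a) = (2 ^ a - 1 :: nat)"
  proof -
    have eq: "(2 ^ b - 1 :: nat) = (2 ^ a - 1) * 2 ^ (b - a) + (2 ^ (b - a) - 1)"
      unfolding pow by (simp add: algebra_simps)
    show ?thesis unfolding eq by (subst div_mult_self3) simp_all
  qed
  moreover have "min u v div k = min (u div k) (v div k)" for u v k :: nat
    by (simp add: min_def) (meson div_le_mono le_antisym nat_le_linear)
  ultimately show ?thesis by (simp add: part_index_def)
qed

text \<open>Part 1 runs from \<open>2^-(e+1)\<close> to \<open>2^-e\<close>, so it collects the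
  numbers whose first binary digit 1 is at place \<open>e + 1\<close>. For \<open>e = 0\<close> it
  is the last part and contains 1; together the blocks tile the interval from 0 to 1 without the
  point 0.\<close>

abbreviation block :: "nat \<Rightarrow> real set" where
  "block e \<equiv> grid_part (2 ^ Suc e) 1"

abbreviation square_block :: "nat \<Rightarrow> (real \<times> real) set" where
  "square_block e \<equiv> block e \<times> block e"

lemma block_unique:
  assumes "x \<in> block e" "x \<in> block e'"
  shows "e = e'"
proof -
  have "\<not> a < b" if "x \<in> block a" "x \<in> block b" for a b
  proof
    assume "a < b"
    with that have "1 = 1 div (2::nat) ^ (b - a)"
      using part_index_coarsen[of "Suc a" "Suc b" x] by (simp add: grid_part_def)
    moreover have "(1::nat) < 2 ^ (b - a)" using \<open>a < b\<close> by (intro one_less_power) auto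
    ultimately show False by simp
  qed
  with assms show ?thesis by (meson linorder_neqE_nat)
qed

lemma measure_block: "measure lebesgue (block e) = 1 / 2 ^ Suc e"
proof -
  have "1 < (2::nat) ^ Suc e" by (rule one_less_power) simp_all
  from measure_grid_part[OF this] show ?thesis by simp
qed

section \<open>Stages of the construction and their pointwise limit\<close>

definition found :: "nat \<Rightarrow> nat \<Rightarrow> bool" where
  "found e j \<longleftrightarrow> (\<exists>w<j. halting_witness e w)"

definition first_witness :: "nat \<Rightarrow> nat" where
  "first_witness e = (LEAST w. halting_witness e w)"

text \<open>At this order the pattern is within \<open>2\<^sup>-\<^sup>w\<^sup>-\<^sup>e\<^sup>-\<^sup>2\<close> of \<open>1/2\<close> in cut norm, where \<open>w\<close> is the first witness; the
  term \<open>e\<close> makes the errors of all blocks summable.\<close>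
definition pattern_value :: "bool \<Rightarrow> nat \<Rightarrow> real \<times> real \<Rightarrow> real" where
  "pattern_value b e z = (if b then (1 + walsh_fun (2 * (first_witness e + e + 2)) z) / 2 else 1 / 2)"

definition stage :: "nat \<Rightarrow> real \<times> real \<Rightarrow> real" where
  "stage j z = (\<Sum>e<j. indicator (square_block e) z * pattern_value (found e j) e z)"

text \<open>At most one term of the series is nonzero, as the blocks are disjoint.\<close>
definition halting_graphon :: "real \<times> real \<Rightarrow> real" where
  "halting_graphon z = (\<Sum>e. indicator (square_block e) z * pattern_value (e \<in> halting_set) e z)"

lemma abs_walsh_fun [simp]: "\<bar>walsh_fun m z\<bar> = 1"
  by (simp add: walsh_fun_def)

lemma walsh_fun_cases: "walsh_fun m z = 1 \<or> walsh_fun m z = - 1"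
  using abs_walsh_fun[of m z] by linarith

lemma pattern_value_bounds: "0 \<le> pattern_value b e z" "pattern_value b e z \<le> 1"
  using walsh_fun_cases[of "2 * (first_witness e + e + 2)" z] by (auto simp: pattern_value_def)

lemma pattern_value_commute: "pattern_value b e (x, y) = pattern_value b e (y, x)"
  by (simp add: pattern_value_def walsh_fun_def walsh_commute)

lemma pattern_value_measurable [measurable]:
  "pattern_value b e \<in> borel_measurable unit_square_measure"
proof -
  have [measurable]: "walsh_fun m \<in> borel_measurable unit_square_measure" for m
    unfolding walsh_fun_def by (rule step_function_measurable)
  show ?thesis unfolding pattern_value_def by measurable
qed

lemma indicator_square_block_measurable [measurable]:
  "indicator (square_block e) \<in> borel_measurable unit_square_measure"
  by (rule indicator_unit_square_measurable) (rule grid_part_sets)+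

lemma stage_measurable [measurable]: "stage j \<in> borel_measurable unit_square_measure"
  unfolding stage_def by measurable

lemma square_block_iff: "z \<in> square_block e \<Longrightarrow> z \<in> square_block e' \<longleftrightarrow> e' = e"
  unfolding mem_Times_iff using block_unique by blast

lemma indicator_square_block:
  "z \<in> square_block e \<Longrightarrow> indicator (square_block e') z = (if e' = e then 1 else 0 :: real)"
  by (simp only: indicator_def square_block_iff of_bool_def)

lemma stage_eq:
  assumes "z \<in> square_block e"
  shows "stage j z = (if e < j then pattern_value (found e j) e z else 0)"
proof -
  have "stage j z = (\<Sum>e'<j. if e' = e then pattern_value (found e' j) e' z else 0)"
    unfolding stage_def using indicator_square_block[OF assms] by (intro sum.cong refl) auto
  then show ?thesis by (simp add: sum.delta)
qed

lemma halting_graphon_eq: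
  assumes "z \<in> square_block e"
  shows "halting_graphon z = pattern_value (e \<in> halting_set) e z"
proof -
  have "(\<lambda>e'. indicator (square_block e') z * pattern_value (e' \<in> halting_set) e' z)
      = (\<lambda>e'. if e' = e then pattern_value (e' \<in> halting_set) e' z else 0)"
    using indicator_square_block[OF assms] by (auto simp: fun_eq_iff)
  then show ?thesis
    unfolding halting_graphon_def
    using sums_single[of e "\<lambda>e'. pattern_value (e' \<in> halting_set) e' z"] by (simp add: sums_iff)
qed

lemma outside_blocks:
  assumes "\<And>e. z \<notin> square_block e"
  shows "stage j z = 0" "halting_graphon z = 0"
proof -
  have "indicator (square_block e) z = (0 :: real)" for e
    using assms by (simp only: indicator_def of_bool_def if_False)
  then show "stage j z = 0" "halting_graphon z = 0"
    by (simp_all only: stage_def halting_graphon_def mult_zero_left sum.neutral_const suminf_zero)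
qed

lemma eventually_found: "\<forall>\<^sub>F j in sequentially. found e j \<longleftrightarrow> e \<in> halting_set"
proof (cases "e \<in> halting_set")
  case True
  then obtain w where "halting_witness e w" by (auto simp: halting_set_iff)
  then have "found e j" if "w < j" for j using that by (auto simp: found_def)
  with True show ?thesis
    by (auto intro!: eventually_mono[OF eventually_gt_at_top[of w]])
next
  case False
  then show ?thesis by (simp add: halting_set_iff found_def)
qed

text \<open>At a fixed point at most one program matters, and its verdict changes at most
  once.\<close>

lemma eventually_stage: "\<forall>\<^sub>F j in sequentially. stage j z = halting_graphon z"
proof (cases "\<exists>e. z \<in> square_block e")
  case True
  then obtain e where e: "z \<in> square_block e" by blast
  show ?thesis
    using eventually_found[of e] eventually_gt_at_top[of e]
    by eventually_elim (simp add: stage_eq[OF e] halting_graphon_eq[OF e])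
next
  case False
  then show ?thesis by (simp add: outside_blocks)
qed

lemma stage_tendsto: "(\<lambda>j. stage j z) \<longlonglongrightarrow> halting_graphon z"
  by (rule tendsto_eventually[OF eventually_stage])

lemma stage_bounds: "0 \<le> stage j z" "stage j z \<le> 1"
proof -
  have "0 \<le> stage j z \<and> stage j z \<le> 1"
  proof (cases "\<exists>e. z \<in> square_block e")
    case True
    then obtain e where e: "z \<in> square_block e" by blast
    show ?thesis unfolding stage_eq[OF e] by (simp add: pattern_value_bounds)
  next
    case False
    then have "stage j z = 0" by (intro outside_blocks) blast
    then show ?thesis by simp
  qed
  then show "0 \<le> stage j z" "stage j z \<le> 1" by simp_all
qed

lemma halting_graphon_bounds: "0 \<le> halting_graphon z" "halting_graphon z \<le> 1"
proof -
  show "0 \<le> halting_graphon z"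
    by (rule tendsto_lowerbound[OF stage_tendsto]) (simp_all add: stage_bounds)
  show "halting_graphon z \<le> 1"
    by (rule tendsto_upperbound[OF stage_tendsto]) (simp_all add: stage_bounds)
qed

lemma graphon_halting_graphon: "graphon halting_graphon"
  unfolding graphon_def
proof (intro conjI ballI)
  show "halting_graphon \<in> borel_measurable unit_square_measure"
    by (rule borel_measurable_LIMSEQ_real[OF stage_tendsto stage_measurable])
  fix x y :: real
  have "indicator (square_block e) (x, y) = (indicator (square_block e) (y, x) :: real)" for e
    by (auto simp: indicator_def)
  then show "halting_graphon (x, y) = halting_graphon (y, x)"
    unfolding halting_graphon_def by (simp add: pattern_value_commute[of _ _ x y])
qed (simp_all add: halting_graphon_bounds)

section \<open>Convergence of the stages in cut norm\<close>

lemma cut_norm_cong: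
  assumes "\<And>z. z \<in> unit_square \<Longrightarrow> F z = G z"
  shows "cut_norm F = cut_norm G"
  unfolding cut_norm_def
proof (rule SUP_cong[OF refl], clarify)
  fix S T :: "real set" assume "S \<subseteq> {0..1}" "T \<subseteq> {0..1}"
  then have "(\<lambda>z. indicator (S \<times> T) z *\<^sub>R F z) = (\<lambda>z. indicator (S \<times> T) z *\<^sub>R G z)"
    using assms by (auto simp: indicator_def fun_eq_iff)
  then show "\<bar>LINT z:S \<times> T|lebesgue. F z\<bar> = \<bar>LINT z:S \<times> T|lebesgue. G z\<bar>"
    by (simp only: set_lebesgue_integral_def)
qed

lemma cut_norm_le_L1:
  assumes F: "F \<in> borel_measurable unit_square_measure" "\<And>z. z \<in> unit_square \<Longrightarrow> \<bar>F z\<bar> \<le> B"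
  shows "cut_norm F \<le> (\<integral>z. \<bar>F z\<bar> \<partial>unit_square_measure)"
  using abs_set_integral_le[OF F] by (intro cut_norm_le)

text \<open>The stages converge even in the \<open>L1\<close> distance, by dominated convergence,
  but this gives no rate. The effective rate in cut norm is the content of
  \<open>stage_cut_dist\<close>.\<close>

lemma stage_cut_dist_tendsto: "(\<lambda>j. cut_dist (stage j) halting_graphon) \<longlonglongrightarrow> 0"
proof (rule tendsto_sandwich[OF _ _ tendsto_const])
  let ?M = unit_square_measure
  have [measurable]: "halting_graphon \<in> borel_measurable ?M"
    using graphon_halting_graphon by (rule graphonD)
  have meas: "(\<lambda>z. stage j z - halting_graphon z) \<in> borel_measurable ?M" for j by measurable
  have bound: "\<bar>stage j z - halting_graphon z\<bar> \<le> 1" for j z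
    using stage_bounds[of j z] halting_graphon_bounds[of z] by linarith
  show "\<forall>\<^sub>F j in sequentially. 0 \<le> cut_dist (stage j) halting_graphon"
    unfolding cut_dist_def using cut_norm_nonneg[OF meas bound] by simp
  show "\<forall>\<^sub>F j in sequentially. cut_dist (stage j) halting_graphon \<le> (\<integral>z. \<bar>stage j z - halting_graphon z\<bar> \<partial>?M)"
    unfolding cut_dist_def using cut_norm_le_L1[OF meas bound] by simp
  have "(\<lambda>j. \<integral>z. \<bar>stage j z - halting_graphon z\<bar> \<partial>?M) \<longlonglongrightarrow> (\<integral>z. 0 \<partial>?M)"
  proof (rule integral_dominated_convergence[where w = "\<lambda>_. 1"])
    show "AE z in ?M. (\<lambda>j. \<bar>stage j z - halting_graphon z\<bar>) \<longlonglongrightarrow> 0"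
      by (intro AE_I2 tendsto_eventually eventually_mono[OF eventually_stage]) simp
  qed (use bound in \<open>auto intro!: AE_I2\<close>)
  then show "(\<lambda>j. \<integral>z. \<bar>stage j z - halting_graphon z\<bar> \<partial>?M) \<longlonglongrightarrow> 0" by simp
qed

lemma sum_geometric_le: "(\<Sum>e<l. 1 / 2 ^ Suc e) \<le> (1 :: real)"
proof -
  have "(\<Sum>e<l. 1 / 2 ^ Suc e) = (1 - 1 / 2 ^ l :: real)"
    by (induction l) (simp_all add: field_simps)
  then show ?thesis by simp
qed

text \<open>Each block contributes at most \<open>2^-j * 2^-(e+1)\<close>. If \<open>e < j\<close>,
  a change means that the first witness is at least \<open>j\<close>, so the pattern is of high
  order. If \<open>e \<ge> j\<close>, the block is new at stage \<open>l\<close>, but its area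
  \<open>4^-(e+1)\<close> is already small enough.\<close>

lemma stage_cut_dist:
  assumes "j < l"
  shows "cut_dist (stage j) (stage l) \<le> 1 / 2 ^ j"
  unfolding cut_dist_def
proof (rule cut_norm_le)
  fix S T :: "real set"
  assume S: "S \<in> sets lebesgue" "S \<subseteq> {0..1}" and T: "T \<in> sets lebesgue" "T \<subseteq> {0..1}"
  let ?M = unit_square_measure
  define d where "d e z = (if e < j then pattern_value (found e j) e z else 0) - pattern_value (found e l) e z"
    for e z
  define R where "R e = (S \<inter> block e) \<times> (T \<inter> block e)" for e
  have sets: "S \<inter> block e \<in> sets lebesgue" "S \<inter> block e \<subseteq> {0..1}"
    "T \<inter> block e \<in> sets lebesgue" "T \<inter> block e \<subseteq> {0..1}" for e
    using S T grid_part_sets[of "2 ^ Suc e" 1] by auto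
  have [measurable]: "d e \<in> borel_measurable ?M" for e
    unfolding d_def by (cases "e < j") simp_all
  have R_meas [measurable]: "indicator (R e) \<in> borel_measurable ?M" for e
    unfolding R_def by (rule indicator_unit_square_measurable[OF sets])
  have d_bound: "\<bar>d e z\<bar> \<le> 1" for e z
    using pattern_value_bounds[of "found e j" e z] pattern_value_bounds[of "found e l" e z]
    by (auto simp: d_def)
  have int: "integrable ?M (\<lambda>z. indicator (R e) z * d e z)" for e
    using d_bound by (intro integrable_unit_square[where B = 1]) (auto simp: abs_mult mult_le_one)
  have bound: "\<bar>\<integral>z. indicator (R e) z * d e z \<partial>?M\<bar> \<le> 1 / 2 ^ j * (1 / 2 ^ Suc e)" for e
  proof (cases "e < j")
    case True
    show ?thesis
    proof (cases "found e j = found e l")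
      case eq: True
      with True have "d e z = 0" for z by (simp add: d_def)
      then show ?thesis by simp
    next
      case False
      then have f: "\<not> found e j" "found e l"
        using assms by (auto simp: found_def)
      then obtain w where "halting_witness e w" by (auto simp: found_def)
      then have "halting_witness e (first_witness e)"
        unfolding first_witness_def by (rule LeastI)
      with f(1) have w: "j \<le> first_witness e"
        unfolding found_def by (meson leI)
      have d: "d e z = - (walsh_fun (2 * (first_witness e + e + 2)) z / 2)" for z
        using True f by (simp add: d_def pattern_value_def field_simps)
      have "\<bar>\<integral>z. indicator (R e) z * d e z \<partial>?M\<bar>
          = \<bar>\<integral>z. indicator (R e) z * walsh_fun (2 * (first_witness e + e + 2)) z \<partial>?M\<bar> / 2"
        unfolding d by simp
      also have "\<dots> \<le> 1 / 2 ^ (first_witness e + e + 2) / 2"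
        unfolding R_def by (intro divide_right_mono walsh_fun_rectangle sets) simp
      also have "\<dots> \<le> 1 / 2 ^ (j + Suc e)"
      proof -
        have "(2::real) ^ (j + Suc e) \<le> 2 ^ (first_witness e + e + 2)"
          using w by (intro power_increasing) auto
        then have le: "1 / 2 ^ (first_witness e + e + 2) \<le> (1::real) / 2 ^ (j + Suc e)"
          by (intro divide_left_mono) auto
        show ?thesis by (rule order_trans[OF _ le]) (simp add: field_simps)
      qed
      finally show ?thesis by (simp add: power_add)
    qed
  next
    case False
    have "\<bar>\<integral>z. indicator (R e) z * d e z \<partial>?M\<bar> \<le> (\<integral>z. \<bar>indicator (R e) z * d e z\<bar> \<partial>?M)"
      by (rule integral_abs_bound)
    also have "\<dots> \<le> (\<integral>z. indicator (R e) z \<partial>?M)"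
    proof (rule integral_mono)
      show "integrable ?M (indicator (R e) :: _ \<Rightarrow> real)"
        by (intro integrable_unit_square[where B = 1]) (auto simp: indicator_def R_meas)
      show "\<bar>indicator (R e) z * d e z\<bar> \<le> indicator (R e) z" for z
        using d_bound[of e z] by (simp add: indicator_def)
    qed (use int in simp)
    also have "\<dots> = measure lebesgue (S \<inter> block e) * measure lebesgue (T \<inter> block e)"
      unfolding R_def by (rule integral_indicator_unit_square[OF sets])
    also have "\<dots> \<le> 1 / 2 ^ Suc e * (1 / 2 ^ Suc e)"
    proof -
      have lm: "block e \<in> lmeasurable"
        by (rule bounded_set_imp_lmeasurable)
          (rule bounded_subset[OF bounded_closed_interval grid_part_sets(2)], rule grid_part_sets(1))
      have "measure lebesgue (A \<inter> block e) \<le> 1 / 2 ^ Suc e" if "A \<in> sets lebesgue" for A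
        unfolding measure_block[symmetric]
        using that grid_part_sets by (intro measure_mono_fmeasurable lm) auto
      with S T show ?thesis by (intro mult_mono) auto
    qed
    also have "\<dots> \<le> 1 / 2 ^ j * (1 / 2 ^ Suc e)"
    proof (intro mult_right_mono divide_left_mono)
      show "(2::real) ^ j \<le> 2 ^ Suc e" using False by (intro power_increasing) auto
    qed auto
    finally show ?thesis .
  qed
  have "(LINT z:S \<times> T|lebesgue. stage j z - stage l z) = (\<integral>z. indicator (S \<times> T) z * (stage j z - stage l z) \<partial>?M)"
    using S T by (intro set_integral_unit_square) auto
  also have "\<dots> = (\<integral>z. (\<Sum>e<l. indicator (R e) z * d e z) \<partial>?M)"
  proof (rule Bochner_Integration.integral_cong[OF refl])
    fix z
    have "stage j z = (\<Sum>e<l. indicator (square_block e) z * (if e < j then pattern_value (found e j) e z else 0))"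
      unfolding stage_def using assms by (intro sum.mono_neutral_cong_left) auto
    then have "stage j z - stage l z = (\<Sum>e<l. indicator (square_block e) z * d e z)"
      by (simp only: stage_def d_def sum_subtractf[symmetric] right_diff_distrib)
    then have "indicator (S \<times> T) z * (stage j z - stage l z)
        = (\<Sum>e<l. indicator (S \<times> T) z * (indicator (square_block e) z * d e z))"
      by (simp only: sum_distrib_left)
    also have "\<dots> = (\<Sum>e<l. indicator (R e) z * d e z)"
      by (intro sum.cong refl) (auto simp: R_def indicator_def)
    finally show "indicator (S \<times> T) z * (stage j z - stage l z) = (\<Sum>e<l. indicator (R e) z * d e z)" .
  qed
  also have "\<dots> = (\<Sum>e<l. \<integral>z. indicator (R e) z * d e z \<partial>?M)"
    by (rule Bochner_Integration.integral_sum) (rule int)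
  also have "\<bar>\<dots>\<bar> \<le> (\<Sum>e<l. 1 / 2 ^ j * (1 / 2 ^ Suc e))"
    by (intro order_trans[OF sum_abs] sum_mono bound)
  also have "\<dots> = 1 / 2 ^ j * (\<Sum>e<l. 1 / 2 ^ Suc e)" by (simp only: sum_distrib_left)
  also have "\<dots> \<le> 1 / 2 ^ j * 1" by (intro mult_left_mono sum_geometric_le) simp
  finally show "\<bar>LINT z:S \<times> T|lebesgue. stage j z - stage l z\<bar> \<le> 1 / 2 ^ j" by simp
qed

lemma edge_variance_halting_graphon:
  "(\<lambda>e. if e \<in> halting_set then 0 else 1 / 4 ^ (e + 2)) sums edge_variance halting_graphon"
proof -
  let ?M = unit_square_measure
  define A where "A e = (if e \<in> halting_set then {} else square_block e)" for e
  have A_sub: "A e \<subseteq> unit_square" for e using grid_part_sets(2) by (auto simp: A_def)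
  have A_sets: "A e \<in> sets ?M" for e
    using A_sub[of e] by (auto simp: A_def sets_restrict_space_iff intro!: sets_lebesgue_Times grid_part_sets)
  have disj: "disjoint_family A"
    unfolding disjoint_family_on_def
  proof (intro ballI impI equals0I)
    fix m n z assume "m \<noteq> n" "z \<in> A m \<inter> A n"
    then have "z \<in> square_block m" "z \<in> square_block n" by (auto simp: A_def split: if_splits)
    with \<open>m \<noteq> n\<close> show False using square_block_iff by blast
  qed
  have meas: "measure ?M (A e) = (if e \<in> halting_set then 0 else 4 * (1 / 4 ^ (e + 2)))" for e
  proof (cases "e \<in> halting_set")
    case False
    have "measure ?M (A e) = measure lebesgue (A e)"
      using A_sub[of e] by (intro measure_restrict_space) auto
    also have "\<dots> = 1 / 2 ^ Suc e * (1 / 2 ^ Suc e)"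
      using False grid_part_sets by (simp only: A_def if_False measure_lebesgue_Times measure_block)
    also have "\<dots> = 4 * (1 / 4 ^ (e + 2))"
      by (simp add: power_mult_distrib[symmetric])
    finally show ?thesis using False by simp
  qed (simp add: A_def)
  \<comment> \<open>Patterned blocks have only the values 0 and 1, where the product vanishes; it is
    \<open>1/4\<close> exactly on the blocks of programs that do not halt.\<close>
  have val: "halting_graphon z * (1 - halting_graphon z) = indicator (\<Union>e. A e) z / 4" for z
  proof (cases "\<exists>e. z \<in> square_block e")
    case True
    then obtain e where e: "z \<in> square_block e" by blast
    have "z \<in> A e' \<longleftrightarrow> e' = e \<and> e \<notin> halting_set" for e'
      using square_block_iff[OF e] by (auto simp: A_def simp del: mem_Sigma_iff)
    then have "indicator (\<Union>e. A e) z = (if e \<in> halting_set then 0 else 1 :: real)"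
      by (auto simp: indicator_def)
    then show ?thesis
      using walsh_fun_cases[of "2 * (first_witness e + e + 2)" z]
      by (auto simp: halting_graphon_eq[OF e] pattern_value_def)
  next
    case False
    then have "z \<notin> (\<Union>e. A e)" by (auto simp: A_def split: if_splits)
    with False show ?thesis by (simp add: outside_blocks)
  qed
  have "edge_variance halting_graphon = measure ?M (\<Union>e. A e) / 4"
  proof -
    have "(\<Union>e. A e) \<subseteq> unit_square" using A_sub by blast
    then show ?thesis by (simp add: edge_variance_def val Int_absorb2)
  qed
  moreover have "(\<lambda>e. measure ?M (A e) / 4) sums (measure ?M (\<Union>e. A e) / 4)"
    using A_sets disj by (intro sums_divide unit_square.finite_measure_UNION) auto
  moreover have "(\<lambda>e. measure ?M (A e) / 4) = (\<lambda>e. if e \<in> halting_set then 0 else 1 / 4 ^ (e + 2))"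
    by (auto simp: meas)
  ultimately show ?thesis by (simp only:)
qed

section \<open>Continuity almost everywhere\<close>

definition dyadic_points :: "real set" where
  "dyadic_points = range (\<lambda>(i, n). real i / 2 ^ n)"

text \<open>At a non-dyadic point \<open>2 ^ n * x\<close> is not an integer, so its floor is
  locally constant; this serves all orders \<open>n\<close> at once.\<close>

lemma eventually_part_index_eq:
  assumes f: "(f \<longlongrightarrow> x) F" and x: "0 \<le> x" "x \<notin> dyadic_points"
  shows "\<forall>\<^sub>F t in F. part_index (2 ^ n) (f t) = part_index (2 ^ n) x"
proof -
  have lim: "((\<lambda>t. 2 ^ n * f t) \<longlongrightarrow> 2 ^ n * x) F" using f by (intro tendsto_intros)
  have "2 ^ n * x \<noteq> of_int \<lfloor>2 ^ n * x\<rfloor>"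
  proof
    assume eq: "2 ^ n * x = of_int \<lfloor>2 ^ n * x\<rfloor>"
    moreover have "0 \<le> \<lfloor>2 ^ n * x\<rfloor>" using x(1) by simp
    ultimately have "x = real (nat \<lfloor>2 ^ n * x\<rfloor>) / 2 ^ n" by (simp add: field_simps)
    then have "x \<in> dyadic_points" unfolding dyadic_points_def by (intro image_eqI[of _ _ "(nat \<lfloor>2 ^ n * x\<rfloor>, n)"]) auto
    with x(2) show False ..
  qed
  then have less: "of_int \<lfloor>2 ^ n * x\<rfloor> < 2 ^ n * x" "2 ^ n * x < of_int \<lfloor>2 ^ n * x\<rfloor> + 1"
    by linarith+
  show ?thesis
    using order_tendstoD(1)[OF lim less(1)] order_tendstoD(2)[OF lim less(2)]
  proof eventually_elim
    case (elim t)
    then have "\<lfloor>2 ^ n * f t\<rfloor> = \<lfloor>2 ^ n * x\<rfloor>" by (intro floor_unique) auto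
    then show ?case by (simp add: part_index_def)
  qed
qed

lemma ex_block:
  assumes "0 < x" "x < 1"
  shows "\<exists>e. x \<in> block e"
proof -
  define e where "e = (LEAST e. 1 \<le> 2 ^ Suc e * x)"
  obtain k where "1 / x < 2 ^ k" using real_arch_pow[of 2 "1 / x"] by auto
  then have "1 \<le> 2 ^ k * x" using assms(1) by (simp add: field_simps)
  then have "1 \<le> 2 ^ Suc k * x" using assms(1) by simp
  then have e: "1 \<le> 2 ^ Suc e * x" unfolding e_def by (rule LeastI)
  have "2 ^ e * x < 1"
  proof (cases e)
    case (Suc e')
    then show ?thesis using not_less_Least[of e' "\<lambda>e. 1 \<le> 2 ^ Suc e * x"] by (simp add: e_def)
  qed (use assms in simp)
  then have "\<lfloor>2 ^ Suc e * x\<rfloor> = 1" using e by (intro floor_unique) auto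
  moreover have "min 1 (2 ^ Suc e - 1) = (1 :: nat)"
  proof -
    have "1 \<le> (2 :: nat) ^ e" by simp
    then show ?thesis unfolding power_Suc by linarith
  qed
  ultimately have "part_index (2 ^ Suc e) x = 1" by (simp only: part_index_def) simp
  then show ?thesis using assms by (auto simp: grid_part_def)
qed

lemma eventually_in_block:
  assumes f: "(f \<longlongrightarrow> x) F" and x: "0 < x" "x < 1" "x \<notin> dyadic_points" "x \<in> block e"
  shows "\<forall>\<^sub>F t in F. f t \<in> block e"
  using eventually_part_index_eq[OF f less_imp_le[OF x(1)] x(3), of "Suc e"]
    order_tendstoD(1)[OF f x(1)] order_tendstoD(2)[OF f x(2)]
  by eventually_elim (use x(4) in \<open>auto simp: grid_part_def\<close>)

text \<open>Off the dyadic lines each point has a neighbourhood inside one product of blocks, where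
  only a single pattern of finite order is involved, so the graphon is locally constant there. The
  blocks accumulate only at 0, which is dyadic.\<close>

lemma ae_continuous_halting_graphon: "ae_continuous halting_graphon"
  unfolding ae_continuous_def
proof (intro bexI conjI)
  let ?N = "dyadic_points \<times> UNIV \<union> UNIV \<times> dyadic_points"
  have "countable dyadic_points" unfolding dyadic_points_def by simp
  then have "dyadic_points \<in> null_sets lebesgue"
    by (intro null_sets_completionI countable_imp_null_set_lborel)
  then have N: "?N \<in> null_sets lebesgue" by (intro null_sets.Un null_sets_lebesgue_Times_UNIV)
  then show "unit_square - ?N \<in> sets lebesgue" by (intro sets.Diff) auto
  show "emeasure lebesgue (unit_square - ?N) = 1"
    using emeasure_Diff_null_set[OF N sets_unit_square] emeasure_unit_square by simp
  show "continuous_on (unit_square - ?N) halting_graphon"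
  proof (rule continuous_at_imp_continuous_on, rule ballI)
    fix z assume "z \<in> unit_square - ?N"
    then obtain x y where z: "z = (x, y)" "x \<in> {0..1}" "y \<in> {0..1}" "x \<notin> dyadic_points" "y \<notin> dyadic_points"
      by (cases z) auto
    \<comment> \<open>No block contains 0; removing both endpoints places the coordinates in the
      open interval, which the blocks cover.\<close>
    have "0 \<in> dyadic_points" "1 \<in> dyadic_points"
      unfolding dyadic_points_def by (auto intro: image_eqI[of _ _ "(0, 0)"] image_eqI[of _ _ "(1, 0)"])
    with z have x: "0 < x" "x < 1" and y: "0 < y" "y < 1"
      by (metis atLeastAtMost_iff order_le_less)+
    obtain e where e: "x \<in> block e" using ex_block[OF x] by blast
    obtain e' where e': "y \<in> block e'" using ex_block[OF y] by blast
    \<comment> \<open>If \<open>e\<close> never halts, \<open>first_witness e\<close> is some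
      unspecified number, and asking for agreement on this grid as well does no harm.\<close>
    define m where "m = 2 * (first_witness e + e + 2)"
    have fst: "(fst \<longlongrightarrow> x) (at z)" and snd: "(snd \<longlongrightarrow> y) (at z)"
      unfolding z(1) by (auto intro: tendsto_eq_intros)
    have "\<forall>\<^sub>F z' in at z. halting_graphon z' = halting_graphon z"
      using eventually_in_block[OF fst x z(4) e] eventually_in_block[OF snd y z(5) e']
        eventually_part_index_eq[OF fst less_imp_le[OF x(1)] z(4), of m]
        eventually_part_index_eq[OF snd less_imp_le[OF y(1)] z(5), of m]
    proof eventually_elim
      case (elim z')
      show ?case
      proof (cases "e = e'")
        case True
        then have "z \<in> square_block e" "z' \<in> square_block e"
          using elim e e' z(1) by (auto simp: mem_Times_iff simp del: mem_Sigma_iff)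
        then show ?thesis
          using elim(3,4) z(1)
          by (simp add: halting_graphon_eq pattern_value_def walsh_fun_def m_def)
      next
        case False
        \<comment> \<open>Products of two different blocks are off the diagonal, where the graphon
          is 0.\<close>
        have out: "z \<notin> square_block a" and out': "z' \<notin> square_block a" for a
          unfolding mem_Times_iff z(1) fst_conv snd_conv
          using elim(1,2) e e' False block_unique by blast+
        show ?thesis using outside_blocks(2)[OF out] outside_blocks(2)[OF out'] by simp
      qed
    qed
    then show "isCont halting_graphon z"
      unfolding isCont_def by (rule tendsto_eventually)
  qed
qed auto

section \<open>A computable name\<close>

lemma recf_triangle [recf_intros]:
  assumes [recf_intros]: "recf g a"
  shows "recf g (\<lambda>x. triangle (a x))"
  unfolding triangle_def by (intro recf_intros)

text \<open>\<open>list_encode\<close> has the head outermost, so the recursion runs from the end of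
  the list: after \<open>k\<close> steps it holds the code of the last \<open>k\<close>
  entries.\<close>

lemma recf_list_encode_map [recf_intros]:
  assumes n [THEN recf_comp, recf_intros]: "recf g n"
    and f: "recf g (\<lambda>z. f (pfst z) (psnd z))"
  shows "recf g (\<lambda>x. list_encode (map (f x) [0..<n x]))"
proof -
  have f' [recf_intros]: "recf g (\<lambda>x. f (h x) (k x))" if "recf g h" "recf g k" for h k
    using recf_comp[OF f recf_pair[OF that]] by simp
  have "rec_nat 0 (\<lambda>i r. Suc (prod_encode (f x (m - Suc i), r))) k = list_encode (map (f x) [m - k..<m])"
    if "k \<le> m" for x m k
    using that
  proof (induction k)
    case (Suc k)
    then have "[m - Suc k..<m] = (m - Suc k) # [m - k..<m]"
      by (subst upt_conv_Cons) (simp_all add: Suc_diff_Suc)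
    with Suc show ?case by simp
  qed simp
  from this[OF le_refl]
  have "(\<lambda>x. list_encode (map (f x) [0..<n x]))
      = (\<lambda>x. rec_nat 0 (\<lambda>i r. Suc (prod_encode (f x (n x - Suc i), r))) (n x))" by simp
  moreover have "recf g (\<lambda>x. rec_nat 0 (\<lambda>i r. Suc (prod_encode (f x (n x - Suc i), r))) (n x))"
    by (intro recf_intros)
  ultimately show ?thesis by simp
qed

text \<open>\<open>p\<close> and \<open>q\<close> are part indices of the grid with \<open>2\<^sup>4\<^sup>j\<close> intervals, which refines the blocks \<open>e < j\<close> and the
  patterns with witness \<open>w < j\<close>.\<close>
definition in_block :: "nat \<Rightarrow> nat \<Rightarrow> nat \<Rightarrow> bool" where
  "in_block j e p \<longleftrightarrow> p div 2 ^ (4 * j - Suc e) = 1"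

definition half_cell :: "nat \<Rightarrow> nat \<Rightarrow> nat \<Rightarrow> bool" where
  "half_cell j p q \<longleftrightarrow> (\<exists>e<j. (in_block j e p \<and> in_block j e q) \<and> \<not> (\<exists>w<j. halting_witness e w))"

text \<open>The first witness is expressed by bounded quantifiers rather than by
  \<open>first_witness\<close>, so that decidability is immediate. An even
  \<open>bit_product\<close> is Walsh sign \<open>+1\<close>, that is, pattern value 1.\<close>

definition one_cell :: "nat \<Rightarrow> nat \<Rightarrow> nat \<Rightarrow> bool" where
  "one_cell j p q \<longleftrightarrow> (\<exists>e<j. (in_block j e p \<and> in_block j e q) \<and>
    (\<exists>w<j. (halting_witness e w \<and> (\<forall>i<w. \<not> halting_witness e i)) \<and>
      bit_product (2 * (w + e + 2)) (p div 2 ^ (4 * j - 2 * (w + e + 2)))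
        (q div 2 ^ (4 * j - 2 * (w + e + 2))) mod 2 = 0))"

text \<open>\<open>rat_value\<close> divides by the successor of the second component, so the codes
  stand for \<open>1/2\<close>, 1 and 0.\<close>

definition entry_code :: "nat \<Rightarrow> nat \<Rightarrow> nat \<Rightarrow> nat" where
  "entry_code j p q = (if half_cell j p q then prod_encode (1, 1)
    else if one_cell j p q then prod_encode (1, 0) else prod_encode (0, 0))"

text \<open>For \<open>q \<le> p\<close> the list position \<open>triangle p + q\<close> equals
  \<open>prod_encode (q, p - q)\<close>; hence the row is \<open>pfst i + psnd i\<close> and the
  column \<open>pfst i\<close>.\<close>

definition name_index :: "nat \<Rightarrow> nat" where
  "name_index j = prod_encode (2 ^ (4 * j) - 1,
    list_encode (map (\<lambda>i. entry_code j (pfst i + psnd i) (pfst i)) [0..<triangle (2 ^ (4 * j))]))"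

lemma recf_bit_product [recf_intros]:
  assumes [THEN recf_comp, recf_intros]: "recf g a" "recf g b" "recf g c"
  shows "recf g (\<lambda>x. bit_product (a x) (b x) (c x))"
  unfolding bit_product_def by (intro recf_intros)

lemma recf_entry_code [recf_intros]:
  assumes [THEN recf_comp, recf_intros]: "recf g a" "recf g b" "recf g c"
  shows "recf g (\<lambda>x. entry_code (a x) (b x) (c x))"
  unfolding entry_code_def half_cell_def one_cell_def in_block_def by (intro recf_intros)

lemma computable_name_index: "computable name_index"
  unfolding computable_iff_recf name_index_def by (intro recf_intros)

lemma entry_code_commute: "entry_code j p q = entry_code j q p"
  unfolding entry_code_def half_cell_def one_cell_def bit_product_def
  by (simp only: conj_commute[of "in_block j _ p"] mult.commute[of "p div _ div _ mod _"])

lemma triangle_less: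
  assumes "q \<le> p" "p < n"
  shows "triangle p + q < triangle n"
proof -
  have mono: "triangle a \<le> triangle (a + b)" for a b by (induction b) auto
  have "triangle p + q < triangle (Suc p)" using assms by simp
  also have "\<dots> \<le> triangle n" using mono[of "Suc p" "n - Suc p"] assms by simp
  finally show ?thesis .
qed

lemma step_graphon_name_index_entry:
  fixes j :: nat
  defines "n \<equiv> 2 ^ (4 * j)"
  shows "step_graphon (name_index j) (x, y) = rat_value (entry_code j (part_index n x) (part_index n y))"
proof -
  have n: "0 < n" by (simp add: n_def)
  let ?p = "part_index n x" and ?q = "part_index n y"
  let ?a = "max ?p ?q" and ?b = "min ?p ?q"
  have ab: "?b \<le> ?a" "?a < n" using part_index_less[OF n] by auto
  have "prod_encode (?b, ?a - ?b) = triangle ?a + ?b"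
    using ab(1) by (simp add: prod_encode_def)
  then have dec: "prod_decode (triangle ?a + ?b) = (?b, ?a - ?b)"
    using prod_encode_inverse[of "(?b, ?a - ?b)"] by simp
  have "step_graphon (name_index j) (x, y) = rat_value (entry_code j ?a ?b)"
    using triangle_less[OF ab] dec n ab(1)
    by (simp add: step_graphon_def name_index_def Let_def n_def[symmetric])
  also have "entry_code j ?a ?b = entry_code j ?p ?q"
    by (simp add: max_def min_def entry_code_commute)
  finally show ?thesis .
qed

lemma rat_value_encode: "rat_value (prod_encode (a, b)) = min 1 (real a / real (Suc b))"
  by (simp add: rat_value_def)

lemma step_graphon_name_index:
  assumes "z \<in> unit_square"
  shows "step_graphon (name_index j) z = stage j z"
proof -
  obtain x y where z: "z = (x, y)" "x \<in> {0..1}" "y \<in> {0..1}" using assms by auto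
  define p where "p = part_index (2 ^ (4 * j)) x"
  define q where "q = part_index (2 ^ (4 * j)) y"
  have in_block: "in_block j e p \<and> in_block j e q \<longleftrightarrow> z \<in> square_block e" if "e < j" for e
    using that z part_index_coarsen[of "Suc e" "4 * j"]
    by (simp add: in_block_def p_def q_def grid_part_def)
  have eq: "step_graphon (name_index j) z = rat_value (entry_code j p q)"
    unfolding z(1) p_def q_def by (rule step_graphon_name_index_entry)
  have half: "half_cell j p q \<longleftrightarrow> (\<exists>e<j. z \<in> square_block e \<and> \<not> found e j)"
    unfolding half_cell_def found_def using in_block by meson
  have one: "one_cell j p q \<longleftrightarrow> (\<exists>e<j. z \<in> square_block e \<and> (\<exists>w<j. (halting_witness e w \<and> (\<forall>i<w. \<not> halting_witness e i)) \<and>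
      bit_product (2 * (w + e + 2)) (p div 2 ^ (4 * j - 2 * (w + e + 2)))
        (q div 2 ^ (4 * j - 2 * (w + e + 2))) mod 2 = 0))"
    unfolding one_cell_def using in_block by meson
  show ?thesis
  proof (cases "\<exists>e<j. z \<in> square_block e")
    case False
    then have "entry_code j p q = prod_encode (0, 0)"
      unfolding entry_code_def half one by auto
    moreover have "stage j z = 0"
      using False by (auto simp: stage_def indicator_def intro!: sum.neutral)
    ultimately show ?thesis by (simp only: eq rat_value_encode)
  next
    case True
    then obtain e where e: "e < j" "z \<in> square_block e" by meson
    have uniq: "z \<in> square_block e' \<longleftrightarrow> e' = e" for e' using square_block_iff[OF e(2)] .
    show ?thesis
    proof (cases "found e j")
      case False
      then have "entry_code j p q = prod_encode (1, 1)"
        unfolding entry_code_def half uniq using e(1) by auto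
      then show ?thesis
        using False e by (simp add: eq rat_value_encode stage_eq pattern_value_def del: mem_Sigma_iff)
    next
      case True
      define w where "w = first_witness e"
      have w: "halting_witness e w" "\<forall>i<w. \<not> halting_witness e i" "w < j"
      proof -
        obtain v where v: "v < j" "halting_witness e v" using True by (auto simp: found_def)
        show "halting_witness e w" unfolding w_def first_witness_def using v(2) by (rule LeastI)
        show "\<forall>i<w. \<not> halting_witness e i" unfolding w_def first_witness_def using not_less_Least by blast
        have "w \<le> v" unfolding w_def first_witness_def using v(2) by (rule Least_le)
        with v(1) show "w < j" by simp
      qed
      have w_uniq: "halting_witness e v \<and> (\<forall>i<v. \<not> halting_witness e i) \<longleftrightarrow> v = w" for v
        using w(1,2) by (metis linorder_neqE_nat)
      define m where "m = 2 * (w + e + 2)"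
      \<comment> \<open>With \<open>w\<close> and \<open>e\<close> at most \<open>j - 1\<close>, the
        exponent \<open>2 * (w + e + 2)\<close> can reach \<open>4 * j\<close> but not exceed it;
        this determines the grid of stage \<open>j\<close>.\<close>
      have m: "m \<le> 4 * j" using w(3) e(1) by (simp add: m_def)
      have not_half: "\<not> half_cell j p q" unfolding half uniq using True by blast
      have "one_cell j p q \<longleftrightarrow> bit_product m (p div 2 ^ (4 * j - m)) (q div 2 ^ (4 * j - m)) mod 2 = 0"
      proof -
        have "(\<exists>e'<j. e' = e \<and> P e') \<longleftrightarrow> P e" "(\<exists>v<j. v = w \<and> P v) \<longleftrightarrow> P w" for P
          using e(1) w(3) by auto
        then show ?thesis by (simp only: one uniq w_uniq m_def)
      qed
      also have "\<dots> \<longleftrightarrow> even (bit_product m (part_index (2 ^ m) x) (part_index (2 ^ m) y))"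
        using part_index_coarsen[OF m] by (simp add: p_def q_def even_iff_mod_2_eq_zero)
      finally have one_iff: "one_cell j p q \<longleftrightarrow> even (bit_product m (part_index (2 ^ m) x) (part_index (2 ^ m) y))" .
      have "stage j z = (1 + walsh_fun m z) / 2"
        using e True by (simp add: stage_eq pattern_value_def m_def w_def del: mem_Sigma_iff)
      then show ?thesis
        unfolding eq using one_iff not_half
        by (auto simp: entry_code_def rat_value_encode walsh_fun_def walsh_def z(1))
    qed
  qed
qed

lemma is_name_name_index: "is_name cut_dist name_index halting_graphon"
  unfolding is_name_def
proof (intro conjI allI impI)
  have "cut_dist (step_graphon (name_index j)) (step_graphon (name_index l)) = cut_dist (stage j) (stage l)" for j l
    unfolding cut_dist_def by (rule cut_norm_cong) (simp only: step_graphon_name_index)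
  then show "cut_dist (step_graphon (name_index j)) (step_graphon (name_index l)) \<le> 1 / 2 ^ j" if "j < l" for j l
    using stage_cut_dist[OF that] by simp
  have "cut_dist (step_graphon (name_index j)) halting_graphon = cut_dist (stage j) halting_graphon" for j
    unfolding cut_dist_def by (rule cut_norm_cong) (simp only: step_graphon_name_index)
  then show "(\<lambda>j. cut_dist (step_graphon (name_index j)) halting_graphon) \<longlonglongrightarrow> 0"
    using stage_cut_dist_tendsto by simp
qed

section \<open>Decoding the halting set\<close>

text \<open>A nonempty list is coded as the successor of the pair of head and tail. The empty list
  is 0, and \<open>0 - 1 = 0\<close> decodes to two zeros, so reading beyond the end stays at 0, the
  default entry of \<open>step_graphon\<close>.\<close>

definition nth_code :: "nat \<Rightarrow> nat \<Rightarrow> nat" where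
  "nth_code c k = pfst (rec_nat c (\<lambda>_ r. psnd (r - 1)) k - 1)"

lemma nth_code_eq: "nth_code c k = (if k < length (list_decode c) then list_decode c ! k else 0)"
proof -
  have "prod_decode 0 = (0, 0)"
    using prod_encode_inverse[of "(0, 0)"] by (simp add: prod_encode_def)
  then have tl: "psnd (list_encode xs - 1) = list_encode (tl xs)"
    and hd: "pfst (list_encode xs - 1) = (if xs = [] then 0 else List.hd xs)" for xs
    by (cases xs; simp)+
  have "rec_nat c (\<lambda>_ r. psnd (r - 1)) k = list_encode (drop k (list_decode c))"
    by (induction k) (simp_all only: old.nat.simps drop_0 list_decode_inverse tl drop_Suc tl_drop)
  then have "nth_code c k = (if drop k (list_decode c) = [] then 0 else List.hd (drop k (list_decode c)))"
    by (simp only: nth_code_def hd)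
  then show ?thesis by (simp add: hd_drop_conv_nth)
qed

section \<open>Evaluating the edge variance of step graphons in natural numbers\<close>

definition cell_code :: "nat \<Rightarrow> nat \<Rightarrow> nat \<Rightarrow> nat" where
  "cell_code i p q = nth_code (psnd i)
    (if p \<le> q then triangle q + p else triangle p + q)"

lemma step_graphon_cell_code:
  "step_graphon i (x, y)
    = rat_value (cell_code i (part_index (Suc (pfst i)) x) (part_index (Suc (pfst i)) y))"
proof -
  \<comment> \<open>The default code 0 from \<open>nth_code\<close> must denote the default value
    0.\<close>
  have "rat_value 0 = 0"
    using rat_value_encode[of 0 0] by (simp add: prod_encode_def)
  then show ?thesis
    by (simp add: step_graphon_def cell_code_def nth_code_eq Let_def max_def min_def split: prod.split)
qed

text \<open>This is \<open>K\<close> times the sum of \<open>v * (1 - v)\<close> over the cell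
  values \<open>v\<close>, each term rounded down. Truncated subtraction gives 0 for fractions above
  1, in accordance with their clipping to 1 in \<open>rat_value\<close>.\<close>

definition scaled_variance :: "nat \<Rightarrow> nat \<Rightarrow> nat" where
  "scaled_variance i K = (\<Sum>p<Suc (pfst i). \<Sum>q<Suc (pfst i).
    (K * (pfst (cell_code i p q) * (Suc (psnd (cell_code i p q)) - pfst (cell_code i p q))))
      div (Suc (psnd (cell_code i p q))) ^ 2)"

lemma recf_scaled_variance [recf_intros]:
  assumes [THEN recf_comp, recf_intros]: "recf g a" "recf g b"
  shows "recf g (\<lambda>x. scaled_variance (a x) (b x))"
proof -
  have [recf_intros]: "recf g (\<lambda>x. cell_code (u x) (v x) (w x))"
    if [THEN recf_comp, recf_intros]: "recf g u" "recf g v" "recf g w" for u v w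
    unfolding cell_code_def nth_code_def by (intro recf_intros)
  show ?thesis unfolding scaled_variance_def by (intro recf_intros)
qed

lemma rat_value_variance:
  "rat_value c * (1 - rat_value c) = real (pfst c * (Suc (psnd c) - pfst c)) / real (Suc (psnd c)) ^ 2"
proof (cases "pfst c \<le> Suc (psnd c)")
  case True
  then have "rat_value c = real (pfst c) / real (Suc (psnd c))"
    by (simp add: rat_value_def case_prod_beta min_def)
  moreover have "a / b * (1 - a / b) = a * (b - a) / b ^ 2" if "b \<noteq> 0" for a b :: real
    using that by (simp add: field_simps power2_eq_square)
  ultimately show ?thesis using True by (simp add: of_nat_diff)
next
  case False
  then have "rat_value c = 1"
    by (simp add: rat_value_def case_prod_beta min_def field_simps)
  then show ?thesis using False by simp
qed

lemma nat_div_bounds: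
  "real a / real b - 1 \<le> real (a div b)" "real (a div b) \<le> real a / real b"
  using floor_divide_of_nat_eq[of a b, where ?'a = real] by linarith+

lemma edge_variance_step_graphon:
  fixes i :: nat
  defines "n \<equiv> Suc (pfst i)"
  shows "edge_variance (step_graphon i)
    = (\<Sum>p<n. \<Sum>q<n. rat_value (cell_code i p q) * (1 - rat_value (cell_code i p q))) / real n ^ 2"
proof -
  let ?c = "\<lambda>p q. rat_value (cell_code i p q) * (1 - rat_value (cell_code i p q))"
  have n: "0 < n" by (simp add: n_def)
  \<comment> \<open>The indicator of the whole square is inserted to match
    \<open>integral_step_rectangle\<close>.\<close>
  have "edge_variance (step_graphon i)
      = (\<integral>z. indicator unit_square z * ?c (part_index n (fst z)) (part_index n (snd z)) \<partial>unit_square_measure)"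
    unfolding edge_variance_def
  proof (rule Bochner_Integration.integral_cong[OF refl])
    fix z :: "real \<times> real" assume "z \<in> space unit_square_measure"
    then have "z \<in> unit_square" by simp
    then show "step_graphon i z * (1 - step_graphon i z)
        = indicator unit_square z * ?c (part_index n (fst z)) (part_index n (snd z))"
      using step_graphon_cell_code[of i "fst z" "snd z"] by (simp add: n_def)
  qed
  also have "\<dots> = (\<Sum>p<n. \<Sum>q<n. ?c p q *
      (measure lebesgue ({0..1} \<inter> grid_part n p) * measure lebesgue ({0..1} \<inter> grid_part n q)))"
    by (rule integral_step_rectangle[OF n]) auto
  also have "\<dots> = (\<Sum>p<n. \<Sum>q<n. ?c p q * (1 / real n * (1 / real n)))"
    using grid_part_sets(2)[of n] by (intro sum.cong refl) (simp add: Int_absorb1 measure_grid_part)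
  also have "\<dots> = (\<Sum>p<n. \<Sum>q<n. ?c p q) / real n ^ 2"
    by (simp add: sum_divide_distrib power2_eq_square)
  finally show ?thesis .
qed

text \<open>Rounding loses at most 1 in each of the \<open>n^2\<close> cells, and the total is
  divided by \<open>K * n^2\<close>.\<close>

lemma scaled_variance_bounds:
  fixes i K :: nat
  assumes K: "0 < K"
  shows "\<bar>real (scaled_variance i K) / (real K * real (Suc (pfst i)) ^ 2) - edge_variance (step_graphon i)\<bar> \<le> 1 / real K"
proof -
  let ?n = "Suc (pfst i)"
  let ?c = "\<lambda>p q. rat_value (cell_code i p q) * (1 - rat_value (cell_code i p q))"
  define t where "t p q = (K * (pfst (cell_code i p q) * (Suc (psnd (cell_code i p q)) - pfst (cell_code i p q))))
      div (Suc (psnd (cell_code i p q))) ^ 2" for p q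
  have t: "real K * ?c p q - 1 \<le> real (t p q)" "real (t p q) \<le> real K * ?c p q" for p q
  proof -
    have "real K * ?c p q = real (K * (pfst (cell_code i p q) * (Suc (psnd (cell_code i p q)) - pfst (cell_code i p q))))
        / real (Suc (psnd (cell_code i p q)) ^ 2)"
      unfolding rat_value_variance by simp
    then show "real K * ?c p q - 1 \<le> real (t p q)" "real (t p q) \<le> real K * ?c p q"
      unfolding t_def by (simp_all only: nat_div_bounds)
  qed
  define C where "C = (\<Sum>p<?n. \<Sum>q<?n. ?c p q)"
  have F: "real (scaled_variance i K) = (\<Sum>p<?n. \<Sum>q<?n. real (t p q))"
    by (simp only: scaled_variance_def t_def of_nat_sum)
  have "real (scaled_variance i K) \<le> (\<Sum>p<?n. \<Sum>q<?n. real K * ?c p q)"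
    unfolding F by (intro sum_mono t)
  also have "\<dots> = real K * C" by (simp only: C_def sum_distrib_left)
  finally have upper: "real (scaled_variance i K) \<le> real K * C" .
  have "real K * C - real ?n ^ 2 = (\<Sum>p<?n. \<Sum>q<?n. real K * ?c p q - 1)"
    by (simp only: C_def sum_subtractf sum_distrib_left) (simp add: power2_eq_square)
  also have "\<dots> \<le> real (scaled_variance i K)"
    unfolding F by (intro sum_mono t)
  finally have lower: "real K * C - real ?n ^ 2 \<le> real (scaled_variance i K)" .
  have ev: "edge_variance (step_graphon i) = C / real ?n ^ 2"
    unfolding C_def by (rule edge_variance_step_graphon)
  define m where "m = real ?n ^ 2"
  have m: "0 < m" by (simp add: m_def)
  have "real (scaled_variance i K) / (real K * m) \<le> C / m"
    using upper m K by (simp add: field_simps)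
  moreover have "C / m - 1 / real K \<le> real (scaled_variance i K) / (real K * m)"
  proof -
    have "C / m - 1 / real K = (real K * C - m) / (real K * m)"
      using m K by (simp add: field_simps)
    also have "\<dots> \<le> real (scaled_variance i K) / (real K * m)"
      using lower m unfolding m_def[symmetric] by (intro divide_right_mono) auto
    finally show ?thesis .
  qed
  ultimately show ?thesis unfolding ev m_def[symmetric] by (simp add: abs_le_iff)
qed

text \<open>A name comes with a rate only between its own members; the Lipschitz bound for
  \<open>l > j\<close> is carried over to \<open>V\<close> by letting \<open>l\<close> tend to
  infinity.\<close>

lemma is_name_edge_variance:
  assumes V: "graphon V" and k: "is_name L1_dist k V"
  shows "\<bar>edge_variance (step_graphon (k j)) - edge_variance V\<bar> \<le> 1 / 2 ^ j"
proof -
  let ?v = "\<lambda>l. edge_variance (step_graphon (k l))"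
  have "(\<lambda>l. ?v l - edge_variance V) \<longlonglongrightarrow> 0"
  proof (rule tendsto_rabs_zero_cancel, rule tendsto_sandwich[OF _ _ tendsto_const])
    show "\<forall>\<^sub>F l in sequentially. \<bar>?v l - edge_variance V\<bar> \<le> L1_dist (step_graphon (k l)) V"
      by (intro always_eventually allI edge_variance_L1_dist graphon_step_graphon V)
    show "(\<lambda>l. L1_dist (step_graphon (k l)) V) \<longlonglongrightarrow> 0"
      using k by (simp add: is_name_def)
  qed simp
  then have "?v \<longlonglongrightarrow> edge_variance V" by (simp add: LIM_zero_iff)
  then have "(\<lambda>l. \<bar>?v j - ?v l\<bar>) \<longlonglongrightarrow> \<bar>?v j - edge_variance V\<bar>"
    by (intro tendsto_intros)
  then show ?thesis
  proof (rule tendsto_upperbound)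
    show "\<forall>\<^sub>F l in sequentially. \<bar>?v j - ?v l\<bar> \<le> 1 / 2 ^ j"
      using eventually_gt_at_top[of j]
    proof eventually_elim
      case (elim l)
      have "\<bar>?v j - ?v l\<bar> \<le> L1_dist (step_graphon (k j)) (step_graphon (k l))"
        by (intro edge_variance_L1_dist graphon_step_graphon)
      also have "\<dots> \<le> 1 / 2 ^ j" using k elim by (simp add: is_name_def)
      finally show ?case .
    qed
  qed simp
qed

text \<open>Multiplication by \<open>16 * 4^e\<close> moves digit \<open>e\<close> to the units
  place and makes all earlier terms multiples of 4. The later digits, being at most 1, add up to at
  most \<open>1/4 + 1/16 + ... = 1/3\<close>, which keeps the number away from the next
  integer.\<close>

lemma base_four_digit:
  fixes d :: "nat \<Rightarrow> nat"
  assumes d: "\<And>i. d i \<le> 1" and r: "(\<lambda>i. real (d i) / 4 ^ (i + 2)) sums r"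
  obtains n \<theta> where "16 * 4 ^ e * r = real n + \<theta>" "0 \<le> \<theta>" "\<theta> \<le> 1 / 3" "n mod 4 = d e"
proof -
  define s where "s = r - (\<Sum>i<Suc e. real (d i) / 4 ^ (i + 2))"
  have s: "(\<lambda>i. real (d (i + Suc e)) / 4 ^ (i + Suc e + 2)) sums s"
    unfolding s_def by (rule sums_split_initial_segment[OF r])
  have "(\<lambda>i. (1 / 4) ^ i) sums (1 / (1 - 1 / 4 :: real))" by (rule geometric_sums) simp
  from sums_divide[OF this, of "4 ^ (e + 3)"]
  have g: "(\<lambda>i. (1 / 4) ^ i / 4 ^ (e + 3)) sums (4 / 3 / 4 ^ (e + 3) :: real)" by simp
  have "0 \<le> s"
    using sums_le[OF _ sums_zero s] by simp
  moreover have "s \<le> 4 / 3 / 4 ^ (e + 3)"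
  proof (rule sums_le[OF _ s g])
    fix i
    have "real (d (i + Suc e)) / 4 ^ (i + Suc e + 2) \<le> 1 / 4 ^ (i + Suc e + 2)"
      using d[of "i + Suc e"] by (intro divide_right_mono) auto
    also have "\<dots> = (1 / 4) ^ i / 4 ^ (e + 3)"
      by (simp add: power_add power_divide)
    finally show "real (d (i + Suc e)) / 4 ^ (i + Suc e + 2) \<le> (1 / 4) ^ i / 4 ^ (e + 3)" .
  qed
  ultimately have \<theta>: "0 \<le> 16 * 4 ^ e * s" "16 * 4 ^ e * s \<le> 1 / 3"
    by (simp_all add: field_simps power_add)
  define n where "n = (\<Sum>i<e. d i * 4 ^ (e - i)) + d e"
  have "16 * 4 ^ e * (real (d i) / 4 ^ (i + 2)) = real (d i * 4 ^ (e - i))" if "i \<le> e" for i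
  proof -
    have "(4 :: real) ^ e = 4 ^ i * 4 ^ (e - i)" using that by (simp flip: power_add)
    then show ?thesis by (simp add: power_add)
  qed
  then have "16 * 4 ^ e * (\<Sum>i<Suc e. real (d i) / 4 ^ (i + 2)) = real n"
    unfolding n_def sum_distrib_left by simp
  then have "16 * 4 ^ e * r = real n + 16 * 4 ^ e * s"
    by (simp add: s_def algebra_simps)
  moreover have "n mod 4 = d e"
  proof -
    have "4 dvd (\<Sum>i<e. d i * 4 ^ (e - i))"
      by (intro dvd_sum dvd_mult dvd_power) auto
    then show ?thesis unfolding n_def using d[of e] by (auto elim!: dvdE)
  qed
  ultimately show ?thesis using that \<theta> by blast
qed

lemma computes_halting_set:
  assumes V: "graphon V" and UV: "weakly_isomorphic halting_graphon V" and k: "is_name L1_dist k V"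
  shows "computes_set k halting_set"
proof -
  \<comment> \<open>The name and the rounding each contribute an error of at most
    \<open>4^-(e+4)\<close>; scaled by \<open>16 * 4^e\<close> the two together amount to
    \<open>1/8\<close>.\<close>
  define K where "K e = (4 :: nat) ^ (e + 4)" for e
  define i where "i e = k (2 * e + 8)" for e
  define D where "D e = K e * Suc (pfst (i e)) ^ 2" for e
  \<comment> \<open>\<open>16 * 4\<^sup>e\<close> times the edge variance of \<open>V\<close> has fractional part at most \<open>1/3\<close> and is approximated
    within \<open>1/8\<close>, so adding \<open>1/3\<close> before rounding down gives the exact integer part.\<close>
  define a where "a e = (48 * 4 ^ e * scaled_variance (i e) (K e) + D e) div (3 * D e)" for e
  have "a e mod 4 = (if e \<in> halting_set then 0 else 1)" for e
  proof -
    have D: "real (D e) = real (K e) * real (Suc (pfst (i e))) ^ 2" "0 < D e"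
      by (simp_all add: D_def K_def)
    define F where "F = real (scaled_variance (i e) (K e)) / real (D e)"
    have "(\<lambda>e. real (if e \<in> halting_set then 0 else 1) / 4 ^ (e + 2)) sums edge_variance V"
      using edge_variance_halting_graphon
        weakly_isomorphic_edge_variance[OF graphon_halting_graphon V UV]
      by (simp add: if_distrib[of "\<lambda>x. real x / _"] cong: if_cong)
    then obtain n \<theta> where n: "16 * 4 ^ e * edge_variance V = real n + \<theta>" "0 \<le> \<theta>" "\<theta> \<le> 1 / 3"
      "n mod 4 = (if e \<in> halting_set then 0 else 1)"
      by (rule base_four_digit[rotated, where e = e]) auto
    have "\<bar>F - edge_variance (step_graphon (i e))\<bar> \<le> 1 / real (K e)"
      unfolding F_def D(1) by (rule scaled_variance_bounds) (simp add: K_def)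
    moreover have "\<bar>edge_variance (step_graphon (i e)) - edge_variance V\<bar> \<le> 1 / 2 ^ (2 * e + 8)"
      unfolding i_def by (rule is_name_edge_variance[OF V k])
    moreover have "1 / 2 ^ (2 * e + 8) = 1 / real (K e)"
      by (simp add: K_def power_add power_mult)
    ultimately have "\<bar>F - edge_variance V\<bar> \<le> 2 / real (K e)" by linarith
    then have "16 * 4 ^ e * \<bar>F - edge_variance V\<bar> \<le> 16 * 4 ^ e * (2 / real (K e))"
      by (intro mult_left_mono) auto
    also have "\<dots> = 1 / 8" by (simp add: K_def power_add)
    finally have "\<bar>16 * 4 ^ e * F - 16 * 4 ^ e * edge_variance V\<bar> \<le> 1 / 8"
      by (simp add: abs_mult right_diff_distrib[symmetric])
    \<comment> \<open>The bounds follow from \<open>1/3 - 1/8 \<ge> 0\<close> and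
      \<open>1/3 + 1/8 + 1/3 < 1\<close>.\<close>
    then have "real n \<le> 16 * 4 ^ e * F + 1 / 3" "16 * 4 ^ e * F + 1 / 3 < real n + 1"
      using n(1-3) by linarith+
    moreover have "real (48 * 4 ^ e * scaled_variance (i e) (K e) + D e) / real (3 * D e) = 16 * 4 ^ e * F + 1 / 3"
      using D(2) by (simp add: F_def field_simps)
    ultimately have "\<lfloor>real (48 * 4 ^ e * scaled_variance (i e) (K e) + D e) / real (3 * D e)\<rfloor> = int n"
      by (intro floor_unique) auto
    then have "a e = n" unfolding a_def floor_divide_of_nat_eq by simp
    with n(4) show ?thesis by simp
  qed
  then have "(\<lambda>e. if a e mod 4 = 0 then 1 else 0) = (\<lambda>e. if e \<in> halting_set then 1 else 0 :: nat)"
    by (auto simp: fun_eq_iff)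
  moreover have "recf k (\<lambda>e. if a e mod 4 = 0 then 1 else 0)"
    unfolding a_def D_def i_def K_def by (intro recf_intros recf_oracle)
  ultimately have "recf k (\<lambda>e. if e \<in> halting_set then 1 else 0)" by (simp only:)
  then show ?thesis unfolding computes_set_def recf_def .
qed

theorem theorem5p1:
  shows "\<exists>U. graphon U \<and> ae_continuous U \<and>
    (\<exists>k. computable k \<and> is_name cut_dist k U) \<and>
    (\<forall>V. graphon V \<and> weakly_isomorphic U V \<longrightarrow>
      (\<forall>k. is_name L1_dist k V \<longrightarrow> computes_set k halting_set))"
  using graphon_halting_graphon ae_continuous_halting_graphon computable_name_index
    is_name_name_index computes_halting_set by blast

end
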